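(* Let $n\ge 2$, $0\le m\le n$, let $P=(p_{jk})$ be an $n\times n$-matrix with real entries and let $W=(w_{jk})$ be the matrix with entries $w_{jk}=\mathrm{sgn}|p_{jk}|$ (i.e. $w_{jk}=1$ if $p_{jk}\neq 0$ and $w_{jk}=0$ otherwise). Then the following statements are equivalent: (i) the problem $$\partial_t u_j + a_j(x,t)\partial_x u_j + b_j(x,t)u_j = 0,\quad 0<x<1,\ t>0,\ j\le n,$$ $$u_j(0,t) = \sum_{k=1}^m p_{jk}u_k(1,t)+\sum_{k=m+1}^n p_{jk}u_k(0,t),\quad t\ge 0,\ 1\le j\le m,$$ $$u_j(1,t) = \sum_{k=1}^m p_{jk}u_k(1,t)+\sum_{k=m+1}^n p_{jk}u_k(0,t),\quad t\ge 0,\ m<j\le n,$$ $$u_j(x,0)=\varphi_j(x),\quad 0\le x\le 1,\ j\le n,$$ is robust finite time stabilizable; (ii) the products $w_{i_1i_2}w_{i_2i_3}\cdots w_{i_ni_{n+1}}$ equal zero for all tuples $(i_1,\dots,i_{n+1})\in\{1,\dots,n\}^{n+1}$; (iii) all principal minors of the matrix $W$ equal zero; (iv) the matrix $W$ is nilpotent, with $W^n=0$.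
   Context: Let $\Pi=\{(x,t): 0\le x\le 1,\ 0\le t<\infty\}$. All functions are real-valued; $L^2(0,1)^n$ is normed by $\|u\|=\max_{j\le n}\|u_j\|_{L^2(0,1)}$. Admissible coefficients: (a) there is $a>0$ with $a_j\ge a$ on $\Pi$ for $1\le j\le m$ and $a_j\le -a$ on $\Pi$ for $m+1\le j\le n$; (b) $a_j,b_j\in C^1(\Pi)$ are bounded in $\Pi$ together with their first order derivatives. $C_0^\infty([0,1])$ is the space of functions in $C^\infty([0,1])$ with support within $(0,1)$. For admissible coefficients and $\varphi\in C_0^\infty([0,1])^n$ the problem has a unique classical $C^1$-solution in $\Pi$. For $\varphi\in L^2(0,1)^n$, a function $u\in C([0,\infty),L^2(0,1))^n$ is an $L^2$-generalized solution if for any sequence $\varphi^l\in C_0^\infty([0,1])^n$ with $\varphi^l\to\varphi$ in $L^2(0,1)^n$, the classical $C^1$-solutions $u^l$ with initial data $\varphi^l$ satisfy $\|u(\cdot,t)-u^l(\cdot,t)\|_{L^2(0,1)^n}\to 0$ as $l\to\infty$, uniformly in $t\in[0,T]$ for each $T>0$. For every $\varphi\in L^2(0,1)^n$ there is a unique $L^2$-generalized solution. The problem is finite time stabilizable (FTS) if there exists $T_e>0$ such that for every $\varphi\in L^2(0,1)^n$ the $L^2$-generalized solution is zero for all $t>T_e$. It is robust FTS if it is FTS for any admissible coefficients $a_j,b_j$ (with $m$ and $P$ fixed). A principal minor of an $n\times n$ matrix is the determinant of its restriction to the rows and columns with the same set of indices $j_1<\dots<j_l$, $1\le l\le n$. 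*)

theory Defs
  imports
    "HOL-Analysis.Analysis"
    "Jordan_Normal_Form.Determinant"
    "Jordan_Normal_Form.DL_Submatrix"
begin

text \<open>
  All component and matrix indices are shifted by one: components are numbered
  \<open>0, \<dots>, n - 1\<close>, and the first \<open>m\<close> of them (those with \<open>j < m\<close>) have positive speed.
\<close>

definition strip :: "(real \<times> real) set" where
  "strip = {0..1} \<times> {0..}"

text \<open>Partial derivatives on the closed strip; they are one-sided on its boundary.\<close>

definition partial_x :: "(real \<Rightarrow> real \<Rightarrow> real) \<Rightarrow> real \<Rightarrow> real \<Rightarrow> real" where
  "partial_x f x t = vector_derivative (\<lambda>y. f y t) (at x within {0..1})"

definition partial_t :: "(real \<Rightarrow> real \<Rightarrow> real) \<Rightarrow> real \<Rightarrow> real \<Rightarrow> real" where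
  "partial_t f x t = vector_derivative (\<lambda>s. f x s) (at t within {0..})"

definition C1_strip :: "(real \<Rightarrow> real \<Rightarrow> real) \<Rightarrow> bool" where
  "C1_strip f \<longleftrightarrow>
     (\<forall>(x, t) \<in> strip.
        (\<lambda>y. f y t) differentiable (at x within {0..1}) \<and>
        (\<lambda>s. f x s) differentiable (at t within {0..})) \<and>
     continuous_on strip (\<lambda>(x, t). f x t) \<and>
     continuous_on strip (\<lambda>(x, t). partial_x f x t) \<and>
     continuous_on strip (\<lambda>(x, t). partial_t f x t)"

definition bounded_on_strip :: "(real \<Rightarrow> real \<Rightarrow> real) \<Rightarrow> bool" where
  "bounded_on_strip f \<longleftrightarrow> bounded ((\<lambda>(x, t). f x t) ` strip)"

text \<open>In the next definition \<open>D k\<close> is the \<open>k\<close>-th derivative of \<open>f\<close> on \<open>[0, 1]\<close>, one-sided at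
  the end points.\<close>

definition Cinf_unit :: "(real \<Rightarrow> real) \<Rightarrow> bool" where
  "Cinf_unit f \<longleftrightarrow>
     (\<exists>D :: nat \<Rightarrow> real \<Rightarrow> real. D 0 = f \<and>
        (\<forall>k. \<forall>x \<in> {0..1}. (D k has_real_derivative D (Suc k) x) (at x within {0..1})))"

definition C0inf_unit :: "(real \<Rightarrow> real) \<Rightarrow> bool" where
  "C0inf_unit f \<longleftrightarrow> Cinf_unit f \<and> closure {x \<in> {0..1}. f x \<noteq> 0} \<subseteq> {0<..<1}"

text \<open>Elements of \<open>L\<^sup>2(0, 1)\<close> are represented by functions on the real line, of which only the
  restriction to \<open>(0, 1)\<close> matters, up to null sets.\<close>

definition L2_unit :: "(real \<Rightarrow> real) \<Rightarrow> bool" where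
  "L2_unit f \<longleftrightarrow>
     f \<in> borel_measurable (lebesgue_on {0<..<1}) \<and>
     integrable (lebesgue_on {0<..<1}) (\<lambda>x. (f x)\<^sup>2)"

definition L2_norm_unit :: "(real \<Rightarrow> real) \<Rightarrow> real" where
  "L2_norm_unit f = sqrt (integral\<^sup>L (lebesgue_on {0<..<1}) (\<lambda>x. (f x)\<^sup>2))"

definition L2_norm_vec :: "nat \<Rightarrow> (nat \<Rightarrow> real \<Rightarrow> real) \<Rightarrow> real" where
  "L2_norm_vec n f = Max ((\<lambda>j. L2_norm_unit (f j)) ` {..<n})"

definition L2_continuous :: "(real \<Rightarrow> real \<Rightarrow> real) \<Rightarrow> bool" where
  "L2_continuous U \<longleftrightarrow>
     (\<forall>t \<ge> 0. L2_unit (U t)) \<and>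
     (\<forall>t \<ge> 0. ((\<lambda>s. L2_norm_unit (\<lambda>x. U s x - U t x)) \<longlongrightarrow> 0) (at t within {0..}))"

definition admissible ::
  "nat \<Rightarrow> nat \<Rightarrow> (nat \<Rightarrow> real \<Rightarrow> real \<Rightarrow> real) \<Rightarrow> (nat \<Rightarrow> real \<Rightarrow> real \<Rightarrow> real) \<Rightarrow> bool" where
  "admissible n m a b \<longleftrightarrow>
     (\<exists>\<alpha>>0. \<forall>(x, t) \<in> strip.
        (\<forall>j<m. \<alpha> \<le> a j x t) \<and> (\<forall>j\<in>{m..<n}. a j x t \<le> - \<alpha>)) \<and>
     (\<forall>j<n. \<forall>f \<in> {a j, b j}.
        C1_strip f \<and> bounded_on_strip f \<and>
        bounded_on_strip (partial_x f) \<and> bounded_on_strip (partial_t f))"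

definition boundary_op ::
  "nat \<Rightarrow> nat \<Rightarrow> real mat \<Rightarrow> (nat \<Rightarrow> real \<Rightarrow> real \<Rightarrow> real) \<Rightarrow> nat \<Rightarrow> real \<Rightarrow> real" where
  "boundary_op n m P u j t =
     (\<Sum>k<m. P $$ (j, k) * u k 1 t) + (\<Sum>k=m..<n. P $$ (j, k) * u k 0 t)"

definition classical_solution ::
  "nat \<Rightarrow> nat \<Rightarrow> real mat \<Rightarrow> (nat \<Rightarrow> real \<Rightarrow> real \<Rightarrow> real) \<Rightarrow> (nat \<Rightarrow> real \<Rightarrow> real \<Rightarrow> real) \<Rightarrow>
   (nat \<Rightarrow> real \<Rightarrow> real) \<Rightarrow> (nat \<Rightarrow> real \<Rightarrow> real \<Rightarrow> real) \<Rightarrow> bool" where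
  "classical_solution n m P a b \<phi> u \<longleftrightarrow>
     (\<forall>j<n. C1_strip (u j)) \<and>
     (\<forall>j<n. \<forall>x\<in>{0<..<1}. \<forall>t>0.
        partial_t (u j) x t + a j x t * partial_x (u j) x t + b j x t * u j x t = 0) \<and>
     (\<forall>j<m. \<forall>t\<ge>0. u j 0 t = boundary_op n m P u j t) \<and>
     (\<forall>j\<in>{m..<n}. \<forall>t\<ge>0. u j 1 t = boundary_op n m P u j t) \<and>
     (\<forall>j<n. \<forall>x\<in>{0..1}. u j x 0 = \<phi> j x)"

text \<open>For a generalized solution the argument order is \<open>U j t x\<close>, so that \<open>U j t\<close> represents
  an element of \<open>L\<^sup>2(0, 1)\<close>; classical solutions are written \<open>u j x t\<close>.\<close>

definition L2_generalized_solution ::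
  "nat \<Rightarrow> nat \<Rightarrow> real mat \<Rightarrow> (nat \<Rightarrow> real \<Rightarrow> real \<Rightarrow> real) \<Rightarrow> (nat \<Rightarrow> real \<Rightarrow> real \<Rightarrow> real) \<Rightarrow>
   (nat \<Rightarrow> real \<Rightarrow> real) \<Rightarrow> (nat \<Rightarrow> real \<Rightarrow> real \<Rightarrow> real) \<Rightarrow> bool" where
  "L2_generalized_solution n m P a b \<phi> U \<longleftrightarrow>
     (\<forall>j<n. L2_continuous (U j)) \<and>
     (\<forall>\<phi>s us.
        (\<forall>l. \<forall>j<n. C0inf_unit (\<phi>s l j)) \<longrightarrow>
        (\<lambda>l. L2_norm_vec n (\<lambda>j x. \<phi>s l j x - \<phi> j x)) \<longlonglongrightarrow> 0 \<longrightarrow>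
        (\<forall>l. classical_solution n m P a b (\<phi>s l) (us l)) \<longrightarrow>
        (\<forall>T>0. uniform_limit {0..T}
           (\<lambda>l t. L2_norm_vec n (\<lambda>j x. U j t x - us l j x t)) (\<lambda>_. 0) sequentially))"

definition FTS ::
  "nat \<Rightarrow> nat \<Rightarrow> real mat \<Rightarrow> (nat \<Rightarrow> real \<Rightarrow> real \<Rightarrow> real) \<Rightarrow> (nat \<Rightarrow> real \<Rightarrow> real \<Rightarrow> real) \<Rightarrow> bool" where
  "FTS n m P a b \<longleftrightarrow>
     (\<exists>T\<^sub>e>0. \<forall>\<phi>. (\<forall>j<n. L2_unit (\<phi> j)) \<longrightarrow>
        (\<forall>U. L2_generalized_solution n m P a b \<phi> U \<longrightarrow>
           (\<forall>t>T\<^sub>e. \<forall>j<n. AE x in lebesgue_on {0<..<1}. U j t x = 0)))"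

definition robust_FTS :: "nat \<Rightarrow> nat \<Rightarrow> real mat \<Rightarrow> bool" where
  "robust_FTS n m P \<longleftrightarrow> (\<forall>a b. admissible n m a b \<longrightarrow> FTS n m P a b)"

definition sgn_abs_mat :: "real mat \<Rightarrow> real mat" where
  "sgn_abs_mat P = map_mat (\<lambda>p. sgn \<bar>p\<bar>) P"

definition principal_minor :: "real mat \<Rightarrow> nat set \<Rightarrow> real" where
  "principal_minor A I = Determinant.det (submatrix A I I)"

definition nilpotent_mat :: "real mat \<Rightarrow> bool" where
  "nilpotent_mat A \<longleftrightarrow> (\<exists>k. A ^\<^sub>m k = 0\<^sub>m (dim_row A) (dim_row A))"

end

theory Submission
  imports Defs
begin

text \<open>
  Everything goes through one combinatorial notion. Draw an arrow from \<open>j\<close> to \<open>k\<close> when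
  \<open>P $$ (j, k) \<noteq> 0\<close>, that is, when the outflow of component \<open>k\<close> enters the inflow of component \<open>j\<close>.
  A nonempty set of indices is called self-feeding if each of its elements has an arrow into the set.
  Conditions (ii), (iii) and (iv) each say that there is no such set: a walk with \<open>n\<close> arrows repeats
  a vertex and so contains a cycle; a nonzero term in the Leibniz expansion of a principal minor comes
  from a permutation along arrows; and an entry of \<open>W ^\<^sub>m n\<close> counts walks. Conversely, on a minimal
  self-feeding set every vertex has exactly one successor, and the successor map is a bijection, so
  that the corresponding submatrix of \<open>W\<close> is a permutation matrix, whose determinant is not zero.

  Without self-feeding sets the components can be solved one after the other, since some unsolved
  component always has all its successors among the solved ones. Each step is a scalar transport
  equation with known inflow. It is solved by characteristics, with \<open>x\<close> as the evolution variable: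
  after an extension of \<open>1/a\<close> and \<open>b\<close> to the whole plane a characteristic is a global trajectory of
  \<open>dt/dx = 1/a\<close>, and the solution is a function \<open>\<psi>\<close> of the time at which the characteristic crosses
  \<open>x = 0\<close>, multiplied by an exponential damping factor. For nonnegative times \<open>\<psi>\<close> is the inflow; for
  negative times it is determined by the initial data. A component thus vanishes a fixed time after
  its inflow does, and the whole system vanishes after \<open>n\<close> such delays, for all test data at once.
  Test functions are dense in \<open>L\<^sup>2(0, 1)\<close>, so a generalized solution is a limit of these
  classical solutions and vanishes from the same time on.

  If a self-feeding set exists, admissible coefficients can be chosen for which one solution never
  dies out. On the largest self-feeding set \<open>S\<close> a generic vector \<open>y\<close> supported on \<open>S\<close> has the property that
  \<open>y\<close> and \<open>c = P y\<close> have the same support. With constant coefficients one can prescribe that an inflow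
  \<open>c\<^sub>j cos (\<pi> t)\<close> leaves component \<open>j\<close> as \<open>y\<^sub>j cos (\<pi> t)\<close>: the modulus of the quotient
  \<open>y\<^sub>j / c\<^sub>j\<close> is produced by \<open>b\<^sub>j\<close>, and its sign by a travel time of one or of two half-periods. The
  relation \<open>c = P y\<close> is then exactly the boundary condition, and the result is a solution periodic in
  time. That it is also a generalized solution follows from an energy estimate for constant
  coefficients with exponential weights in \<open>x\<close>, which make the outflow dominate the inflow.
\<close>

section \<open>Index sets that feed themselves\<close>

definition self_feeding :: "nat \<Rightarrow> real mat \<Rightarrow> nat set \<Rightarrow> bool" where
  "self_feeding n A T \<longleftrightarrow> T \<noteq> {} \<and> T \<subseteq> {..<n} \<and> (\<forall>j\<in>T. \<exists>k\<in>T. A $$ (j, k) \<noteq> 0)"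

lemma self_feeding_sgn_abs:
  assumes "A \<in> carrier_mat n n"
  shows "self_feeding n (sgn_abs_mat A) T \<longleftrightarrow> self_feeding n A T"
proof -
  have "sgn_abs_mat A $$ (j, k) \<noteq> 0 \<longleftrightarrow> A $$ (j, k) \<noteq> 0" if "j < n" "k < n" for j k
    using assms that by (simp add: sgn_abs_mat_def sgn_0_0)
  then show ?thesis unfolding self_feeding_def by (meson lessThan_iff subset_iff)
qed

text \<open>A choice of successors inside \<open>T\<close> can be iterated forever.\<close>

lemma self_feeding_walk:
  assumes T: "self_feeding n A T"
  obtains i :: "nat \<Rightarrow> nat" where "\<And>l. i l < n" "\<And>l. A $$ (i l, i (Suc l)) \<noteq> 0"
proof -
  obtain \<sigma> where \<sigma>: "\<And>j. j \<in> T \<Longrightarrow> \<sigma> j \<in> T \<and> A $$ (j, \<sigma> j) \<noteq> 0"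
    using T unfolding self_feeding_def by metis
  obtain j where j: "j \<in> T" using T by (auto simp: self_feeding_def)
  have mem: "(\<sigma> ^^ l) j \<in> T" for l by (induction l) (use j \<sigma> in auto)
  show thesis
  proof (rule that[of "\<lambda>l. (\<sigma> ^^ l) j"])
    show "(\<sigma> ^^ l) j < n" for l using mem[of l] T by (auto simp: self_feeding_def)
    show "A $$ ((\<sigma> ^^ l) j, (\<sigma> ^^ Suc l) j) \<noteq> 0" for l using \<sigma>[OF mem[of l]] by simp
  qed
qed

text \<open>The walk visits \<open>n + 1\<close> vertices out of \<open>n\<close>, so it closes up; the vertices on the loop feed
  each other.\<close>

lemma walk_self_feeding:
  fixes i :: "nat \<Rightarrow> nat"
  assumes i: "\<And>l. l \<le> n \<Longrightarrow> i l < n" and A: "\<And>l. l < n \<Longrightarrow> A $$ (i l, i (Suc l)) \<noteq> 0"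
  shows "\<exists>T. self_feeding n A T"
proof -
  have "\<not> inj_on i {..n}"
  proof
    assume "inj_on i {..n}"
    then have "card {..n} \<le> card {..<n}" using i by (intro card_inj_on_le[of i]) auto
    then show False by simp
  qed
  then obtain p q where "p \<le> n" "q \<le> n" "p \<noteq> q" "i p = i q" by (auto simp: inj_on_def)
  then obtain p q where pq: "p < q" "q \<le> n" "i p = i q"
    by (metis linorder_neqE_nat)
  have "\<exists>k\<in>i ` {p..<q}. A $$ (i l, k) \<noteq> 0" if l: "l \<in> {p..<q}" for l
  proof (cases "Suc l = q")
    case True
    then have "A $$ (i l, i p) \<noteq> 0" using A[of l] pq by auto
    moreover have "i p \<in> i ` {p..<q}" using pq(1) by (intro imageI) auto
    ultimately show ?thesis by blast
  next
    case False
    then show ?thesis using A[of l] pq l by (intro bexI[of _ "i (Suc l)"]) auto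
  qed
  then have "self_feeding n A (i ` {p..<q})"
    using pq i by (auto simp: self_feeding_def)
  then show ?thesis by blast
qed

lemma self_feeding_iff_walk:
  "(\<exists>T. self_feeding n A T) \<longleftrightarrow>
   \<not> (\<forall>i :: nat \<Rightarrow> nat. (\<forall>l\<le>n. i l < n) \<longrightarrow> (\<Prod>l<n. A $$ (i l, i (Suc l))) = 0)"
proof
  assume "\<exists>T. self_feeding n A T"
  then obtain i :: "nat \<Rightarrow> nat" where "\<And>l. i l < n" "\<And>l. A $$ (i l, i (Suc l)) \<noteq> 0"
    using self_feeding_walk by metis
  then have "(\<forall>l\<le>n. i l < n)" "(\<Prod>l<n. A $$ (i l, i (Suc l))) \<noteq> 0"
    by auto
  then show "\<not> (\<forall>i :: nat \<Rightarrow> nat. (\<forall>l\<le>n. i l < n) \<longrightarrow> (\<Prod>l<n. A $$ (i l, i (Suc l))) = 0)"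
    by blast
next
  assume "\<not> (\<forall>i :: nat \<Rightarrow> nat. (\<forall>l\<le>n. i l < n) \<longrightarrow> (\<Prod>l<n. A $$ (i l, i (Suc l))) = 0)"
  then obtain i :: "nat \<Rightarrow> nat" where "\<And>l. l \<le> n \<Longrightarrow> i l < n" "(\<Prod>l<n. A $$ (i l, i (Suc l))) \<noteq> 0"
    by blast
  then show "\<exists>T. self_feeding n A T"
    by (intro walk_self_feeding[of n i]) auto
qed

lemma principal_minor_expand:
  assumes A: "A \<in> carrier_mat n n" and I: "I \<subseteq> {..<n}"
  shows "principal_minor A I = (\<Sum>p\<in>{p. p permutes {0..<card I}}.
    signof p * (\<Prod>i = 0..<card I. A $$ (pick I i, pick I (p i))))"
proof -
  have card: "{i. i < dim_row A \<and> i \<in> I} = I" "{i. i < dim_col A \<and> i \<in> I} = I"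
    using A I by auto
  have S: "submatrix A I I \<in> carrier_mat (card I) (card I)"
    using dim_submatrix[of A I I] unfolding card by (intro carrier_matI) auto
  have "submatrix A I I $$ (i, p i) = A $$ (pick I i, pick I (p i))"
    if "p permutes {0..<card I}" "i \<in> {0..<card I}" for p i
    using submatrix_index[of i A I "p i" I] permutes_in_image[OF that(1), of i] that(2)
    unfolding card by auto
  then show ?thesis
    unfolding principal_minor_def det_def'[OF S]
    by (intro sum.cong arg_cong2[where f = "(*)"] prod.cong) auto
qed

lemma pick_bij:
  assumes "finite I"
  shows "bij_betw (pick I) {0..<card I} I"
proof -
  have inj: "inj_on (pick I) {0..<card I}"
    by (rule inj_onI) (metis atLeastLessThan_iff card_pick nat_neq_iff pick_mono pick_mono_le order_less_irrefl)
  moreover have "pick I ` {0..<card I} \<subseteq> I"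
    using pick_in_set_le by auto
  ultimately show ?thesis
    using assms by (metis atLeast0LessThan bij_betw_imageI card_image card_lessThan card_subset_eq)
qed

text \<open>A nonzero term of the Leibniz expansion belongs to a permutation that maps every index along an arrow,
  and therefore keeps the arrows inside \<open>I\<close>.\<close>

lemma minor_nonzero_self_feeding:
  assumes A: "A \<in> carrier_mat n n" and I: "I \<subseteq> {..<n}" "I \<noteq> {}" and m: "principal_minor A I \<noteq> 0"
  shows "self_feeding n A I"
proof -
  have fin: "finite I" using I(1) finite_subset by blast
  obtain p where p: "p permutes {0..<card I}"
    and nz: "(\<Prod>i = 0..<card I. A $$ (pick I i, pick I (p i))) \<noteq> 0"
    using m unfolding principal_minor_expand[OF A I(1)]
    by (metis (no_types, lifting) mem_Collect_eq mult_zero_right sum.neutral)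
  have "\<exists>k\<in>I. A $$ (j, k) \<noteq> 0" if "j \<in> I" for j
  proof -
    obtain i where i: "i \<in> {0..<card I}" "j = pick I i"
      using pick_bij[OF fin] \<open>j \<in> I\<close> by (metis bij_betw_imp_surj_on imageE)
    moreover have "pick I (p i) \<in> I"
      using pick_bij[OF fin] permutes_in_image[OF p, of i] i(1) by (auto simp: bij_betw_def)
    ultimately show ?thesis using nz by auto
  qed
  then show ?thesis using I by (auto simp: self_feeding_def)
qed

text \<open>The image of \<open>T\<close> under any choice of successors is again self-feeding, hence equal to \<open>T\<close> by
  minimality. So every choice of successors is a bijection. If some vertex had two successors, changing
  the choice at this vertex alone would turn one bijection into another, which is impossible.\<close>

lemma minimal_self_feeding:
  assumes T: "self_feeding n A T" and min: "\<And>S. S \<subset> T \<Longrightarrow> \<not> self_feeding n A S"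
  obtains \<sigma> where "bij_betw \<sigma> T T" "\<And>j k. j \<in> T \<Longrightarrow> k \<in> T \<Longrightarrow> A $$ (j, k) \<noteq> 0 \<longleftrightarrow> k = \<sigma> j"
proof -
  have fin: "finite T" using T finite_subset by (auto simp: self_feeding_def)
  have bij: "bij_betw \<sigma> T T" if \<sigma>: "\<And>j. j \<in> T \<Longrightarrow> \<sigma> j \<in> T \<and> A $$ (j, \<sigma> j) \<noteq> 0" for \<sigma>
  proof -
    have "self_feeding n A (\<sigma> ` T)"
      using T \<sigma> unfolding self_feeding_def by blast
    then have "\<sigma> ` T = T" using min[of "\<sigma> ` T"] \<sigma> by blast
    then show ?thesis using fin by (simp add: bij_betw_def eq_card_imp_inj_on)
  qed
  obtain \<sigma> where \<sigma>: "\<And>j. j \<in> T \<Longrightarrow> \<sigma> j \<in> T \<and> A $$ (j, \<sigma> j) \<noteq> 0"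
    using T unfolding self_feeding_def by metis
  show thesis
  proof (rule that[OF bij[OF \<sigma>]])
    fix j k assume jk: "j \<in> T" "k \<in> T"
    show "A $$ (j, k) \<noteq> 0 \<longleftrightarrow> k = \<sigma> j"
    proof
      assume "A $$ (j, k) \<noteq> 0"
      then have "bij_betw (\<sigma>(j := k)) T T" using \<sigma> jk by (intro bij) auto
      moreover obtain j' where j': "j' \<in> T" "k = \<sigma> j'"
        using bij[OF \<sigma>] jk(2) unfolding bij_betw_def by blast
      ultimately have "j' = j"
        using jk(1) unfolding bij_betw_def inj_on_def by (metis fun_upd_other fun_upd_same)
      then show "k = \<sigma> j" using j' by simp
    qed (use \<sigma> jk in auto)
  qed
qed

text \<open>On a minimal self-feeding set the submatrix has exactly one nonzero entry in each row and in each
  column, so exactly one term of the Leibniz expansion survives.\<close>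

lemma self_feeding_minor:
  assumes A: "A \<in> carrier_mat n n" and ex: "\<exists>T. self_feeding n A T"
  shows "\<exists>I. I \<noteq> {} \<and> I \<subseteq> {..<n} \<and> principal_minor A I \<noteq> 0"
proof -
  have "card S < card T" if "S \<subset> T" "T \<subseteq> {..<n}" for S T
    using psubset_card_mono[OF finite_subset[OF that(2)] that(1)] by simp
  then have "{(S, T). S \<subset> T \<and> T \<subseteq> {..<n}} \<subseteq> Wellfounded.measure card"
    by (intro subrelI) (unfold in_measure, blast)
  then have wf: "wf {(S, T). S \<subset> T \<and> T \<subseteq> {..<n}}"
    by (rule wf_subset[OF wf_measure])
  obtain T where T: "self_feeding n A T" and min: "\<And>S. S \<subset> T \<Longrightarrow> \<not> self_feeding n A S"
  proof -
    obtain T0 where "T0 \<in> Collect (self_feeding n A)" using ex by blast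
    from wfE_min[OF wf this] obtain T where "T \<in> Collect (self_feeding n A)"
      "\<And>S. (S, T) \<in> {(S, T). S \<subset> T \<and> T \<subseteq> {..<n}} \<Longrightarrow> S \<notin> Collect (self_feeding n A)"
      by blast
    then show thesis by (intro that[of T]) (auto simp: self_feeding_def)
  qed
  obtain \<sigma> where \<sigma>: "bij_betw \<sigma> T T"
    and nz: "\<And>j k. j \<in> T \<Longrightarrow> k \<in> T \<Longrightarrow> A $$ (j, k) \<noteq> 0 \<longleftrightarrow> k = \<sigma> j"
    using minimal_self_feeding[OF T min] by metis
  have TI: "T \<noteq> {}" "T \<subseteq> {..<n}" using T by (auto simp: self_feeding_def)
  then have fin: "finite T" using finite_subset by blast
  note pick = pick_bij[OF fin]
  let ?N = "{0..<card T}"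
  define g where "g = inv_into ?N (pick T)"
  have g: "bij_betw g T ?N" unfolding g_def by (rule bij_betw_inv_into[OF pick])
  have gp: "g (pick T i) = i" if "i \<in> ?N" for i
    unfolding g_def using bij_betw_inv_into_left[OF pick that] .
  have pg: "pick T (g j) = j" if "j \<in> T" for j
    unfolding g_def using bij_betw_inv_into_right[OF pick that] .
  have pT: "pick T i \<in> T" if "i \<in> ?N" for i using bij_betwE[OF pick] that by blast
  define p where "p i = (if i \<in> ?N then g (\<sigma> (pick T i)) else i)" for i
  have "bij_betw (g \<circ> \<sigma> \<circ> pick T) ?N ?N"
    by (intro bij_betw_trans[OF pick] bij_betw_trans[OF \<sigma>] g)
  then have "bij_betw p ?N ?N"
    by (rule bij_betw_cong[THEN iffD1, rotated]) (simp add: p_def)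
  then have p: "p permutes ?N" by (rule bij_imp_permutes) (simp add: p_def)
  have "principal_minor A T = (\<Sum>q\<in>{q. q permutes ?N}. if q = p then
      signof p * (\<Prod>i\<in>?N. A $$ (pick T i, pick T (p i))) else 0)"
    unfolding principal_minor_expand[OF A TI(2)]
  proof (rule sum.cong[OF refl])
    fix q assume "q \<in> {q. q permutes ?N}"
    then have q: "q permutes ?N" by simp
    show "signof q * (\<Prod>i\<in>?N. A $$ (pick T i, pick T (q i))) =
        (if q = p then signof p * (\<Prod>i\<in>?N. A $$ (pick T i, pick T (p i))) else 0)"
    proof (cases "q = p")
      case False
      then obtain i where i: "q i \<noteq> p i" by blast
      then have iN: "i \<in> ?N" using permutes_not_in[OF q] permutes_not_in[OF p] by metis
      then have qN: "q i \<in> ?N" using permutes_in_image[OF q] by blast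
      have "pick T (q i) \<noteq> \<sigma> (pick T i)"
        using i gp[OF qN] iN by (auto simp: p_def)
      then have "A $$ (pick T i, pick T (q i)) = 0" using nz[OF pT[OF iN] pT[OF qN]] by blast
      then have "(\<Prod>i\<in>?N. A $$ (pick T i, pick T (q i))) = 0" using iN by (intro prod_zero) auto
      then show ?thesis using False by simp
    qed simp
  qed
  also have "\<dots> = signof p * (\<Prod>i\<in>?N. A $$ (pick T i, pick T (p i)))"
    using p by (simp add: sum.delta finite_permutations)
  also have "\<dots> \<noteq> 0"
  proof -
    have "A $$ (pick T i, pick T (p i)) \<noteq> 0" if i: "i \<in> ?N" for i
    proof -
      have s: "\<sigma> (pick T i) \<in> T" using bij_betwE[OF \<sigma>] pT[OF i] by blast
      then have "pick T (p i) = \<sigma> (pick T i)" using i by (simp add: p_def pg)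
      then show ?thesis using nz[OF pT[OF i] s] by simp
    qed
    then have "(\<Prod>i\<in>?N. A $$ (pick T i, pick T (p i))) \<noteq> 0" by (simp add: prod_zero_iff)
    then show ?thesis by (simp add: sign_def)
  qed
  finally show ?thesis using TI by blast
qed

lemma self_feeding_iff_minor:
  assumes "A \<in> carrier_mat n n"
  shows "(\<exists>T. self_feeding n A T) \<longleftrightarrow> \<not> (\<forall>I. I \<noteq> {} \<and> I \<subseteq> {..<n} \<longrightarrow> principal_minor A I = 0)"
  using self_feeding_minor[OF assms] minor_nonzero_self_feeding[OF assms] by blast

lemma pow_mat_walk:
  fixes A :: "real mat"
  assumes A: "A \<in> carrier_mat n n"
  shows "i < n \<Longrightarrow> j < n \<Longrightarrow> (A ^\<^sub>m k) $$ (i, j) \<noteq> 0 \<Longrightarrow>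
    \<exists>w :: nat \<Rightarrow> nat. (\<forall>l\<le>k. w l < n) \<and> (\<forall>l<k. A $$ (w l, w (Suc l)) \<noteq> 0) \<and> w k = j"
proof (induction k arbitrary: j)
  case 0
  then show ?case by (intro exI[of _ "\<lambda>_. j"]) auto
next
  case (Suc k)
  have P: "A ^\<^sub>m k \<in> carrier_mat n n" by (rule pow_carrier_mat[OF A])
  have "(\<Sum>h = 0..<n. (A ^\<^sub>m k) $$ (i, h) * A $$ (h, j)) \<noteq> 0"
    using Suc.prems P A by (simp add: scalar_prod_def)
  then obtain h where h: "h < n" "(A ^\<^sub>m k) $$ (i, h) \<noteq> 0" "A $$ (h, j) \<noteq> 0"
    by (metis (no_types, lifting) atLeastLessThan_iff mult_not_zero sum.neutral)
  from Suc.IH[OF Suc.prems(1) h(1,2)] obtain w :: "nat \<Rightarrow> nat"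
    where w: "\<forall>l\<le>k. w l < n" "\<forall>l<k. A $$ (w l, w (Suc l)) \<noteq> 0" "w k = h" by blast
  show ?case
    by (intro exI[of _ "w(Suc k := j)"]) (use w h Suc.prems(2) in \<open>auto simp: less_Suc_eq\<close>)
qed

text \<open>The entries of the power are nonnegative, so no cancellation can remove the contribution of a
  walk inside \<open>T\<close>. The nonnegativity is part of the induction.\<close>

lemma pow_mat_self_feeding:
  fixes A :: "real mat"
  assumes A: "A \<in> carrier_mat n n" and nn: "\<And>i j. i < n \<Longrightarrow> j < n \<Longrightarrow> A $$ (i, j) \<ge> 0"
    and T: "self_feeding n A T"
  shows "(\<forall>i<n. \<forall>j<n. (A ^\<^sub>m k) $$ (i, j) \<ge> 0) \<and> (\<exists>i<n. \<exists>j\<in>T. (A ^\<^sub>m k) $$ (i, j) > 0)"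
proof (induction k)
  case 0
  obtain j where "j \<in> T" "j < n" using T by (auto simp: self_feeding_def)
  then show ?case using A by (auto intro!: exI[of _ j] bexI[of _ j])
next
  case (Suc k)
  have P: "A ^\<^sub>m k \<in> carrier_mat n n" by (rule pow_carrier_mat[OF A])
  have eq: "(A ^\<^sub>m Suc k) $$ (i, j) = (\<Sum>h = 0..<n. (A ^\<^sub>m k) $$ (i, h) * A $$ (h, j))"
    if "i < n" "j < n" for i j
    using that P A by (simp add: scalar_prod_def)
  have nonneg: "(A ^\<^sub>m k) $$ (i, h) * A $$ (h, j) \<ge> 0" if "i < n" "j < n" "h < n" for i j h
    using Suc.IH nn that by simp
  obtain i j where ij: "i < n" "j \<in> T" "(A ^\<^sub>m k) $$ (i, j) > 0" using Suc.IH by blast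
  obtain j' where j': "j' \<in> T" "A $$ (j, j') \<noteq> 0" using T ij(2) unfolding self_feeding_def by blast
  have n: "j < n" "j' < n" using T ij(2) j'(1) by (auto simp: self_feeding_def)
  have "0 < (A ^\<^sub>m k) $$ (i, j) * A $$ (j, j')"
    using ij j'(2) nn[OF n] by (simp add: zero_less_mult_iff less_le)
  also have "\<dots> \<le> (A ^\<^sub>m Suc k) $$ (i, j')"
    unfolding eq[OF ij(1) n(2)]
    by (rule member_le_sum[where f = "\<lambda>h. (A ^\<^sub>m k) $$ (i, h) * A $$ (h, j')"])
       (use n ij(1) in \<open>auto intro!: nonneg\<close>)
  finally have "(A ^\<^sub>m Suc k) $$ (i, j') > 0" .
  moreover have "\<forall>i<n. \<forall>j<n. (A ^\<^sub>m Suc k) $$ (i, j) \<ge> 0"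
    using eq nonneg by (auto intro!: sum_nonneg simp del: pow_mat.simps)
  ultimately show ?case using ij(1) j'(1) by blast
qed

lemma self_feeding_iff_pow:
  fixes A :: "real mat"
  assumes A: "A \<in> carrier_mat n n" and nn: "\<And>i j. i < n \<Longrightarrow> j < n \<Longrightarrow> A $$ (i, j) \<ge> 0"
  shows "(\<exists>T. self_feeding n A T) \<longleftrightarrow> \<not> (nilpotent_mat A \<and> A ^\<^sub>m n = 0\<^sub>m n n)"
proof
  assume "\<exists>T. self_feeding n A T"
  then obtain T where T: "self_feeding n A T" by blast
  obtain i j where "i < n" "j \<in> T" "(A ^\<^sub>m n) $$ (i, j) > 0"
    using pow_mat_self_feeding[OF A nn T, of n] by blast
  moreover have "j < n" using T \<open>j \<in> T\<close> by (auto simp: self_feeding_def)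
  ultimately show "\<not> (nilpotent_mat A \<and> A ^\<^sub>m n = 0\<^sub>m n n)" by auto
next
  assume "\<not> (nilpotent_mat A \<and> A ^\<^sub>m n = 0\<^sub>m n n)"
  then have "A ^\<^sub>m n \<noteq> 0\<^sub>m n n" using A by (auto simp: nilpotent_mat_def)
  moreover have "A ^\<^sub>m n \<in> carrier_mat n n" by (rule pow_carrier_mat[OF A])
  ultimately obtain i j where "i < n" "j < n" "(A ^\<^sub>m n) $$ (i, j) \<noteq> 0"
    by (metis carrier_matD(1) carrier_matD(2) eq_matI index_zero_mat)
  from pow_mat_walk[OF A this] show "\<exists>T. self_feeding n A T"
    by (metis walk_self_feeding)
qed

section \<open>Signed integrals over a variable interval\<close>

text \<open>The mean value of \<open>f\<close> over the segment from \<open>a\<close> to \<open>b\<close>. The substitution to the fixed interval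
  \<open>[0, 1]\<close> is the point of the definition: continuity and differentiability in parameters, including
  the end points, reduce to integrals over a fixed interval, and the sign comes out right when \<open>b < a\<close>. Also
  \<open>F b - F a = (b - a) * avg F' a b\<close> is the factorization of an increment with a factor that depends
  continuously on \<open>a\<close> and \<open>b\<close>, which yields derivatives in the form of Caratheodory.\<close>

definition avg :: "(real \<Rightarrow> real) \<Rightarrow> real \<Rightarrow> real \<Rightarrow> real" where
  "avg f a b = integral {0..1} (\<lambda>\<theta>. f (a + \<theta> * (b - a)))"

text \<open>The signed integral of \<open>f\<close> from \<open>a\<close> to \<open>b\<close>.\<close>

definition sint :: "real \<Rightarrow> real \<Rightarrow> (real \<Rightarrow> real) \<Rightarrow> real" where
  "sint a b f = (b - a) * avg f a b"

lemma sint_same [simp]: "sint a a f = 0"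
  by (simp add: sint_def)

lemma avg_same [simp]: "avg f a a = f a"
  by (simp add: avg_def)

lemma continuous_on_pairI:
  assumes "continuous_on UNIV (\<lambda>(x, y). f x y)" "continuous_on S g" "continuous_on S h"
  shows "continuous_on S (\<lambda>w. f (g w) (h w))"
  using continuous_on_compose2[OF assms(1), of S "\<lambda>w. (g w, h w)"] assms(2,3)
  by (auto intro!: continuous_intros)

lemma continuous_on_avg:
  fixes f :: "'p::topological_space \<Rightarrow> real \<Rightarrow> real"
  assumes f: "continuous_on UNIV (\<lambda>(p, y). f p y)"
    and a: "continuous_on UNIV a" and b: "continuous_on UNIV b"
  shows "continuous_on UNIV (\<lambda>p. avg (f p) (a p) (b p))"
proof -
  have "continuous_on (UNIV \<times> cbox 0 1) (\<lambda>(p, \<theta>). f p (a p + \<theta> * (b p - a p)))"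
    unfolding split_beta
    by (intro continuous_on_pairI[OF f] continuous_intros
          continuous_on_compose2[OF a] continuous_on_compose2[OF b]) auto
  from integral_continuous_on_param[OF this] show ?thesis
    by (simp add: avg_def)
qed

lemma FTC_sint_segment:
  assumes "\<And>x. x \<in> closed_segment a b \<Longrightarrow>
      (F has_real_derivative f x) (at x within closed_segment a b)"
  shows "F b - F a = sint a b f"
proof -
  have seg: "a + \<theta> * (b - a) \<in> closed_segment a b" if "\<theta> \<in> {0..1}" for \<theta>
    using that unfolding in_segment by (intro exI[of _ \<theta>]) (auto simp: algebra_simps)
  have "((\<lambda>\<theta>. (b - a) * f (a + \<theta> * (b - a))) has_integral
          F (a + 1 * (b - a)) - F (a + 0 * (b - a))) {0..1}"
  proof (rule fundamental_theorem_of_calculus)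
    fix \<theta> :: real assume \<theta>: "\<theta> \<in> {0..1}"
    have "((\<lambda>\<theta>. F (a + \<theta> * (b - a))) has_real_derivative f (a + \<theta> * (b - a)) * (b - a))
           (at \<theta> within {0..1})"
    proof (rule DERIV_image_chain[where f = F and g = "\<lambda>\<theta>. a + \<theta> * (b - a)", unfolded o_def])
      show "(F has_real_derivative f (a + \<theta> * (b - a)))
         (at (a + \<theta> * (b - a)) within (\<lambda>\<theta>. a + \<theta> * (b - a)) ` {0..1})"
        by (rule DERIV_subset[OF assms[OF seg[OF \<theta>]]]) (use seg in auto)
    qed (auto intro!: derivative_eq_intros)
    then show "((\<lambda>\<theta>. F (a + \<theta> * (b - a))) has_vector_derivative (b - a) * f (a + \<theta> * (b - a)))
          (at \<theta> within {0..1})"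
      by (simp add: has_real_derivative_iff_has_vector_derivative mult.commute)
  qed simp
  then have "integral {0..1} (\<lambda>\<theta>. (b - a) * f (a + \<theta> * (b - a))) = F b - F a"
    by (rule integral_unique[THEN trans]) simp
  then show ?thesis by (simp only: sint_def avg_def integral_mult_right)
qed

lemma FTC_sint:
  assumes "\<And>x. (F has_real_derivative f x) (at x)"
  shows "F b - F a = sint a b f"
  by (rule FTC_sint_segment) (blast intro: has_field_derivative_at_within assms)

text \<open>Near \<open>x\<close> the signed integral differs by a constant from an ordinary integral with a fixed lower
  limit \<open>lo\<close> to the left of both \<open>a\<close> and \<open>x\<close>.\<close>

lemma sint_has_derivative:
  assumes f: "continuous_on UNIV f"
  shows "((\<lambda>x. sint a x f) has_real_derivative f x) (at x)"
proof -
  define lo where "lo = min a x - 1"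
  define hi where "hi = max a x + 1"
  define F where "F = (\<lambda>y. integral {lo..y} f)"
  have F: "(F has_real_derivative f y) (at y within {lo..hi})" if "y \<in> {lo..hi}" for y
    unfolding F_def using that
    by (intro integral_has_real_derivative continuous_on_subset[OF f]) auto
  have eq: "sint a y f = F y - F a" if "y \<in> {lo..hi}" for y
  proof -
    have sub: "closed_segment a y \<subseteq> {lo..hi}"
      using that by (auto simp: closed_segment_eq_real_ivl lo_def hi_def split: if_splits)
    show ?thesis
      by (rule FTC_sint_segment[symmetric]) (use F sub in \<open>blast intro: DERIV_subset\<close>)
  qed
  have x: "x \<in> {lo<..<hi}" by (auto simp: lo_def hi_def)
  have "(F has_real_derivative f x) (at x)"
    using F[of x] x by (metis (no_types, lifting) at_within_Icc_at greaterThanLessThan_iff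
        atLeastAtMost_iff less_imp_le)
  then have "((\<lambda>y. F y - F a) has_real_derivative f x) (at x)"
    by (auto intro!: derivative_eq_intros)
  then show ?thesis
    by (rule has_field_derivative_transform_within_open[where S = "{lo<..<hi}"])
       (use x eq in auto)
qed

lemma sint_add:
  assumes "continuous_on UNIV f"
  shows "sint a b f + sint b c f = sint a c f"
  using FTC_sint[OF sint_has_derivative[OF assms], where a = b and b = c, of a] by simp

lemma avg_derivative_param:
  assumes f: "continuous_on UNIV (\<lambda>(p, y). f p y)"
    and f': "continuous_on UNIV (\<lambda>(p, y). f' p y)"
    and d: "\<And>p y. ((\<lambda>p. f p y) has_real_derivative f' p y) (at p)"
  shows "((\<lambda>p. avg (f p) a b) has_real_derivative avg (f' p) a b) (at p)"
proof -
  have "((\<lambda>p. integral (cbox 0 1) (\<lambda>\<theta>. f p (a + \<theta> * (b - a)))) has_field_derivative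
          integral (cbox 0 1) (\<lambda>\<theta>. f' p (a + \<theta> * (b - a)))) (at p within UNIV)"
  proof (rule leibniz_rule_field_derivative)
    show "(\<lambda>\<theta>. f q (a + \<theta> * (b - a))) integrable_on cbox 0 1" for q
      by (intro integrable_continuous continuous_on_pairI[OF f] continuous_intros)
    show "continuous_on (UNIV \<times> cbox 0 1) (\<lambda>(q, \<theta>). f' q (a + \<theta> * (b - a)))"
      unfolding split_beta by (intro continuous_on_pairI[OF f'] continuous_intros)
  qed (auto intro: d)
  then show ?thesis by (simp add: avg_def)
qed

lemma avg_bound:
  assumes "continuous_on UNIV f" "\<And>x. x \<in> closed_segment a b \<Longrightarrow> \<bar>f x\<bar> \<le> B"
  shows "\<bar>avg f a b\<bar> \<le> B"
proof -
  have "norm (integral {0..1} (\<lambda>\<theta>. f (a + \<theta> * (b - a)))) \<le> B * (1 - 0)"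
  proof (rule integral_bound)
    show "continuous_on {0..1} (\<lambda>\<theta>. f (a + \<theta> * (b - a)))"
      by (intro continuous_on_compose2[OF assms(1)] continuous_intros) auto
    fix \<theta> :: real assume "\<theta> \<in> {0..1}"
    then have "a + \<theta> * (b - a) \<in> closed_segment a b"
      unfolding in_segment by (intro exI[of _ \<theta>]) (auto simp: algebra_simps)
    then show "norm (f (a + \<theta> * (b - a))) \<le> B" using assms(2) by auto
  qed simp
  then show ?thesis by (simp add: avg_def)
qed

lemma avg_integrable:
  fixes f :: "real \<Rightarrow> real"
  assumes "continuous_on UNIV f"
  shows "(\<lambda>\<theta>. f (a + \<theta> * (b - a))) integrable_on {0..1::real}"
  by (intro integrable_continuous_interval continuous_on_compose2[OF assms] continuous_intros) auto

lemma avg_diff: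
  assumes "continuous_on UNIV f" "continuous_on UNIV g"
  shows "avg (\<lambda>x. f x - g x) a b = avg f a b - avg g a b"
  unfolding avg_def by (intro integral_diff avg_integrable assms)

lemma sint_exp_bound:
  assumes f: "continuous_on UNIV f" and b: "\<And>r. \<bar>f r\<bar> \<le> M * exp (K * \<bar>r\<bar>)" and K: "K > 0"
  shows "\<bar>sint 0 s f\<bar> \<le> M / K * (exp (K * \<bar>s\<bar>) - 1)"
proof -
  have "\<bar>avg f 0 s\<bar> \<le> avg (\<lambda>r. M * exp (K * r)) 0 \<bar>s\<bar>"
    unfolding avg_def real_norm_def[symmetric]
  proof (rule integral_norm_bound_integral)
    show "(\<lambda>\<theta>. f (0 + \<theta> * (s - 0))) integrable_on {0..1}" by (rule avg_integrable[OF f])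
    show "(\<lambda>\<theta>. M * exp (K * (0 + \<theta> * (norm s - 0)))) integrable_on {0..1}"
      by (intro integrable_continuous_interval continuous_intros)
    fix \<theta> :: real assume "\<theta> \<in> {0..1}"
    then show "norm (f (0 + \<theta> * (s - 0))) \<le> M * exp (K * (0 + \<theta> * (norm s - 0)))"
      using b[of "\<theta> * s"] by (simp add: abs_mult)
  qed
  then have "\<bar>s\<bar> * \<bar>avg f 0 s\<bar> \<le> sint 0 \<bar>s\<bar> (\<lambda>r. M * exp (K * r))"
    by (simp add: sint_def mult_left_mono)
  also have "\<dots> = M / K * exp (K * \<bar>s\<bar>) - M / K * exp (K * 0)"
    by (rule FTC_sint[symmetric]) (use K in \<open>auto intro!: derivative_eq_intros\<close>)
  finally show ?thesis by (simp add: sint_def abs_mult algebra_simps)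
qed

section \<open>Characteristics of a slope field on the plane\<close>

text \<open>Picard's theorem with a globally Lipschitz right-hand side. To get a solution on the whole line in
  a single step, the contraction principle is applied to \<open>z s = exp (- K * \<bar>s\<bar>) * (p s - y)\<close>: the weight
  makes \<open>z\<close> bounded, and with \<open>K = 2 * L\<close> the integral operator contracts by the factor \<open>1/2\<close>.\<close>

lemma ode_solution_from_0:
  fixes c :: "real \<Rightarrow> real \<Rightarrow> real"
  assumes c: "continuous_on UNIV (\<lambda>(s, y). c s y)"
    and C: "\<And>s y. \<bar>c s y\<bar> \<le> C"
    and L: "\<And>s y z. \<bar>c s y - c s z\<bar> \<le> L * \<bar>y - z\<bar>" and L0: "L > 0"
  shows "\<exists>p. p 0 = y \<and> (\<forall>s. (p has_real_derivative c s (p s)) (at s))"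
proof -
  define K where "K = 2 * L"
  have K: "K > 0" using L0 by (simp add: K_def)
  define f where "f z r = c r (y + exp (K * \<bar>r\<bar>) * z r)" for z r
  \<comment> \<open>The Picard operator, written for the weighted unknown.\<close>
  define G where "G z s = exp (- K * \<bar>s\<bar>) * sint 0 s (f z)" for z s
  have f_cont: "continuous_on UNIV (f z)" if "continuous_on UNIV z" for z
    unfolding f_def by (intro continuous_on_pairI[OF c] continuous_intros that)
  have C0: "0 \<le> C" using C[of 0 0] by linarith
  have G: "G z \<in> bcontfun" if z: "continuous_on UNIV z" for z
  proof (rule bcontfun_normI)
    have "continuous_on UNIV (\<lambda>s. sint 0 s (f z))"
      by (rule DERIV_continuous_on, rule has_field_derivative_at_within,
          rule sint_has_derivative[OF f_cont[OF z]])
    then show "continuous_on UNIV (G z)"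
      unfolding G_def by (rule continuous_on_mult[rotated]) (intro continuous_intros)
    fix s
    have "\<bar>avg (f z) 0 s\<bar> \<le> C"
      by (rule avg_bound[OF f_cont[OF z]]) (simp add: f_def C)
    then have "norm (G z s) \<le> exp (- K * \<bar>s\<bar>) * (\<bar>s\<bar> * C)"
      by (simp add: G_def sint_def abs_mult mult_left_mono)
    also have "\<dots> = (\<bar>s\<bar> / exp (K * \<bar>s\<bar>)) * C"
      by (simp add: exp_minus field_simps)
    also have "\<dots> \<le> 1 / K * C"
    proof (rule mult_right_mono[OF _ C0])
      have "K * \<bar>s\<bar> \<le> exp (K * \<bar>s\<bar>)" using exp_ge_add_one_self[of "K * \<bar>s\<bar>"] by linarith
      then show "\<bar>s\<bar> / exp (K * \<bar>s\<bar>) \<le> 1 / K" using K by (simp add: field_simps)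
    qed
    finally show "norm (G z s) \<le> C / K" by simp
  qed
  define \<Gamma> where "\<Gamma> z = Bcontfun (G (apply_bcontfun z))" for z
  have cz: "continuous_on UNIV (apply_bcontfun z)" for z :: "real \<Rightarrow>\<^sub>C real"
    by (rule continuous_on_apply_bcontfun)
  have \<Gamma>: "apply_bcontfun (\<Gamma> z) = G (apply_bcontfun z)" for z
    unfolding \<Gamma>_def by (rule Bcontfun_inverse[OF G[OF cz]])
  have "\<exists>!z. \<Gamma> z = z"
  proof (rule banach_fix_type[of "1/2"], simp, simp, intro allI)
    fix z z' :: "real \<Rightarrow>\<^sub>C real"
    show "dist (\<Gamma> z) (\<Gamma> z') \<le> 1 / 2 * dist z z'"
    proof (rule dist_bound)
      fix s
      define h where "h r = f z r - f z' r" for r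
      have h: "continuous_on UNIV h"
        unfolding h_def by (intro continuous_intros f_cont cz)
      have "\<bar>h r\<bar> \<le> (L * dist z z') * exp (K * \<bar>r\<bar>)" for r
      proof -
        have "\<bar>h r\<bar> \<le> L * \<bar>exp (K * \<bar>r\<bar>) * z r - exp (K * \<bar>r\<bar>) * z' r\<bar>"
          unfolding h_def f_def
          using L[of r "y + exp (K * \<bar>r\<bar>) * z r" "y + exp (K * \<bar>r\<bar>) * z' r"] by simp
        also have "\<dots> = L * (exp (K * \<bar>r\<bar>) * dist (z r) (z' r))"
          by (simp add: dist_real_def abs_mult flip: right_diff_distrib)
        also have "\<dots> \<le> L * (exp (K * \<bar>r\<bar>) * dist z z')"
          using L0 by (intro mult_left_mono dist_bounded) auto
        finally show ?thesis by (simp add: mult_ac)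
      qed
      from sint_exp_bound[OF h this K, of s]
      have "\<bar>sint 0 s h\<bar> \<le> 1/2 * dist z z' * (exp (K * \<bar>s\<bar>) - 1)"
        using L0 by (simp add: K_def)
      also have "\<dots> \<le> 1/2 * dist z z' * exp (K * \<bar>s\<bar>)"
        by (intro mult_left_mono) auto
      finally have "\<bar>sint 0 s h\<bar> \<le> 1/2 * dist z z' * exp (K * \<bar>s\<bar>)" .
      moreover have "dist (\<Gamma> z s) (\<Gamma> z' s) = exp (- K * \<bar>s\<bar>) * \<bar>sint 0 s h\<bar>"
        unfolding \<Gamma> G_def h_def sint_def avg_diff[OF f_cont[OF cz] f_cont[OF cz]] dist_real_def
        by (simp add: abs_mult flip: right_diff_distrib)
      ultimately have "dist (\<Gamma> z s) (\<Gamma> z' s)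
          \<le> exp (- K * \<bar>s\<bar>) * (1/2 * dist z z' * exp (K * \<bar>s\<bar>))"
        by (simp add: mult_left_mono)
      also have "\<dots> = 1/2 * dist z z'"
        by (simp add: exp_minus field_simps)
      finally show "dist (\<Gamma> z s) (\<Gamma> z' s) \<le> 1/2 * dist z z'" .
    qed
  qed
  then obtain z where "\<Gamma> z = z" by blast
  then have z: "z s = exp (- K * \<bar>s\<bar>) * sint 0 s (f z)" for s
    using \<Gamma>[of z] unfolding G_def by metis
  define p where "p s = y + sint 0 s (f z)" for s
  have "f z s = c s (p s)" for s
  proof -
    have "exp (K * \<bar>s\<bar>) * z s = sint 0 s (f z)"
      by (subst z) (simp add: exp_minus field_simps)
    then show ?thesis by (simp add: f_def p_def)
  qed
  moreover have "(p has_real_derivative f z s) (at s)" for s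
    unfolding p_def
    using DERIV_add[OF DERIV_const sint_has_derivative[OF f_cont[OF cz]], of y 0] by simp
  ultimately show ?thesis
    by (intro exI[of _ p]) (auto simp: p_def)
qed

lemma ode_solution:
  fixes c :: "real \<Rightarrow> real \<Rightarrow> real"
  assumes c: "continuous_on UNIV (\<lambda>(s, y). c s y)"
    and C: "\<And>s y. \<bar>c s y\<bar> \<le> C"
    and L: "\<And>s y z. \<bar>c s y - c s z\<bar> \<le> L * \<bar>y - z\<bar>" and L0: "L > 0"
  shows "\<exists>p. p x = y \<and> (\<forall>s. (p has_real_derivative c s (p s)) (at s))"
proof -
  have "continuous_on UNIV (\<lambda>(s, y). c (s + x) y)"
    unfolding split_beta by (intro continuous_on_pairI[OF c] continuous_intros)
  from ode_solution_from_0[OF this C L L0, of y]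
  obtain q where q: "q 0 = y" "\<And>s. (q has_real_derivative c (s + x) (q s)) (at s)" by blast
  have "((\<lambda>s. q (s - x)) has_real_derivative c s (q (s - x))) (at s)" for s
    using q(2)[of "s - x"] DERIV_shift[of q "c s (q (s - x))" s "- x"] by simp
  with q(1) show ?thesis by (intro exI[of _ "\<lambda>s. q (s - x)"]) auto
qed

text \<open>Here \<open>c s y\<close> is the slope of a characteristic, the variable \<open>s\<close> stands for the space variable of
  the transport equation and \<open>y\<close> for time. Its derivative in \<open>y\<close> governs how trajectories depend on
  their starting point.\<close>

locale slope_field =
  fixes c ct :: "real \<Rightarrow> real \<Rightarrow> real" and C L :: real
  assumes c_cont: "continuous_on UNIV (\<lambda>(s, y). c s y)"
    and ct_cont: "continuous_on UNIV (\<lambda>(s, y). ct s y)"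
    and c_deriv: "(c s has_real_derivative ct s y) (at y)"
    and c_bound: "\<bar>c s y\<bar> \<le> C"
    and ct_bound: "\<bar>ct s y\<bar> \<le> L"
begin

definition trajectory :: "(real \<Rightarrow> real) \<Rightarrow> bool" where
  "trajectory p \<longleftrightarrow> (\<forall>s. (p has_real_derivative c s (p s)) (at s))"

definition char :: "real \<Rightarrow> real \<Rightarrow> real \<Rightarrow> real" where
  "char x t = (SOME p. p x = t \<and> trajectory p)"

definition gap_rate :: "(real \<Rightarrow> real) \<Rightarrow> (real \<Rightarrow> real) \<Rightarrow> real \<Rightarrow> real" where
  "gap_rate p q s = avg (ct s) (q s) (p s)"

lemma C_nonneg: "C \<ge> 0" and L_nonneg: "L \<ge> 0"
  using c_bound[of 0 0] ct_bound[of 0 0] by linarith+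

lemma ct_section_cont: "continuous_on UNIV (ct s)"
  by (rule continuous_on_pairI[OF ct_cont, where g = "\<lambda>_. s" and h = "\<lambda>y. y"])
     (intro continuous_intros)+

lemma c_difference: "c s y - c s z = (y - z) * avg (ct s) z y"
  using FTC_sint[OF c_deriv, of s y z] by (simp add: sint_def)

lemma char: "char x t x = t" "trajectory (char x t)"
proof -
  have "\<bar>c s y - c s z\<bar> \<le> (L + 1) * \<bar>y - z\<bar>" for s y z
  proof -
    have "\<bar>avg (ct s) z y\<bar> \<le> L + 1"
      by (rule avg_bound[OF ct_section_cont]) (rule order_trans[OF ct_bound], simp)
    then show ?thesis
      unfolding c_difference abs_mult by (subst mult.commute) (rule mult_right_mono, auto)
  qed
  then have "\<exists>p. p x = t \<and> trajectory p"
    unfolding trajectory_def by (rule ode_solution[OF c_cont c_bound]) (use L_nonneg in linarith)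
  from someI_ex[OF this] show "char x t x = t" "trajectory (char x t)"
    by (auto simp: char_def)
qed

lemma trajectory_deriv: "trajectory p \<Longrightarrow> (p has_real_derivative c s (p s)) (at s)"
  by (simp add: trajectory_def)

lemma trajectory_cont: "trajectory p \<Longrightarrow> continuous_on UNIV p"
  by (rule DERIV_continuous_on) (blast intro: has_field_derivative_at_within trajectory_deriv)

lemma trajectory_increment:
  assumes "trajectory p"
  shows "p s - p r = sint r s (\<lambda>x. c x (p x))"
  by (rule FTC_sint) (rule trajectory_deriv[OF assms])

lemma trajectory_lipschitz:
  assumes p: "trajectory p"
  shows "\<bar>p s - p r\<bar> \<le> C * \<bar>s - r\<bar>"
proof -
  have "\<bar>avg (\<lambda>x. c x (p x)) r s\<bar> \<le> C"
    by (intro avg_bound continuous_on_pairI[OF c_cont] continuous_intros trajectory_cont[OF p] c_bound)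
  then show ?thesis
    unfolding trajectory_increment[OF p] sint_def abs_mult
    by (subst mult.commute) (rule mult_right_mono, auto)
qed

lemma gap_rate_cont:
  assumes "trajectory p" "trajectory q"
  shows "continuous_on UNIV (gap_rate p q)"
  unfolding gap_rate_def
  by (intro continuous_on_avg ct_cont trajectory_cont assms)

text \<open>The difference of two trajectories satisfies a linear equation, whose coefficient is the mean of
  \<open>ct\<close> between them. This one formula gives uniqueness, the Lipschitz dependence on the data, and the
  derivative with respect to them.\<close>

lemma gap:
  assumes p: "trajectory p" and q: "trajectory q"
  shows "p s - q s = (p r - q r) * exp (sint r s (gap_rate p q))"
proof -
  let ?\<kappa> = "gap_rate p q"
  \<comment> \<open>The quotient of the gap by its expected value is constant.\<close>
  let ?g = "\<lambda>s. (p s - q s) * exp (- sint r s ?\<kappa>)"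
  have "(?g has_real_derivative 0) (at s)" for s
  proof -
    have "((\<lambda>s. sint r s ?\<kappa>) has_real_derivative ?\<kappa> s) (at s)"
      by (rule sint_has_derivative[OF gap_rate_cont[OF p q]])
    from DERIV_mult[OF DERIV_diff[OF trajectory_deriv[OF p] trajectory_deriv[OF q]]
        DERIV_fun_exp[OF DERIV_minus[OF this]]]
    have "(?g has_real_derivative (c s (p s) - c s (q s)) * exp (- sint r s ?\<kappa>)
            + exp (- sint r s ?\<kappa>) * - ?\<kappa> s * (p s - q s)) (at s)" .
    then show ?thesis
      by (simp add: c_difference gap_rate_def algebra_simps)
  qed
  then have "?g s = ?g r" by (intro DERIV_isconst_all) blast
  then show ?thesis by (simp add: exp_minus field_simps)
qed

lemma char_unique:
  assumes "trajectory p"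
  shows "char x (p x) = p"
proof
  fix s show "char x (p x) s = p s"
    using gap[OF char(2) assms, of x "p x" s x] by (simp add: char(1))
qed

lemma char_char: "char x (char x' t' x) = char x' t'"
proof -
  have "trajectory (char x' t')" by (rule char(2))
  then show ?thesis using char_unique[of "char x' t'" x] by simp
qed

lemma gap_bound:
  assumes p: "trajectory p" and q: "trajectory q"
  shows "\<bar>p s - q s\<bar> \<le> \<bar>p r - q r\<bar> * exp (L * \<bar>s - r\<bar>)"
proof -
  have "\<bar>avg (gap_rate p q) r s\<bar> \<le> L"
    by (rule avg_bound[OF gap_rate_cont[OF p q]])
       (unfold gap_rate_def, rule avg_bound, rule ct_section_cont, rule ct_bound)
  then have "\<bar>sint r s (gap_rate p q)\<bar> \<le> L * \<bar>s - r\<bar>"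
    unfolding sint_def abs_mult by (subst mult.commute) (rule mult_right_mono, auto)
  then have "exp (sint r s (gap_rate p q)) \<le> exp (L * \<bar>s - r\<bar>)"
    by (subst exp_le_cancel_iff) linarith
  then have "\<bar>p r - q r\<bar> * exp (sint r s (gap_rate p q)) \<le> \<bar>p r - q r\<bar> * exp (L * \<bar>s - r\<bar>)"
    by (rule mult_left_mono) simp
  then show ?thesis
    by (subst gap[OF p q, of s r]) (simp add: abs_mult)
qed

lemma char_jointly_cont: "continuous_on UNIV (\<lambda>(x, t, s). char x t s)"
proof -
  have "isCont (\<lambda>z. char (fst z) (fst (snd z)) (snd (snd z))) (x, t, s)" for x t s
  proof -
    define b where "b z = (\<bar>fst (snd z) - t\<bar> + C * \<bar>fst z - x\<bar>) * exp (L * \<bar>s - x\<bar>)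
        + C * \<bar>snd (snd z) - s\<bar>" for z :: "real \<times> real \<times> real"
    have le: "\<bar>char x' t' s' - char x t s\<bar> \<le> b (x', t', s')" for x' t' s'
    proof -
      have "\<bar>char x' t' x - t'\<bar> \<le> C * \<bar>x' - x\<bar>"
        using trajectory_lipschitz[OF char(2)[of x' t'], of x x'] char(1)[of x' t']
        by (simp add: abs_minus_commute)
      then have *: "\<bar>char x' t' x - char x t x\<bar> \<le> \<bar>t' - t\<bar> + C * \<bar>x' - x\<bar>"
        by (simp add: char(1))
      have "\<bar>char x' t' s - char x t s\<bar> \<le> (\<bar>t' - t\<bar> + C * \<bar>x' - x\<bar>) * exp (L * \<bar>s - x\<bar>)"
        by (rule order_trans[OF gap_bound[OF char(2) char(2), where r = x]])
           (intro mult_right_mono *, simp)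
      moreover have "\<bar>char x' t' s' - char x' t' s\<bar> \<le> C * \<bar>s' - s\<bar>"
        by (rule trajectory_lipschitz[OF char(2)])
      ultimately show ?thesis unfolding b_def fst_conv snd_conv by linarith
    qed
    have "(b \<longlongrightarrow> (\<bar>t - t\<bar> + C * \<bar>x - x\<bar>) * exp (L * \<bar>s - x\<bar>) + C * \<bar>s - s\<bar>) (at (x, t, s))"
      unfolding b_def by (intro tendsto_eq_intros) auto
    then have b0: "(b \<longlongrightarrow> 0) (at (x, t, s))" by simp
    have "((\<lambda>z. char (fst z) (fst (snd z)) (snd (snd z)) - char x t s) \<longlongrightarrow> 0) (at (x, t, s))"
      by (rule Lim_null_comparison[OF _ b0], rule always_eventually) (simp add: le)
    then show ?thesis
      by (simp add: isCont_def LIM_zero_iff)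
  qed
  then show ?thesis
    by (simp add: continuous_on_eq_continuous_at split_beta)
qed

lemma char_cont:
  assumes "continuous_on S f" "continuous_on S g" "continuous_on S h"
  shows "continuous_on S (\<lambda>w. char (f w) (g w) (h w))"
proof -
  have "continuous_on S (\<lambda>w. (f w, g w, h w))"
    by (intro continuous_intros assms)
  from continuous_on_compose2[OF char_jointly_cont this] show ?thesis by simp
qed

text \<open>The derivative of the characteristic through \<open>(x, t)\<close> with respect to \<open>t\<close>; as \<open>t'\<close> tends to \<open>t\<close>, the
  growth rate of the gap tends to \<open>ct\<close> along the characteristic.\<close>

definition char_t :: "real \<Rightarrow> real \<Rightarrow> real \<Rightarrow> real" where
  "char_t x t s = exp (sint x s (\<lambda>r. ct r (char x t r)))"

lemma char_t_pos: "char_t x t s > 0"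
  by (simp add: char_t_def)

lemma char_t_cont:
  assumes "continuous_on UNIV f" "continuous_on UNIV g" "continuous_on UNIV h"
  shows "continuous_on UNIV (\<lambda>w :: 'a :: topological_space. char_t (f w) (g w) (h w))"
  unfolding char_t_def sint_def
  by (intro continuous_intros continuous_on_avg assms)
     (unfold split_beta, intro continuous_on_pairI[OF ct_cont] char_cont continuous_intros
       continuous_on_compose2[OF assms(1)] continuous_on_compose2[OF assms(2)], auto)

lemma char_has_t_derivative:
  "((\<lambda>t. char x t s) has_real_derivative char_t x t s) (at t)"
  unfolding CARAT_DERIV
proof (intro exI[of _ "\<lambda>t'. exp (sint x s (gap_rate (char x t') (char x t)))"] conjI allI)
  fix t'
  show "char x t' s - char x t s = exp (sint x s (gap_rate (char x t') (char x t))) * (t' - t)"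
    using gap[OF char(2) char(2), of x t' s x t x] by (simp add: char(1))
next
  have "continuous_on UNIV (\<lambda>t'. exp (sint x s (gap_rate (char x t') (char x t))))"
    unfolding sint_def
  proof (intro continuous_intros continuous_on_avg)
    have "continuous_on UNIV (\<lambda>z. avg (ct (snd z)) (char x t (snd z)) (char x (fst z) (snd z)))"
      by (intro continuous_on_avg char_cont continuous_intros)
         (unfold split_beta, intro continuous_on_pairI[OF ct_cont] continuous_intros)
    then show "continuous_on UNIV (\<lambda>(t', r). gap_rate (char x t') (char x t) r)"
      by (simp add: gap_rate_def split_beta)
  qed
  then show "isCont (\<lambda>t'. exp (sint x s (gap_rate (char x t') (char x t)))) t"
    by (simp add: continuous_on_eq_continuous_at)
  show "exp (sint x s (gap_rate (char x t) (char x t))) = char_t x t s"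
    by (simp add: char_t_def gap_rate_def[abs_def])
qed

text \<open>The characteristic through \<open>(x', t)\<close> arrives at the abscissa \<open>x\<close> at the time \<open>t\<close> corrected by the
  integral of the slope from \<open>x'\<close> to \<open>x\<close>. With \<open>char_char\<close> this reduces every derivative in \<open>x\<close> of a function
  of the characteristic through \<open>(x, t)\<close> to a derivative in \<open>t\<close>.\<close>

lemma char_has_foot_derivative:
  "((\<lambda>x'. char x' t x) has_real_derivative - c x t) (at x)"
  unfolding CARAT_DERIV
proof (intro exI[of _ "\<lambda>x'. - avg (\<lambda>r. c r (char x' t r)) x' x"] conjI allI)
  fix x'
  show "char x' t x - char x t x = - avg (\<lambda>r. c r (char x' t r)) x' x * (x' - x)"
    using trajectory_increment[OF char(2)[of x' t], of x x'] by (simp add: sint_def char(1) algebra_simps)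
next
  have "continuous_on UNIV (\<lambda>x'. - avg (\<lambda>r. c r (char x' t r)) x' x)"
    by (intro continuous_intros continuous_on_avg)
       (unfold split_beta, intro continuous_on_pairI[OF c_cont] char_cont continuous_intros)
  then show "isCont (\<lambda>x'. - avg (\<lambda>r. c r (char x' t r)) x' x) x"
    by (simp add: continuous_on_eq_continuous_at)
qed (simp add: char(1))

text \<open>The time at which the characteristic through \<open>(x, t)\<close> crosses \<open>x = 0\<close>. It is a first integral:
  \<open>\<partial>\<^sub>x foot + c * \<partial>\<^sub>t foot = 0\<close>.\<close>

definition foot :: "real \<Rightarrow> real \<Rightarrow> real" where "foot x t = char x t 0"

definition foot_t :: "real \<Rightarrow> real \<Rightarrow> real" where "foot_t x t = char_t x t 0"

lemma foot_has_t_derivative: "(foot x has_real_derivative foot_t x t) (at t)"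
  using char_has_t_derivative[of x 0 t] by (simp add: foot_def[abs_def] foot_t_def)

lemma foot_has_x_derivative:
  "((\<lambda>x. foot x t) has_real_derivative - c x t * foot_t x t) (at x)"
proof -
  have "((\<lambda>\<tau>. foot x \<tau>) has_real_derivative foot_t x t) (at (char x t x))"
    by (simp add: char(1) foot_has_t_derivative)
  from DERIV_chain2[OF this char_has_foot_derivative]
  have "((\<lambda>x'. foot x (char x' t x)) has_real_derivative foot_t x t * - c x t) (at x)" .
  then show ?thesis by (simp add: foot_def char_char mult.commute)
qed

lemma foot_t_pos: "foot_t x t > 0"
  by (simp add: foot_t_def char_t_pos)

lemma foot_cont: "continuous_on UNIV (\<lambda>(x, t). foot x t)"
  unfolding foot_def split_beta by (intro char_cont continuous_intros)

lemma foot_t_cont: "continuous_on UNIV (\<lambda>(x, t). foot_t x t)"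
  unfolding foot_t_def split_beta by (intro char_t_cont continuous_intros)

lemma foot_0: "foot 0 t = t"
  by (simp add: foot_def char(1))

lemma foot_ge: "foot x t \<ge> t - C * \<bar>x\<bar>"
  using trajectory_lipschitz[OF char(2)[of x t], of 0 x] char(1)[of x t] by (simp add: foot_def)

end

locale slope_field_damped = slope_field +
  fixes \<beta> \<beta>t :: "real \<Rightarrow> real \<Rightarrow> real"
  assumes \<beta>_cont: "continuous_on UNIV (\<lambda>(s, y). \<beta> s y)"
    and \<beta>t_cont: "continuous_on UNIV (\<lambda>(s, y). \<beta>t s y)"
    and \<beta>_deriv: "(\<beta> s has_real_derivative \<beta>t s y) (at y)"
begin

text \<open>The solution of \<open>\<partial>\<^sub>x damp + c * \<partial>\<^sub>t damp = \<beta>\<close> that vanishes at \<open>x = 0\<close>; \<open>exp (- damp)\<close> is the damping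
  that a quantity carried along the characteristic has undergone since \<open>x = 0\<close>.\<close>

definition damp :: "real \<Rightarrow> real \<Rightarrow> real" where
  "damp x t = sint 0 x (\<lambda>s. \<beta> s (char x t s))"

definition damp_t :: "real \<Rightarrow> real \<Rightarrow> real" where
  "damp_t x t = sint 0 x (\<lambda>s. \<beta>t s (char x t s) * char_t x t s)"

lemma \<beta>_char_cont: "continuous_on UNIV (\<lambda>s. \<beta> s (char x t s))"
  by (intro continuous_on_pairI[OF \<beta>_cont] char_cont continuous_intros)

lemma damp_has_t_derivative: "(damp x has_real_derivative damp_t x t) (at t)"
proof -
  have 1: "continuous_on UNIV (\<lambda>(t, s). \<beta> s (char x t s))"
    unfolding split_beta by (intro continuous_on_pairI[OF \<beta>_cont] char_cont continuous_intros)
  have 2: "continuous_on UNIV (\<lambda>(t, s). \<beta>t s (char x t s) * char_t x t s)"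
    unfolding split_beta
    by (intro continuous_on_mult continuous_on_pairI[OF \<beta>t_cont] char_cont char_t_cont continuous_intros)
  have "((\<lambda>t. avg (\<lambda>s. \<beta> s (char x t s)) 0 x) has_real_derivative
      avg (\<lambda>s. \<beta>t s (char x t s) * char_t x t s) 0 x) (at t)"
    by (rule avg_derivative_param[OF 1 2]) (rule DERIV_chain2[OF \<beta>_deriv char_has_t_derivative])
  from DERIV_cmult[OF this, of "x - 0"] show ?thesis
    by (simp add: damp_def[abs_def] damp_t_def sint_def)
qed

text \<open>The characteristic through \<open>(x', t)\<close> also passes through \<open>(x, char x' t x)\<close>. So the increment of
  \<open>damp\<close> splits into an increment in \<open>t\<close> at the fixed abscissa \<open>x\<close> and an integral of \<open>\<beta>\<close> over the
  short piece from \<open>x\<close> to \<open>x'\<close>.\<close>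

lemma damp_has_x_derivative:
  "((\<lambda>x. damp x t) has_real_derivative \<beta> x t - c x t * damp_t x t) (at x)"
proof -
  have "((\<lambda>\<tau>. damp x \<tau>) has_real_derivative damp_t x t) (at (char x t x))"
    by (simp add: char(1) damp_has_t_derivative)
  from DERIV_chain2[OF this char_has_foot_derivative]
  have 1: "((\<lambda>x'. damp x (char x' t x)) has_real_derivative damp_t x t * - c x t) (at x)" .
  have 2: "((\<lambda>x'. sint x x' (\<lambda>s. \<beta> s (char x' t s))) has_real_derivative \<beta> x t) (at x)"
    unfolding CARAT_DERIV
  proof (intro exI[of _ "\<lambda>x'. avg (\<lambda>s. \<beta> s (char x' t s)) x x'"] conjI allI)
    have "continuous_on UNIV (\<lambda>x'. avg (\<lambda>s. \<beta> s (char x' t s)) x x')"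
      by (intro continuous_intros continuous_on_avg)
         (unfold split_beta, intro continuous_on_pairI[OF \<beta>_cont] char_cont continuous_intros)
    then show "isCont (\<lambda>x'. avg (\<lambda>s. \<beta> s (char x' t s)) x x') x"
      by (simp add: continuous_on_eq_continuous_at)
  qed (auto simp: char(1) sint_def)
  have eq: "damp x' t = damp x (char x' t x) + sint x x' (\<lambda>s. \<beta> s (char x' t s))" for x'
    unfolding damp_def char_char using sint_add[OF \<beta>_char_cont, of 0 x x' t x'] by simp
  show ?thesis
    unfolding eq using DERIV_add[OF 1 2] by (simp add: algebra_simps)
qed

lemma damp_cont: "continuous_on UNIV (\<lambda>(x, t). damp x t)"
  unfolding damp_def sint_def split_beta
  by (intro continuous_on_mult continuous_on_avg continuous_intros)
     (unfold split_beta, intro continuous_on_pairI[OF \<beta>_cont] char_cont continuous_intros)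

lemma damp_t_cont: "continuous_on UNIV (\<lambda>(x, t). damp_t x t)"
  unfolding damp_t_def sint_def split_beta
  by (intro continuous_on_mult continuous_on_avg continuous_intros)
     (unfold split_beta, intro continuous_on_mult continuous_on_pairI[OF \<beta>t_cont] char_cont
       char_t_cont continuous_intros)

lemma damp_0 [simp]: "damp 0 t = 0"
  by (simp add: damp_def)

end

section \<open>Continuously differentiable functions on the strip\<close>

text \<open>A version of \<^const>\<open>C1_strip\<close> that names the partial derivatives.\<close>

definition C1_with :: "(real \<Rightarrow> real \<Rightarrow> real) \<Rightarrow> (real \<Rightarrow> real \<Rightarrow> real) \<Rightarrow> (real \<Rightarrow> real \<Rightarrow> real) \<Rightarrow> bool" where
  "C1_with f fx ft \<longleftrightarrow>
     (\<forall>x\<in>{0..1}. \<forall>t\<ge>0. ((\<lambda>y. f y t) has_real_derivative fx x t) (at x within {0..1}) \<and>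
        (f x has_real_derivative ft x t) (at t within {0..})) \<and>
     continuous_on strip (\<lambda>(x, t). f x t) \<and>
     continuous_on strip (\<lambda>(x, t). fx x t) \<and>
     continuous_on strip (\<lambda>(x, t). ft x t)"

lemma at_within_Ici_nontrivial: "at t within {0..} \<noteq> bot" if "(t::real) \<ge> 0"
proof
  assume "at t within {0..} = bot"
  then have "at t within {t..} \<le> bot"
    using at_le[of "{t..}" "{0..}" t] that by auto
  then show False
    by (simp add: at_within_Ici_at_right bot_unique trivial_limit_at_right_real)
qed

lemma at_within_unit_nontrivial: "at x within {0..1} \<noteq> bot" if "x \<in> {0..1::real}"
  using that by (simp add: trivial_limit_within islimpt_Icc)

lemma partial_x_eq:
  assumes "((\<lambda>y. f y t) has_real_derivative d) (at x within {0..1})" "x \<in> {0..1}"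
  shows "partial_x f x t = d"
  unfolding partial_x_def
  by (rule vector_derivative_within)
     (use assms at_within_unit_nontrivial in \<open>auto simp: has_real_derivative_iff_has_vector_derivative\<close>)

lemma partial_t_eq:
  assumes "(f x has_real_derivative d) (at t within {0..})" "t \<ge> 0"
  shows "partial_t f x t = d"
  unfolding partial_t_def
  by (rule vector_derivative_within)
     (use assms at_within_Ici_nontrivial in \<open>auto simp: has_real_derivative_iff_has_vector_derivative\<close>)

lemma C1_with_partials:
  assumes "C1_with f fx ft" "x \<in> {0..1}" "t \<ge> 0"
  shows "partial_x f x t = fx x t" "partial_t f x t = ft x t"
  using assms by (auto simp: C1_with_def intro!: partial_x_eq partial_t_eq)

lemma C1_with_imp_C1_strip:
  assumes "C1_with f fx ft"
  shows "C1_strip f"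
  unfolding C1_strip_def
proof (intro conjI)
  show "\<forall>(x, t)\<in>strip. (\<lambda>y. f y t) differentiable at x within {0..1} \<and> f x differentiable at t within {0..}"
    using assms by (auto simp: C1_with_def strip_def intro: differentiableI_vector
        dest!: spec simp: has_real_derivative_iff_has_vector_derivative)
  have "continuous_on strip (\<lambda>z. partial_x f (fst z) (snd z)) = continuous_on strip (\<lambda>z. fx (fst z) (snd z))"
    by (rule continuous_on_cong) (auto simp: strip_def C1_with_partials(1)[OF assms])
  then show "continuous_on strip (\<lambda>(x, t). partial_x f x t)"
    using assms by (simp add: C1_with_def split_beta)
  have "continuous_on strip (\<lambda>z. partial_t f (fst z) (snd z)) = continuous_on strip (\<lambda>z. ft (fst z) (snd z))"
    by (rule continuous_on_cong) (auto simp: strip_def C1_with_partials(2)[OF assms])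
  then show "continuous_on strip (\<lambda>(x, t). partial_t f x t)"
    using assms by (simp add: C1_with_def split_beta)
qed (use assms in \<open>simp add: C1_with_def\<close>)

lemma C1_strip_imp_C1_with:
  assumes "C1_strip f"
  shows "C1_with f (partial_x f) (partial_t f)"
proof -
  have "((\<lambda>y. f y t) has_real_derivative partial_x f x t) (at x within {0..1}) \<and>
        (f x has_real_derivative partial_t f x t) (at t within {0..})"
    if xt: "x \<in> {0..1}" "t \<ge> 0" for x t
  proof -
    have "(\<lambda>y. f y t) differentiable (at x within {0..1})" "f x differentiable (at t within {0..})"
      using assms xt by (auto simp: C1_strip_def strip_def)
    then obtain d e where
      "((\<lambda>y. f y t) has_real_derivative d) (at x within {0..1})"
      "(f x has_real_derivative e) (at t within {0..})"
      by (meson real_differentiable_def)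
    then show ?thesis using partial_x_eq[of f t d x] partial_t_eq[of f x e t] xt by auto
  qed
  then show ?thesis using assms by (auto simp: C1_with_def C1_strip_def)
qed

section \<open>Extension of coefficients and data\<close>

definition clamp01 :: "real \<Rightarrow> real" where "clamp01 x = max 0 (min 1 x)"

lemma clamp01_mem: "clamp01 x \<in> {0..1}" and clamp01_id: "x \<in> {0..1} \<Longrightarrow> clamp01 x = x"
  by (auto simp: clamp01_def)

lemma clamp01_cont: "continuous_on S f \<Longrightarrow> continuous_on S (\<lambda>x. clamp01 (f x))"
  unfolding clamp01_def by (intro continuous_intros)

definition plane_ext_t :: "(real \<Rightarrow> real \<Rightarrow> real) \<Rightarrow> real \<Rightarrow> real \<Rightarrow> real" where
  "plane_ext_t f' x t = f' (clamp01 x) \<bar>t\<bar>"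

text \<open>The coefficient is frozen outside \<open>[0, 1]\<close> in \<open>x\<close>, and its derivative in \<open>t\<close> is continued evenly to
  negative \<open>t\<close>, so the continuation in \<open>t\<close> is an odd reflection about the value at \<open>t = 0\<close>. It keeps
  the bounds of the derivative and the bounds of the function up to a factor three. Positivity is kept for
  \<open>t \<ge> 0\<close>, where the method of characteristics uses it, and can be lost for negative times.\<close>

definition plane_ext :: "(real \<Rightarrow> real \<Rightarrow> real) \<Rightarrow> (real \<Rightarrow> real \<Rightarrow> real) \<Rightarrow> real \<Rightarrow> real \<Rightarrow> real" where
  "plane_ext f f' x t = f (clamp01 x) 0 + sint 0 t (plane_ext_t f' x)"

text \<open>What the method of characteristics uses of a coefficient: the derivative in \<open>t\<close> only.\<close>

definition t_differentiable :: "(real \<Rightarrow> real \<Rightarrow> real) \<Rightarrow> (real \<Rightarrow> real \<Rightarrow> real) \<Rightarrow> bool" where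
  "t_differentiable f f' \<longleftrightarrow>
     (\<forall>x\<in>{0..1}. \<forall>t\<ge>0. (f x has_real_derivative f' x t) (at t within {0..})) \<and>
     continuous_on strip (\<lambda>(x, t). f x t) \<and> continuous_on strip (\<lambda>(x, t). f' x t)"

lemma plane_ext_t_cont:
  assumes "t_differentiable f f'"
  shows "continuous_on UNIV (\<lambda>(x, t). plane_ext_t f' x t)"
proof -
  have "continuous_on strip (\<lambda>(x, t). f' x t)"
    using assms by (simp add: t_differentiable_def)
  moreover have "continuous_on UNIV (\<lambda>z :: real \<times> real. (clamp01 (fst z), \<bar>snd z\<bar>))"
    by (intro continuous_intros clamp01_cont)
  ultimately have "continuous_on UNIV (\<lambda>z. (\<lambda>(x, t). f' x t) (clamp01 (fst z), \<bar>snd z\<bar>))"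
    by (rule continuous_on_compose2)
       (use clamp01_mem in \<open>auto simp: strip_def\<close>)
  then show ?thesis by (simp add: plane_ext_t_def split_beta)
qed

lemma plane_ext_cont:
  assumes "t_differentiable f f'"
  shows "continuous_on UNIV (\<lambda>(x, t). plane_ext f f' x t)"
proof -
  have "continuous_on strip (\<lambda>(x, t). f x t)"
    using assms by (simp add: t_differentiable_def)
  moreover have "continuous_on UNIV (\<lambda>z :: real \<times> real. (clamp01 (fst z), 0 :: real))"
    by (intro continuous_intros clamp01_cont)
  ultimately have "continuous_on UNIV (\<lambda>z :: real \<times> real. (\<lambda>(x, t). f x t) (clamp01 (fst z), 0))"
    by (rule continuous_on_compose2)
       (use clamp01_mem in \<open>auto simp: strip_def\<close>)
  then have 1: "continuous_on UNIV (\<lambda>z :: real \<times> real. f (clamp01 (fst z)) 0)"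
    by simp
  show ?thesis
    unfolding plane_ext_def split_beta sint_def
    by (intro 1 continuous_intros continuous_on_avg)
       (unfold split_beta, intro continuous_on_pairI[OF plane_ext_t_cont[OF assms]] continuous_intros)
qed

lemma plane_ext_deriv:
  assumes "t_differentiable f f'"
  shows "(plane_ext f f' x has_real_derivative plane_ext_t f' x t) (at t)"
proof -
  have "continuous_on UNIV (plane_ext_t f' x)"
    by (rule continuous_on_pairI[OF plane_ext_t_cont[OF assms], where g = "\<lambda>_. x" and h = "\<lambda>y. y"])
       (intro continuous_intros)+
  from DERIV_add[OF DERIV_const[of "f (clamp01 x) 0"] sint_has_derivative[OF this, of 0 t]]
  show ?thesis by (simp add: plane_ext_def[abs_def])
qed

lemma plane_ext_eq:
  assumes "t_differentiable f f'" "t \<ge> 0"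
  shows "plane_ext f f' x t = f (clamp01 x) t"
proof -
  have "f (clamp01 x) t - f (clamp01 x) 0 = sint 0 t (plane_ext_t f' x)"
  proof (rule FTC_sint_segment)
    fix s assume s: "s \<in> closed_segment 0 t"
    then have "s \<ge> 0" using assms(2) by (auto simp: closed_segment_eq_real_ivl)
    then have "(f (clamp01 x) has_real_derivative plane_ext_t f' x s) (at s within {0..})"
      using assms(1) clamp01_mem by (simp add: t_differentiable_def plane_ext_t_def)
    then show "(f (clamp01 x) has_real_derivative plane_ext_t f' x s) (at s within closed_segment 0 t)"
      by (rule DERIV_subset) (use assms(2) in \<open>auto simp: closed_segment_eq_real_ivl\<close>)
  qed
  then show ?thesis by (simp add: plane_ext_def)
qed

lemma plane_ext_eq_strip:
  assumes "t_differentiable f f'" "x \<in> {0..1}" "t \<ge> 0"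
  shows "plane_ext f f' x t = f x t"
  using plane_ext_eq[OF assms(1,3), of x] assms(2) by (simp add: clamp01_id)

lemma plane_ext_reflect:
  "plane_ext f f' x t = 2 * plane_ext f f' x 0 - plane_ext f f' x (- t)"
proof -
  have "avg (plane_ext_t f' x) 0 (- t) = avg (plane_ext_t f' x) 0 t"
    by (simp add: avg_def plane_ext_t_def)
  then show ?thesis by (simp add: plane_ext_def sint_def)
qed

lemma plane_ext_bound:
  assumes f: "t_differentiable f f'" and B: "\<And>x t. x \<in> {0..1} \<Longrightarrow> t \<ge> 0 \<Longrightarrow> \<bar>f x t\<bar> \<le> B"
  shows "\<bar>plane_ext f f' x t\<bar> \<le> 3 * B"
proof (cases "t \<ge> 0")
  case True
  then show ?thesis using B[OF clamp01_mem[of x] True] plane_ext_eq[OF f True] by simp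
next
  case False
  then have "\<bar>plane_ext f f' x 0\<bar> \<le> B" "\<bar>plane_ext f f' x (- t)\<bar> \<le> B"
    using B[OF clamp01_mem[of x], of 0] B[OF clamp01_mem[of x], of "- t"] by (simp_all add: plane_ext_eq[OF f])
  then show ?thesis using plane_ext_reflect[of f f' x t] by linarith
qed

lemma derivative_zero_on_open:
  assumes "(f has_real_derivative d) (at x)" "open S" "x \<in> S" "\<And>y. y \<in> S \<Longrightarrow> f y = 0"
  shows "d = 0"
proof -
  have "(f has_real_derivative 0) (at x)"
    by (rule has_field_derivative_transform_within_open[of "\<lambda>_. 0", OF _ assms(2,3)])
       (use assms(4) in auto)
  then show ?thesis using assms(1) DERIV_unique by blast
qed

text \<open>Gluing on an open cover: \<open>f\<close> on \<open>A\<close> and zero on \<open>B\<close> agree on the intersection.\<close>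

lemma C1_extend_by_zero:
  assumes A: "open A" and B: "open B" "A \<union> B = UNIV"
    and d: "\<And>x. x \<in> A \<Longrightarrow> (f has_real_derivative f' x) (at x)"
    and c: "continuous_on A f'" and z: "\<And>x. x \<in> A \<inter> B \<Longrightarrow> f x = 0"
  defines "F \<equiv> \<lambda>x. if x \<in> A then f x else 0" and "F' \<equiv> \<lambda>x. if x \<in> A then f' x else 0"
  shows "(F has_real_derivative F' x) (at x)" "continuous_on UNIV F'"
    "\<And>x. x \<in> B \<Longrightarrow> F x = 0" "\<And>x. x \<in> B \<Longrightarrow> F' x = 0"
proof -
  show F0: "F x = 0" if "x \<in> B" for x
    using that z by (auto simp: F_def)
  show F'0: "F' x = 0" if x: "x \<in> B" for x
  proof (cases "x \<in> A")
    case True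
    then have "f' x = 0"
      by (intro derivative_zero_on_open[OF d, of x "A \<inter> B"]) (use x z A B in auto)
    then show ?thesis by (simp add: F'_def)
  qed (simp add: F'_def)
  show "(F has_real_derivative F' x) (at x)"
  proof (cases "x \<in> A")
    case True
    have "(F has_real_derivative f' x) (at x)"
      by (rule has_field_derivative_transform_within_open[OF d[OF True] A True]) (simp add: F_def)
    then show ?thesis using True by (simp add: F'_def)
  next
    case False
    then have "x \<in> B" using B(2) by blast
    have "(F has_real_derivative 0) (at x)"
      by (rule has_field_derivative_transform_within_open[OF DERIV_const B(1) \<open>x \<in> B\<close>]) (simp add: F0)
    then show ?thesis using False by (simp add: F'_def)
  qed
  have "continuous_on A F'" using c by (simp add: F'_def)
  moreover have "continuous_on B F' \<longleftrightarrow> continuous_on B (\<lambda>_. 0 :: real)"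
    by (rule continuous_on_cong) (auto simp: F'0)
  ultimately have "continuous_on (A \<union> B) F'"
    using A B(1) by (intro continuous_on_open_Un) auto
  then show "continuous_on UNIV F'" by (simp add: B(2))
qed

lemma C0inf_unit_extension:
  assumes "C0inf_unit \<phi>"
  obtains f f' l r where "0 < l" "l < r" "r < 1"
    "\<And>x. (f has_real_derivative f' x) (at x)" "continuous_on UNIV f'"
    "\<And>x. x \<notin> {l<..<r} \<Longrightarrow> f x = 0" "\<And>x. x \<notin> {l<..<r} \<Longrightarrow> f' x = 0"
    "\<And>x. x \<in> {0..1} \<Longrightarrow> f x = \<phi> x"
proof -
  define S where "S = closure {x \<in> {0..1}. \<phi> x \<noteq> 0}"
  have S: "S \<subseteq> {0<..<1}" "closed S" using assms by (auto simp: S_def C0inf_unit_def)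
  obtain D where D0: "D 0 = \<phi>" and
    D: "\<And>k x. x \<in> {0..1} \<Longrightarrow> (D k has_real_derivative D (Suc k) x) (at x within {0..1})"
    using assms by (auto simp: C0inf_unit_def Cinf_unit_def)
  have \<phi>S: "\<phi> x = 0" if "x \<in> {0..1}" "x \<notin> S" for x
    using that closure_subset[of "{x \<in> {0..1}. \<phi> x \<noteq> 0}"] unfolding S_def by blast
  define f where "f x = (if x \<in> {0<..<1} then \<phi> x else 0)" for x
  define f' where "f' x = (if x \<in> {0<..<1} then D 1 x else 0)" for x
  have d: "(D k has_real_derivative D (Suc k) x) (at x)" if "x \<in> {0<..<1}" for x k
    using D[of x k] that by (simp add: at_within_Icc_at)
  have cD: "continuous_on {0<..<1} (D 1)"
    by (rule DERIV_continuous_on) (blast intro: has_field_derivative_at_within d)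
  note ext = C1_extend_by_zero[where A = "{0<..<1}" and B = "- S" and f = \<phi> and f' = "D 1",
      OF open_greaterThanLessThan _ _ _ cD, folded f_def f'_def]
  have ext_prem: "open (- S)" "{0<..<1} \<union> - S = UNIV"
    "\<And>x. x \<in> {0<..<1} \<Longrightarrow> (\<phi> has_real_derivative D 1 x) (at x)"
    "\<And>x. x \<in> {0<..<1} \<inter> - S \<Longrightarrow> \<phi> x = 0"
    using S d[of _ 0] D0 \<phi>S by auto
  have "\<exists>l r. 0 < l \<and> l < r \<and> r < 1 \<and> S \<subseteq> {l<..<r}"
  proof (cases "S = {}")
    case True
    then show ?thesis by (intro exI[of _ "1/3"] exI[of _ "2/3"]) auto
  next
    case False
    have "bounded S" by (rule bounded_subset[of "{0..1}"]) (use S(1) in force)+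
    then have "compact S" using S(2) compact_eq_bounded_closed by blast
    then obtain lo hi where lo: "lo \<in> S" "\<And>x. x \<in> S \<Longrightarrow> lo \<le> x" and hi: "hi \<in> S" "\<And>x. x \<in> S \<Longrightarrow> x \<le> hi"
      using compact_attains_inf[of S] compact_attains_sup[of S] False by metis
    have "0 < lo" "hi < 1" "lo \<le> hi" using lo hi S(1) by auto
    moreover from this have "S \<subseteq> {lo/2<..<(1 + hi)/2}"
      using lo(2) hi(2) by (fastforce simp: field_simps)
    ultimately show ?thesis
      by (intro exI[of _ "lo/2"] exI[of _ "(1 + hi)/2"]) auto
  qed
  then obtain l r where lr: "0 < l" "l < r" "r < 1" "S \<subseteq> {l<..<r}" by blast
  have out: "x \<in> - S" if "x \<notin> {l<..<r}" for x using that lr(4) by blast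
  have z: "f x = 0" "f' x = 0" if "x \<notin> {l<..<r}" for x
    using ext(3,4)[OF ext_prem] out[OF that] by blast+
  show thesis
  proof (rule that[of l r f f'])
    fix x assume "x \<in> {0..1::real}"
    moreover have "0 \<notin> S" "1 \<notin> S" using S(1) by auto
    ultimately show "f x = \<phi> x" using \<phi>S[of x] by (cases "x = 0 \<or> x = 1") (auto simp: f_def)
  next
    fix x show "(f has_real_derivative f' x) (at x)" using ext(1)[OF ext_prem] by blast
  next
    show "continuous_on UNIV f'" using ext(2)[OF ext_prem] by blast
  qed (use lr z in auto)
qed

lemma boundary_data_extension:
  fixes g g' :: "real \<Rightarrow> real"
  assumes d: "\<And>t. t \<ge> 0 \<Longrightarrow> (g has_real_derivative g' t) (at t within {0..})"
    and c: "continuous_on {0..} g'" and \<delta>: "\<delta> > 0" and z: "\<And>t. 0 \<le> t \<Longrightarrow> t < \<delta> \<Longrightarrow> g t = 0"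
  obtains f f' where "\<And>t. (f has_real_derivative f' t) (at t)" "continuous_on UNIV f'"
    "\<And>t. t \<ge> 0 \<Longrightarrow> f t = g t" "\<And>t. t \<le> 0 \<Longrightarrow> f t = 0"
proof -
  have d': "(g has_real_derivative g' t) (at t)" if "t \<in> {0<..}" for t
    using d[of t] that by (simp add: at_within_interior[of t "{0..}"])
  note ext = C1_extend_by_zero[OF open_greaterThan open_lessThan[of \<delta>], of 0 g g']
  have pre: "{0<..} \<union> {..<\<delta>} = UNIV" "\<And>t. t \<in> {0<..} \<Longrightarrow> (g has_real_derivative g' t) (at t)"
    "continuous_on {0<..} g'" "\<And>t. t \<in> {0<..} \<inter> {..<\<delta>} \<Longrightarrow> g t = 0"
    using \<delta> d' z by (auto intro!: continuous_on_subset[OF c])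
  show thesis
  proof (rule that[OF ext(1,2)[OF pre]])
    fix t :: real assume "t \<ge> 0"
    then show "(if t \<in> {0<..} then g t else 0) = g t" using z[of 0] \<delta> by auto
  qed auto
qed

section \<open>The scalar transport equation\<close>

lemma decreasing_inverse:
  fixes h h' :: "real \<Rightarrow> real"
  assumes h: "\<And>x. (h has_real_derivative h' x) (at x)" and neg: "\<And>x. h' x < 0"
  obtains g where "\<And>x. g (h x) = x" "open (range h)"
    "\<And>y. y \<in> range h \<Longrightarrow> (g has_real_derivative inverse (h' (g y))) (at y)"
proof -
  have less: "h y < h x" if "x < y" for x y
    by (rule DERIV_neg_imp_decreasing[OF that]) (use h neg in blast)
  then have inj: "inj h"
    by (metis injI linorder_neqE_linordered_idom order_less_irrefl)
  define g where "g = inv_into UNIV h"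
  have g: "g (h x) = x" for x by (simp add: g_def inj)
  have hc: "isCont h x" for x using h DERIV_isCont by blast
  have nbhd: "{h (x + 1)<..<h (x - 1)} \<subseteq> range h" for x
  proof
    fix y assume "y \<in> {h (x + 1)<..<h (x - 1)}"
    then have "\<exists>z\<ge>x - 1. z \<le> x + 1 \<and> h z = y"
      by (intro IVT2) (auto intro: hc)
    then show "y \<in> range h" by blast
  qed
  have op: "open (range h)"
    unfolding open_subopen[of "range h"]
  proof
    fix y assume "y \<in> range h"
    then obtain x where "y = h x" by blast
    then show "\<exists>T. open T \<and> y \<in> T \<and> T \<subseteq> range h"
      using nbhd[of x] less[of x "x + 1"] less[of "x - 1" x]
      by (intro exI[of _ "{h (x + 1)<..<h (x - 1)}"]) auto
  qed
  have dg: "(g has_real_derivative inverse (h' (g y))) (at y)" if "y \<in> range h" for y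
  proof -
    obtain x where y: "y = h x" using \<open>y \<in> range h\<close> by blast
    have "isCont g (h x)"
      by (rule isCont_inverse_function[where d = 1]) (auto simp: g hc)
    moreover have "(h has_real_derivative h' (g y)) (at (g y))" by (rule h)
    ultimately show ?thesis
      using neg[of "g y"] less[of x "x + 1"] less[of "x - 1" x] nbhd[of x]
      by (intro DERIV_inverse_function[where f = h and a = "h (x + 1)" and b = "h (x - 1)"])
         (auto simp: y g)
  qed
  show thesis by (rule that[OF g op dg])
qed

text \<open>The range of \<open>h\<close> is an open interval, possibly bounded, on which \<open>h\<close> has a differentiable inverse;
  outside the compact interval \<open>{h r..h l}\<close> the transported function is continued by zero.\<close>

lemma push_forward_by_decreasing:
  fixes h h' \<rho> \<rho>' :: "real \<Rightarrow> real"
  assumes h: "\<And>x. (h has_real_derivative h' x) (at x)" and h'c: "continuous_on UNIV h'"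
    and neg: "\<And>x. h' x < 0"
    and \<rho>: "\<And>x. (\<rho> has_real_derivative \<rho>' x) (at x)" and \<rho>'c: "continuous_on UNIV \<rho>'"
    and z: "\<And>x. x \<notin> {l<..<r} \<Longrightarrow> \<rho> x = 0" 
  obtains \<psi> \<psi>' where "\<And>y. (\<psi> has_real_derivative \<psi>' y) (at y)" "continuous_on UNIV \<psi>'"
    "\<And>x. \<psi> (h x) = \<rho> x" "\<And>y. y \<notin> {h r..h l} \<Longrightarrow> \<psi> y = 0"
proof -
  obtain g where g: "\<And>x. g (h x) = x" and op: "open (range h)"
    and dg: "\<And>y. y \<in> range h \<Longrightarrow> (g has_real_derivative inverse (h' (g y))) (at y)"
    by (rule decreasing_inverse[OF h neg]) blast
  have less: "h y < h x" if "x < y" for x y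
    by (rule DERIV_neg_imp_decreasing[OF that]) (use h neg in blast)
  then have le: "h y \<le> h x" if "x \<le> y" for x y
    using that by (cases "x = y") (auto intro: less_imp_le)
  let ?f = "\<lambda>y. \<rho> (g y)" and ?f' = "\<lambda>y. \<rho>' (g y) * inverse (h' (g y))"
  \<comment> \<open>By the intermediate value theorem \<open>{h r..h l}\<close> lies in the range, so the two open sets cover the line.\<close>
  have U: "range h \<union> - {h r..h l} = UNIV"
  proof -
    have "y \<in> range h" if y: "y \<in> {h r..h l}" for y
    proof -
      have "l \<le> r" by (rule ccontr) (use y less[of r l] in auto)
      then have "\<exists>x\<ge>l. x \<le> r \<and> h x = y"
        using y DERIV_isCont[OF h] by (intro IVT2) auto
      then show ?thesis by blast
    qed
    then show ?thesis by blast
  qed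
  have d: "(?f has_real_derivative ?f' y) (at y)" if "y \<in> range h" for y
    by (rule DERIV_chain2[OF \<rho> dg[OF that]])
  have gc: "continuous_on (range h) g"
    by (rule DERIV_continuous_on[OF has_field_derivative_at_within[OF dg]])
  have c: "continuous_on (range h) ?f'"
    using neg by (intro continuous_intros continuous_on_compose2[OF \<rho>'c gc] continuous_on_compose2[OF h'c gc])
      (auto simp: less_imp_neq)
  have z': "?f y = 0" if y: "y \<in> range h \<inter> - {h r..h l}" for y
  proof -
    obtain x where x: "y = h x" using y by blast
    have "x \<notin> {l<..<r}"
    proof
      assume "x \<in> {l<..<r}"
      then have "h r \<le> h x" "h x \<le> h l" by (auto intro!: le)
      then show False using y x by auto
    qed
    then show ?thesis by (simp add: x g z)
  qed
  have opc: "open (- {h r..h l})" by (rule open_Compl) simp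
  note ext = C1_extend_by_zero[where f = ?f and f' = ?f', OF op opc U d c z']
  show thesis
  proof (rule that[OF ext(1,2)])
    show "(if h x \<in> range h then ?f (h x) else 0) = \<rho> x" for x by (simp add: g)
    show "(if y \<in> range h then ?f y else 0) = 0" if "y \<notin> {h r..h l}" for y
      using ext(3)[of y] that by blast
  qed 
qed

context slope_field_damped begin

text \<open>The general solution of \<open>\<partial>\<^sub>x u + c * \<partial>\<^sub>t u + \<beta> * u = 0\<close>, with values \<open>\<psi>\<close> at \<open>x = 0\<close>.\<close>

definition sol :: "(real \<Rightarrow> real) \<Rightarrow> real \<Rightarrow> real \<Rightarrow> real" where
  "sol \<psi> x t = \<psi> (foot x t) * exp (- damp x t)"

lemma sol_derivatives:
  assumes \<psi>: "\<And>y. (\<psi> has_real_derivative \<psi>' y) (at y)" "continuous_on UNIV \<psi>'"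
  obtains ux ut where "\<And>x t. ((\<lambda>x. sol \<psi> x t) has_real_derivative ux x t) (at x)"
    "\<And>x t. (sol \<psi> x has_real_derivative ut x t) (at t)"
    "continuous_on UNIV (\<lambda>(x, t). sol \<psi> x t)"
    "continuous_on UNIV (\<lambda>(x, t). ux x t)" "continuous_on UNIV (\<lambda>(x, t). ut x t)"
    "\<And>x t. ux x t + c x t * ut x t + \<beta> x t * sol \<psi> x t = 0"
proof -
  define ux where "ux x t = \<psi>' (foot x t) * (- c x t * foot_t x t) * exp (- damp x t)
     + exp (- damp x t) * - (\<beta> x t - c x t * damp_t x t) * \<psi> (foot x t)" for x t
  define ut where "ut x t = \<psi>' (foot x t) * foot_t x t * exp (- damp x t)
     + exp (- damp x t) * - damp_t x t * \<psi> (foot x t)" for x t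
  have \<psi>c: "continuous_on UNIV \<psi>"
    by (rule DERIV_continuous_on) (blast intro: has_field_derivative_at_within \<psi>(1))
  have fc: "continuous_on UNIV (\<lambda>z :: real \<times> real. foot (fst z) (snd z))"
    and dc: "continuous_on UNIV (\<lambda>z :: real \<times> real. damp (fst z) (snd z))"
    and ftc: "continuous_on UNIV (\<lambda>z :: real \<times> real. foot_t (fst z) (snd z))"
    and dtc: "continuous_on UNIV (\<lambda>z :: real \<times> real. damp_t (fst z) (snd z))"
    and cc: "continuous_on UNIV (\<lambda>z :: real \<times> real. c (fst z) (snd z))"
    and bc: "continuous_on UNIV (\<lambda>z :: real \<times> real. \<beta> (fst z) (snd z))"
    using foot_cont damp_cont foot_t_cont damp_t_cont c_cont \<beta>_cont by (simp_all add: split_beta)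
  have \<psi>f: "continuous_on UNIV (\<lambda>z :: real \<times> real. \<psi> (foot (fst z) (snd z)))"
    and \<psi>'f: "continuous_on UNIV (\<lambda>z :: real \<times> real. \<psi>' (foot (fst z) (snd z)))"
    by (rule continuous_on_compose2[OF \<psi>c fc] continuous_on_compose2[OF \<psi>(2) fc], simp)+
  show thesis
  proof (rule that[of ux ut])
    fix x t
    show "((\<lambda>x. sol \<psi> x t) has_real_derivative ux x t) (at x)"
      unfolding sol_def ux_def
      by (rule DERIV_mult[OF DERIV_chain2[OF \<psi>(1) foot_has_x_derivative]
            DERIV_fun_exp[OF DERIV_minus[OF damp_has_x_derivative]]])
    have "((\<lambda>t. \<psi> (foot x t) * exp (- damp x t)) has_real_derivative ut x t) (at t)"
      unfolding ut_def
      by (rule DERIV_mult[OF DERIV_chain2[OF \<psi>(1) foot_has_t_derivative]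
            DERIV_fun_exp[OF DERIV_minus[OF damp_has_t_derivative]]])
    then show "(sol \<psi> x has_real_derivative ut x t) (at t)"
      by (simp add: sol_def[abs_def])
    show "ux x t + c x t * ut x t + \<beta> x t * sol \<psi> x t = 0"
      by (simp add: ux_def ut_def sol_def algebra_simps)
  qed (unfold sol_def ux_def ut_def split_beta, (intro continuous_intros fc dc ftc dtc cc bc \<psi>f \<psi>'f)+)
qed

end

text \<open>The argument \<open>x\<^sub>0\<close> is the end of \<open>[0, 1]\<close> through which the characteristics enter.\<close>

definition solves_transport ::
  "(real \<Rightarrow> real \<Rightarrow> real) \<Rightarrow> (real \<Rightarrow> real \<Rightarrow> real) \<Rightarrow> (real \<Rightarrow> real) \<Rightarrow> real \<Rightarrow> (real \<Rightarrow> real) \<Rightarrow> (real \<Rightarrow> real \<Rightarrow> real) \<Rightarrow> bool" where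
  "solves_transport a b \<phi> x\<^sub>0 g u \<longleftrightarrow> C1_strip u \<and>
     (\<forall>x\<in>{0..1}. \<forall>t\<ge>0. partial_t u x t + a x t * partial_x u x t + b x t * u x t = 0) \<and>
     (\<forall>t\<ge>0. u x\<^sub>0 t = g t) \<and> (\<forall>x\<in>{0..1}. u x 0 = \<phi> x)"

text \<open>With initial data that vanish near the boundary, such an inflow is compatible at the corner of the
  strip.\<close>

definition flat_at_0 :: "(real \<Rightarrow> real) \<Rightarrow> bool" where
  "flat_at_0 g \<longleftrightarrow> (\<exists>\<delta>>0. \<forall>t. 0 \<le> t \<and> t < \<delta> \<longrightarrow> g t = 0)"

text \<open>Besides the solution itself, the two properties that let its outflow serve as the inflow of another
  component: it vanishes for small times, and the solution vanishes a time \<open>K\<close> after its inflow does.\<close>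

definition delayed_transport ::
  "(real \<Rightarrow> real \<Rightarrow> real) \<Rightarrow> (real \<Rightarrow> real \<Rightarrow> real) \<Rightarrow> (real \<Rightarrow> real) \<Rightarrow> real \<Rightarrow> (real \<Rightarrow> real) \<Rightarrow> real \<Rightarrow>
   (real \<Rightarrow> real \<Rightarrow> real) \<Rightarrow> bool" where
  "delayed_transport a b \<phi> x\<^sub>0 g K u \<longleftrightarrow>
     solves_transport a b \<phi> x\<^sub>0 g u \<and> flat_at_0 (u (1 - x\<^sub>0)) \<and>
     (\<forall>T\<ge>0. (\<forall>t>T. g t = 0) \<longrightarrow> (\<forall>x\<in>{0..1}. \<forall>t>T + K. u x t = 0))"

text \<open>Division by \<open>a\<close> turns the equation into an evolution in \<open>x\<close> with slope \<open>c = 1/a\<close> and damping rate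
  \<open>\<beta> = b/a\<close>. The values \<open>\<psi>\<close> at \<open>x = 0\<close> are the inflow for \<open>t \<ge> 0\<close>. For \<open>t \<le> 0\<close> they are chosen so that
  the solution equals \<open>\<phi>\<close> on the line \<open>t = 0\<close>, which is possible because \<open>h x = foot x 0\<close> is strictly
  decreasing. Both pieces of \<open>\<psi>\<close> vanish near \<open>0\<close>, so no singularity leaves the corner. The slope \<open>c\<close> is
  bounded by \<open>3/\<alpha>\<close>, which bounds the crossing time. The support of \<open>\<phi>\<close> keeps away from \<open>x = 1\<close>, so the
  outflow vanishes for small times.\<close>

lemma scalar_transport_right:
  fixes a a' b b' :: "real \<Rightarrow> real \<Rightarrow> real"
  assumes a: "t_differentiable a a'" and b: "t_differentiable b b'"
    and \<alpha>: "\<alpha> > 0" "\<And>x t. x \<in> {0..1} \<Longrightarrow> t \<ge> 0 \<Longrightarrow> a x t \<ge> \<alpha>"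
    and M: "\<And>x t. x \<in> {0..1} \<Longrightarrow> t \<ge> 0 \<Longrightarrow> \<bar>a' x t\<bar> \<le> M"
    and \<phi>: "C0inf_unit \<phi>"
    and g: "\<And>t. t \<ge> 0 \<Longrightarrow> (g has_real_derivative g' t) (at t within {0..})"
    and g'c: "continuous_on {0..} g'"
    and flat: "flat_at_0 g"
  shows "\<exists>u. delayed_transport a b \<phi> 0 g (3 / \<alpha>) u"
proof -
  obtain \<delta> where \<delta>: "\<delta> > 0" "\<And>t. 0 \<le> t \<Longrightarrow> t < \<delta> \<Longrightarrow> g t = 0"
    using flat by (auto simp: flat_at_0_def)
  let ?r = "\<lambda>x t. 1 / a x t" and ?rt = "\<lambda>x t. - a' x t / (a x t)\<^sup>2"
  have apos: "a x t > 0" if "x \<in> {0..1}" "t \<ge> 0" for x t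
    using \<alpha>(1) \<alpha>(2)[OF that] by linarith
  have r: "t_differentiable ?r ?rt"
    unfolding t_differentiable_def
  proof (intro conjI ballI allI impI)
    fix x t :: real assume xt: "x \<in> {0..1}" "t \<ge> 0"
    have "(a x has_real_derivative a' x t) (at t within {0..})"
      using a xt by (simp add: t_differentiable_def)
    then show "((\<lambda>t. 1 / a x t) has_real_derivative - a' x t / (a x t)\<^sup>2) (at t within {0..})"
      using apos[OF xt] by (auto intro!: derivative_eq_intros simp: power2_eq_square field_simps)
  qed (use a apos in \<open>auto simp: t_differentiable_def split_beta strip_def less_imp_neq[symmetric]
        intro!: continuous_intros\<close>)
  define c where "c = plane_ext ?r ?rt"
  define ct where "ct = plane_ext_t ?rt"
  define eb where "eb = plane_ext b b'"
  define ebt where "ebt = plane_ext_t b'"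
  define \<beta> where "\<beta> x t = c x t * eb x t" for x t
  define \<beta>t where "\<beta>t x t = ct x t * eb x t + ebt x t * c x t" for x t
  have cont: "continuous_on UNIV (\<lambda>(x, t). c x t)" "continuous_on UNIV (\<lambda>(x, t). ct x t)"
    "continuous_on UNIV (\<lambda>(x, t). eb x t)" "continuous_on UNIV (\<lambda>(x, t). ebt x t)"
    unfolding c_def ct_def eb_def ebt_def
    by (rule plane_ext_cont[OF r] plane_ext_t_cont[OF r] plane_ext_cont[OF b] plane_ext_t_cont[OF b])+
  have c_d: "(c x has_real_derivative ct x t) (at t)" for x t
    unfolding c_def ct_def by (rule plane_ext_deriv[OF r])
  have eb_d: "(eb x has_real_derivative ebt x t) (at t)" for x t
    unfolding eb_def ebt_def by (rule plane_ext_deriv[OF b])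
  interpret slope_field_damped c ct "3 / \<alpha>" "M / \<alpha>\<^sup>2" \<beta> \<beta>t
  proof
    fix x t
    have "\<bar>1 / a y s\<bar> \<le> 1 / \<alpha>" if "y \<in> {0..1}" "s \<ge> 0" for y s
      using \<alpha>(2)[OF that] \<alpha>(1) by (simp add: frac_le)
    from plane_ext_bound[OF r this] show "\<bar>c x t\<bar> \<le> 3 / \<alpha>" by (simp add: c_def)
    have m: "clamp01 x \<in> {0..1}" "\<bar>t\<bar> \<ge> 0" by (auto simp: clamp01_def)
    have "\<bar>a' (clamp01 x) \<bar>t\<bar>\<bar> / (a (clamp01 x) \<bar>t\<bar>)\<^sup>2 \<le> M / \<alpha>\<^sup>2"
      by (rule frac_le) (use M[OF m] \<alpha>(1) \<alpha>(2)[OF m] in \<open>auto intro: power_mono\<close>)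
    then show "\<bar>ct x t\<bar> \<le> M / \<alpha>\<^sup>2"
      by (simp add: ct_def plane_ext_t_def)
    show "(\<beta> x has_real_derivative \<beta>t x t) (at t)"
      unfolding \<beta>_def[abs_def] \<beta>t_def by (rule DERIV_mult[OF c_d eb_d])
  qed (use cont c_d in \<open>auto simp: \<beta>_def \<beta>t_def split_beta intro!: continuous_intros\<close>)
  obtain f f' l r where lr: "0 < l" "l < r" "r < 1"
    and f: "\<And>x. (f has_real_derivative f' x) (at x)" "continuous_on UNIV f'"
    and f0: "\<And>x. x \<notin> {l<..<r} \<Longrightarrow> f x = 0" "\<And>x. x \<notin> {l<..<r} \<Longrightarrow> f' x = 0"
    and f\<phi>: "\<And>x. x \<in> {0..1} \<Longrightarrow> f x = \<phi> x"
    by (rule C0inf_unit_extension[OF \<phi>]) blast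
  obtain G G' where G: "\<And>t. (G has_real_derivative G' t) (at t)" "continuous_on UNIV G'"
    and Gg: "\<And>t. t \<ge> 0 \<Longrightarrow> G t = g t" and G0: "\<And>t. t \<le> 0 \<Longrightarrow> G t = 0"
    by (rule boundary_data_extension[OF g g'c \<delta>]) blast+
  define h where "h x = foot x 0" for x
  define h' where "h' x = - c x 0 * foot_t x 0" for x
  \<comment> \<open>The damping between \<open>x = 0\<close> and the point \<open>(x, 0)\<close> is undone in advance.\<close>
  define \<rho> where "\<rho> x = f x * exp (damp x 0)" for x
  define \<rho>' where "\<rho>' x = f' x * exp (damp x 0)
      + exp (damp x 0) * (\<beta> x 0 - c x 0 * damp_t x 0) * f x" for x
  have h: "(h has_real_derivative h' x) (at x)" for x
    unfolding h_def[abs_def] h'_def by (rule foot_has_x_derivative)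
  have neg: "h' x < 0" for x
  proof -
    have "c x 0 > 0"
      unfolding c_def using apos[OF clamp01_mem[of x], of 0] by (subst plane_ext_eq[OF r]) auto
    then show ?thesis by (simp add: h'_def foot_t_pos)
  qed
  have line: "continuous_on UNIV (\<lambda>x. F x 0)" if "continuous_on UNIV (\<lambda>(x, t). F x t)"
    for F :: "real \<Rightarrow> real \<Rightarrow> real"
    by (rule continuous_on_pairI[OF that]) (intro continuous_intros)+
  note lines = line[OF c_cont] line[OF \<beta>_cont] line[OF foot_t_cont] line[OF damp_cont] line[OF damp_t_cont]
  have h'c: "continuous_on UNIV h'"
    unfolding h'_def by (intro continuous_intros lines)
  have \<rho>: "(\<rho> has_real_derivative \<rho>' x) (at x)" for x
    unfolding \<rho>_def \<rho>'_def by (rule DERIV_mult[OF f(1) DERIV_fun_exp[OF damp_has_x_derivative]])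
  have fc: "continuous_on UNIV f"
    by (rule DERIV_continuous_on) (blast intro: has_field_derivative_at_within f(1))
  have \<rho>'c: "continuous_on UNIV \<rho>'"
    unfolding \<rho>'_def by (intro continuous_intros lines f fc)
  have \<rho>0: "\<rho> x = 0" if "x \<notin> {l<..<r}" for x using f0[OF that] by (simp add: \<rho>_def)
  obtain \<psi> \<psi>' where \<psi>: "\<And>y. (\<psi> has_real_derivative \<psi>' y) (at y)" "continuous_on UNIV \<psi>'"
    and \<psi>h: "\<And>x. \<psi> (h x) = \<rho> x" and \<psi>0: "\<And>y. y \<notin> {h r..h l} \<Longrightarrow> \<psi> y = 0"
    by (rule push_forward_by_decreasing[OF h h'c neg \<rho> \<rho>'c \<rho>0]) blast+
  have hless: "h y < h x" if "x < y" for x y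
    by (rule DERIV_neg_imp_decreasing[OF that]) (use h neg in blast)
  have h0: "h 0 = 0" by (simp add: h_def foot_0)
  have \<psi>pos: "\<psi> y = 0" if "y \<ge> 0" for y
    using that hless[OF lr(1)] h0 by (intro \<psi>0) auto
  define \<Psi> where "\<Psi> y = G y + \<psi> y" for y
  have \<Psi>: "(\<Psi> has_real_derivative G' y + \<psi>' y) (at y)" for y
    unfolding \<Psi>_def by (rule DERIV_add[OF G(1) \<psi>(1)])
  have \<Psi>c: "continuous_on UNIV (\<lambda>y. G' y + \<psi>' y)" by (intro continuous_intros G(2) \<psi>(2))
  obtain ux ut where ux: "\<And>x t. ((\<lambda>x. sol \<Psi> x t) has_real_derivative ux x t) (at x)"
    and ut: "\<And>x t. (sol \<Psi> x has_real_derivative ut x t) (at t)"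
    and cu: "continuous_on UNIV (\<lambda>(x, t). sol \<Psi> x t)"
    "continuous_on UNIV (\<lambda>(x, t). ux x t)" "continuous_on UNIV (\<lambda>(x, t). ut x t)"
    and eq: "\<And>x t. ux x t + c x t * ut x t + \<beta> x t * sol \<Psi> x t = 0"
    by (rule sol_derivatives[OF \<Psi> \<Psi>c]) blast
  have "\<exists>\<epsilon>>0. \<forall>t. 0 \<le> t \<and> t < \<epsilon> \<longrightarrow> foot 1 t < h r"
  proof -
    have "isCont (foot 1) 0" by (rule DERIV_isCont[OF foot_has_t_derivative])
    then have "(foot 1 \<longlongrightarrow> h 1) (at 0)" by (simp add: isCont_def h_def)
    then have "eventually (\<lambda>t. foot 1 t < h r) (at 0)"
      by (rule order_tendstoD(2)) (rule hless[OF lr(3)])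
    then obtain \<epsilon> where "\<epsilon> > 0" "\<And>t. t \<noteq> 0 \<Longrightarrow> dist t 0 < \<epsilon> \<Longrightarrow> foot 1 t < h r"
      unfolding eventually_at by blast
    then have "foot 1 t < h r" if "0 \<le> t" "t < \<epsilon>" for t
      using that hless[OF lr(3)] by (cases "t = 0") (auto simp: h_def)
    then show ?thesis using \<open>\<epsilon> > 0\<close> by blast
  qed
  then obtain \<epsilon> where \<epsilon>: "\<epsilon> > 0" "\<And>t. 0 \<le> t \<Longrightarrow> t < \<epsilon> \<Longrightarrow> foot 1 t < h r" by blast
  have C1: "C1_with (sol \<Psi>) ux ut"
    unfolding C1_with_def
    using ux ut cu by (auto intro: has_field_derivative_at_within continuous_on_subset)
  show ?thesis
    unfolding delayed_transport_def solves_transport_def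
  proof (intro exI[of _ "sol \<Psi>"] conjI ballI allI impI)
    show "C1_strip (sol \<Psi>)" by (rule C1_with_imp_C1_strip[OF C1])
  next
    fix x t :: real assume xt: "x \<in> {0..1}" "t \<ge> 0"
    have c: "c x t = 1 / a x t" and e: "eb x t = b x t"
      unfolding c_def eb_def using xt by (rule plane_ext_eq_strip[OF r] plane_ext_eq_strip[OF b])+
    have "a x t * (ux x t + c x t * ut x t + \<beta> x t * sol \<Psi> x t) = 0"
      by (simp only: eq)
    then show "partial_t (sol \<Psi>) x t + a x t * partial_x (sol \<Psi>) x t + b x t * sol \<Psi> x t = 0"
      unfolding C1_with_partials[OF C1 xt] using apos[OF xt] by (simp add: \<beta>_def c e algebra_simps)
  next
    fix t :: real assume "t \<ge> 0"
    then show "sol \<Psi> 0 t = g t" by (simp add: sol_def foot_0 \<Psi>_def \<psi>pos Gg)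
  next
    fix x :: real assume x: "x \<in> {0..1}"
    have "h x \<le> 0" using hless[of 0 x] h0 x by (cases "x = 0") auto
    then have "sol \<Psi> x 0 = \<psi> (h x) * exp (- damp x 0)"
      by (simp add: sol_def \<Psi>_def G0 flip: h_def)
    also have "\<dots> = f x" by (simp add: \<psi>h \<rho>_def exp_minus)
    finally show "sol \<Psi> x 0 = \<phi> x" by (simp add: f\<phi>[OF x])
  next
    have "sol \<Psi> 1 t = 0" if "0 \<le> t" "t < \<epsilon>" for t
    proof -
      have "foot 1 t < h r" using \<epsilon>(2) that .
      moreover from this have "foot 1 t < 0" using hless[of 0 r] lr h0 by simp
      ultimately show ?thesis by (simp add: sol_def \<Psi>_def G0 \<psi>0)
    qed
    then show "flat_at_0 (sol \<Psi> (1 - 0))" using \<epsilon>(1) by (auto simp: flat_at_0_def)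
  next
    fix T x t :: real
    assume T: "T \<ge> 0" "\<forall>t>T. g t = 0" and x: "x \<in> {0..1}" and t: "t > T + 3 / \<alpha>"
    have "3 / \<alpha> * \<bar>x\<bar> \<le> 3 / \<alpha> * 1" by (rule mult_left_mono) (use x \<alpha>(1) in auto)
    then have "foot x t > T" using foot_ge[of t x] t by linarith
    then show "sol \<Psi> x t = 0" using T by (simp add: sol_def \<Psi>_def Gg \<psi>pos)
  qed
qed

section \<open>Classical solutions without self-feeding sets\<close>

lemma C1_strip_t_differentiable:
  assumes "C1_strip f"
  shows "t_differentiable f (partial_t f)"
  using C1_strip_imp_C1_with[OF assms] by (simp add: C1_with_def t_differentiable_def)

lemma reflect_derivative: "((\<lambda>x. 1 - x) has_real_derivative - 1) (at x within S)"
  by (auto intro!: derivative_eq_intros)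

lemma C0inf_unit_reflect:
  assumes "C0inf_unit \<phi>"
  shows "C0inf_unit (\<lambda>x. \<phi> (1 - x))"
proof -
  obtain D where D0: "D 0 = \<phi>" and
    D: "\<And>k x. x \<in> {0..1} \<Longrightarrow> (D k has_real_derivative D (Suc k) x) (at x within {0..1})"
    using assms by (auto simp: C0inf_unit_def Cinf_unit_def)
  have "((\<lambda>x. (-1) ^ k * D k (1 - x)) has_real_derivative (-1) ^ Suc k * D (Suc k) (1 - x))
      (at x within {0..1})" if x: "x \<in> {0..1}" for k x
  proof -
    have "(\<lambda>x. 1 - x) ` {0..1} = {0..1::real}"
      using image_diff_atLeastAtMost[of 1 0 1] by simp
    then have "(D k has_real_derivative D (Suc k) (1 - x)) (at (1 - x) within (\<lambda>x. 1 - x) ` {0..1})"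
      using D[of "1 - x" k] x by simp
    from DERIV_image_chain[OF this reflect_derivative]
    have "((\<lambda>x. D k (1 - x)) has_real_derivative - D (Suc k) (1 - x)) (at x within {0..1})"
      by (simp add: o_def)
    from DERIV_cmult[OF this, of "(-1) ^ k"] show ?thesis by simp
  qed
  then have "Cinf_unit (\<lambda>x. \<phi> (1 - x))"
    unfolding Cinf_unit_def
    by (intro exI[of _ "\<lambda>k x. (-1) ^ k * D k (1 - x)"]) (auto simp: D0)
  moreover have "closure {x \<in> {0..1}. \<phi> (1 - x) \<noteq> 0} \<subseteq> {0<..<1}"
  proof -
    let ?S = "{x \<in> {0..1}. \<phi> x \<noteq> 0}"
    have S: "closure ?S \<subseteq> {0<..<1}" using assms by (simp add: C0inf_unit_def)
    have "closed ((\<lambda>x. 1 - x) -` closure ?S)"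
      by (intro closed_vimage continuous_intros) auto
    moreover have "{x \<in> {0..1}. \<phi> (1 - x) \<noteq> 0} \<subseteq> (\<lambda>x. 1 - x) -` closure ?S"
    proof
      fix x assume "x \<in> {x \<in> {0..1}. \<phi> (1 - x) \<noteq> 0}"
      then have "1 - x \<in> ?S" by simp
      then show "x \<in> (\<lambda>x. 1 - x) -` closure ?S" using closure_subset[of ?S] by blast
    qed
    ultimately have "closure {x \<in> {0..1}. \<phi> (1 - x) \<noteq> 0} \<subseteq> (\<lambda>x. 1 - x) -` closure ?S"
      by (intro closure_minimal)
    also have "\<dots> \<subseteq> {0<..<1}" using S by auto
    finally show ?thesis .
  qed
  ultimately show ?thesis by (simp add: C0inf_unit_def)
qed

lemma continuous_on_strip_reflect:
  assumes "continuous_on strip (\<lambda>(x, t). f x t)"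
  shows "continuous_on strip (\<lambda>(x, t). f (1 - x) t)"
proof -
  have "continuous_on strip (\<lambda>z. (\<lambda>(x, t). f x t) (1 - fst z, snd z))"
    by (rule continuous_on_compose2[OF assms]) (auto intro!: continuous_intros simp: strip_def)
  then show ?thesis by (simp add: split_beta)
qed

lemma t_differentiable_reflect:
  assumes "t_differentiable f f'"
  shows "t_differentiable (\<lambda>x. f (1 - x)) (\<lambda>x. f' (1 - x))"
  using assms by (auto simp: t_differentiable_def intro: continuous_on_strip_reflect)

lemma t_differentiable_uminus:
  assumes "t_differentiable f f'"
  shows "t_differentiable (\<lambda>x t. - f x t) (\<lambda>x t. - f' x t)"
  using assms by (auto simp: t_differentiable_def split_beta intro!: continuous_intros DERIV_minus)

lemma C1_with_reflect:
  assumes "C1_with f fx ft"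
  shows "C1_with (\<lambda>x. f (1 - x)) (\<lambda>x t. - fx (1 - x) t) (\<lambda>x. ft (1 - x))"
proof -
  have "((\<lambda>y. f (1 - y) t) has_real_derivative - fx (1 - x) t) (at x within {0..1})"
    if x: "x \<in> {0..1}" and t: "t \<ge> 0" for x t
  proof -
    have "(\<lambda>x. 1 - x) ` {0..1} = {0..1::real}"
      using image_diff_atLeastAtMost[of 1 0 1] by simp
    then have "((\<lambda>y. f y t) has_real_derivative fx (1 - x) t) (at (1 - x) within (\<lambda>x. 1 - x) ` {0..1})"
      using assms x t by (simp add: C1_with_def)
    from DERIV_image_chain[OF this reflect_derivative] show ?thesis
      by (simp add: o_def)
  qed
  moreover have "continuous_on strip (\<lambda>(x, t). - fx (1 - x) t)"
    using continuous_on_minus[OF continuous_on_strip_reflect[of fx]] assms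
    by (simp add: C1_with_def split_beta)
  ultimately show ?thesis
    using assms by (auto simp: C1_with_def intro: continuous_on_strip_reflect)
qed

definition inflow_end :: "nat \<Rightarrow> nat \<Rightarrow> real" where
  "inflow_end m j = (if j < m then 0 else 1)"

lemma delayed_transport_reflect:
  assumes v: "delayed_transport (\<lambda>x t. - a (1 - x) t) (\<lambda>x. b (1 - x)) (\<lambda>x. \<phi> (1 - x)) 0 g K v"
  shows "delayed_transport a b \<phi> 1 g K (\<lambda>x. v (1 - x))"
proof -
  have "C1_with v (partial_x v) (partial_t v)"
    using v by (intro C1_strip_imp_C1_with) (simp add: delayed_transport_def solves_transport_def)
  note u = C1_with_reflect[OF this]
  have pde: "\<forall>x\<in>{0..1}. \<forall>t\<ge>0. partial_t v x t + - a (1 - x) t * partial_x v x t + b (1 - x) t * v x t = 0"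
    using v by (simp add: delayed_transport_def solves_transport_def)
  have "partial_t (\<lambda>x. v (1 - x)) x t + a x t * partial_x (\<lambda>x. v (1 - x)) x t + b x t * v (1 - x) t = 0"
    if xt: "x \<in> {0..1}" "t \<ge> 0" for x t
    using bspec[OF pde, of "1 - x"] xt by (simp add: C1_with_partials[OF u xt])
  then show ?thesis
    using v C1_with_imp_C1_strip[OF u] by (simp add: delayed_transport_def solves_transport_def)
qed

text \<open>The delay \<open>K\<close> depends only on the coefficients, not on the data; this makes the extinction
  time uniform.\<close>

definition solvable_with_delay ::
  "nat \<Rightarrow> nat \<Rightarrow> (nat \<Rightarrow> real \<Rightarrow> real \<Rightarrow> real) \<Rightarrow> (nat \<Rightarrow> real \<Rightarrow> real \<Rightarrow> real) \<Rightarrow> real \<Rightarrow> bool" where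
  "solvable_with_delay n m a b K \<longleftrightarrow>
     (\<forall>j<n. \<forall>\<phi> g g'. C0inf_unit \<phi> \<and> (\<forall>t\<ge>0. (g has_real_derivative g' t) (at t within {0..})) \<and>
        continuous_on {0..} g' \<and> flat_at_0 g \<longrightarrow>
        (\<exists>u. delayed_transport (a j) (b j) \<phi> (inflow_end m j) g K u))"

text \<open>Components with negative speed are reduced to positive speed by the reflection \<open>x \<mapsto> 1 - x\<close>.\<close>

lemma admissible_solvable_with_delay:
  assumes adm: "admissible n m a b"
  obtains K where "K > 0" "solvable_with_delay n m a b K"
proof -
  obtain \<alpha> where \<alpha>: "\<alpha> > 0"
    and pos: "\<And>j x t. j < m \<Longrightarrow> x \<in> {0..1} \<Longrightarrow> t \<ge> 0 \<Longrightarrow> \<alpha> \<le> a j x t"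
    and neg: "\<And>j x t. m \<le> j \<Longrightarrow> j < n \<Longrightarrow> x \<in> {0..1} \<Longrightarrow> t \<ge> 0 \<Longrightarrow> a j x t \<le> - \<alpha>"
    using adm by (auto simp: admissible_def strip_def)
  show thesis
  proof (rule that[of "3 / \<alpha>"])
    show "3 / \<alpha> > 0" using \<alpha> by simp
    show "solvable_with_delay n m a b (3 / \<alpha>)"
      unfolding solvable_with_delay_def
    proof (intro allI impI, elim conjE)
      fix j \<phi> g g'
      assume j: "j < n" and \<phi>: "C0inf_unit \<phi>"
        and g_d: "\<forall>t\<ge>0. (g has_real_derivative g' t) (at t within {0..})"
        and g_c: "continuous_on {0..} g'" and flat: "flat_at_0 g"
      note g = g_d[rule_format] g_c
      have a: "t_differentiable (a j) (partial_t (a j))" and b: "t_differentiable (b j) (partial_t (b j))"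
        using adm j by (auto simp: admissible_def intro!: C1_strip_t_differentiable)
      obtain M where M: "\<And>x t. x \<in> {0..1} \<Longrightarrow> t \<ge> 0 \<Longrightarrow> \<bar>partial_t (a j) x t\<bar> \<le> M"
        using adm j by (fastforce simp: admissible_def bounded_on_strip_def bounded_iff strip_def)
      show "\<exists>u. delayed_transport (a j) (b j) \<phi> (inflow_end m j) g (3 / \<alpha>) u"
      proof (cases "j < m")
        case True
        then show ?thesis
          using scalar_transport_right[OF a b \<alpha> pos[OF True] M \<phi> g flat] by (simp add: inflow_end_def)
      next
        case False
        note a' = t_differentiable_uminus[OF t_differentiable_reflect[OF a]]
        note b' = t_differentiable_reflect[OF b]
        have neg': "\<alpha> \<le> - a j (1 - x) t" if "x \<in> {0..1}" "t \<ge> 0" for x t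
          using neg[of j "1 - x" t] False j that by auto
        have M': "\<bar>- partial_t (a j) (1 - x) t\<bar> \<le> M" if "x \<in> {0..1}" "t \<ge> 0" for x t
          using M[of "1 - x" t] that by simp
        obtain v where "delayed_transport (\<lambda>x t. - a j (1 - x) t) (\<lambda>x. b j (1 - x)) (\<lambda>x. \<phi> (1 - x)) 0 g (3 / \<alpha>) v"
          using scalar_transport_right[OF a' b' \<alpha> neg' M' C0inf_unit_reflect[OF \<phi>] g flat] by blast
        from delayed_transport_reflect[OF this] show ?thesis
          using False by (auto simp: inflow_end_def)
      qed
    qed
  qed
qed

lemma boundary_op_outflow:
  assumes "m \<le> n"
  shows "boundary_op n m P u j t = (\<Sum>k<n. P $$ (j, k) * u k (1 - inflow_end m k) t)"
proof -
  have split: "{..<n} = {..<m} \<union> {m..<n}" using assms by auto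
  have "(\<Sum>k<n. P $$ (j, k) * u k (1 - inflow_end m k) t) =
     (\<Sum>k<m. P $$ (j, k) * u k (1 - inflow_end m k) t) + (\<Sum>k=m..<n. P $$ (j, k) * u k (1 - inflow_end m k) t)"
    unfolding split by (rule sum.union_disjoint) auto
  then show ?thesis by (simp add: boundary_op_def inflow_end_def)
qed

lemma C1_strip_trace:
  assumes f: "C1_strip f" and x: "x \<in> {0..1}"
  shows "t \<ge> 0 \<Longrightarrow> (f x has_real_derivative partial_t f x t) (at t within {0..})"
    "continuous_on {0..} (partial_t f x)"
proof -
  note C = C1_strip_imp_C1_with[OF f]
  show "t \<ge> 0 \<Longrightarrow> (f x has_real_derivative partial_t f x t) (at t within {0..})"
    using C x by (simp add: C1_with_def)
  have "continuous_on {0..} (\<lambda>t. (\<lambda>(x, t). partial_t f x t) (x, t))"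
    by (rule continuous_on_compose2[of strip]) (use C x in \<open>auto simp: C1_with_def strip_def intro!: continuous_intros\<close>)
  then show "continuous_on {0..} (partial_t f x)" by simp
qed

lemma flat_at_0_sum:
  assumes "finite A" "\<And>k. k \<in> A \<Longrightarrow> flat_at_0 (g k)"
  shows "flat_at_0 (\<lambda>t. \<Sum>k\<in>A. c k * g k t)"
proof -
  obtain \<delta> where \<delta>: "\<And>k. k \<in> A \<Longrightarrow> \<delta> k > 0 \<and> (\<forall>t. 0 \<le> t \<and> t < \<delta> k \<longrightarrow> g k t = 0)"
    using assms(2) unfolding flat_at_0_def by metis
  \<comment> \<open>The \<open>1\<close> covers the case of an empty \<open>A\<close>.\<close>
  let ?d = "Min (insert 1 (\<delta> ` A))"
  have "?d > 0" using assms(1) \<delta> by (subst Min_gr_iff) auto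
  moreover have "g k t = 0" if "0 \<le> t" "t < ?d" "k \<in> A" for t k
    using that \<delta>[of k] assms(1) by auto
  ultimately show ?thesis
    unfolding flat_at_0_def by (intro exI[of _ ?d]) (auto intro!: sum.neutral)
qed

text \<open>The inflow is computed from the whole family \<open>u\<close>, but only those members enter that are successors
  of \<open>j\<close>.\<close>

definition component_solution where
  "component_solution n m P a b \<phi> \<tau> u j \<longleftrightarrow>
     solves_transport (a j) (b j) (\<phi> j) (inflow_end m j)
       (\<lambda>t. \<Sum>k<n. P $$ (j, k) * u k (1 - inflow_end m k) t) (u j) \<and>
     flat_at_0 (u j (1 - inflow_end m j)) \<and> (\<forall>x\<in>{0..1}. \<forall>t > \<tau>. u j x t = (0 :: real))"

text \<open>The set \<open>A\<close> is closed under successors, so the equations of its components do not involve the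
  others. As long as \<open>A\<close> is not everything, its complement is not self-feeding, so it contains a component
  all of whose successors lie in \<open>A\<close>. Adding this component costs one more delay.\<close>

lemma successor_closed_solvable:
  fixes P :: "real mat"
  assumes acyclic: "\<not> (\<exists>T. self_feeding n P T)"
    and K: "solvable_with_delay n m a b K" and K0: "K > 0"
  shows "N \<le> n \<Longrightarrow> \<exists>A \<subseteq> {..<n}. card A = N \<and> (\<forall>j\<in>A. \<forall>k<n. P $$ (j, k) \<noteq> 0 \<longrightarrow> k \<in> A) \<and>
    (\<forall>\<phi>. (\<forall>j<n. C0inf_unit (\<phi> j)) \<longrightarrow>
      (\<exists>u. \<forall>j\<in>A. component_solution n m P a b \<phi> (real N * K) u j))"
proof (induction N)
  case 0
  then show ?case by (intro exI[of _ "{}"]) auto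
next
  case (Suc N)
  let ?end = "\<lambda>k. 1 - inflow_end m k"
  obtain A where A: "A \<subseteq> {..<n}" "card A = N"
    and closed: "\<And>j k. j \<in> A \<Longrightarrow> k < n \<Longrightarrow> P $$ (j, k) \<noteq> 0 \<Longrightarrow> k \<in> A"
    and IH: "\<And>\<phi>. (\<forall>j<n. C0inf_unit (\<phi> j)) \<Longrightarrow>
      \<exists>u. \<forall>j\<in>A. component_solution n m P a b \<phi> (real N * K) u j"
    using Suc.IH[OF Suc_leD[OF Suc.prems]] by blast
  have fin: "finite A" using A(1) finite_subset by blast
  have "A \<noteq> {..<n}" using A(2) Suc.prems by auto
  then have "{..<n} - A \<noteq> {}" using A(1) by blast
  moreover have "\<not> self_feeding n P ({..<n} - A)" using acyclic by blast
  ultimately obtain j where j: "j < n" "j \<notin> A" and jA: "\<And>k. k < n \<Longrightarrow> k \<notin> A \<Longrightarrow> P $$ (j, k) = 0"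
    unfolding self_feeding_def by blast
  have endp: "?end k \<in> {0..1}" for k by (simp add: inflow_end_def)
  have "\<exists>u. \<forall>i\<in>insert j A. component_solution n m P a b \<phi> (real (Suc N) * K) u i" if \<phi>: "\<forall>j<n. C0inf_unit (\<phi> j)" for \<phi>
  proof -
    obtain u where u: "\<forall>j\<in>A. component_solution n m P a b \<phi> (real N * K) u j"
      using IH[OF \<phi>] by blast
    have uC: "C1_strip (u k)" and uf: "flat_at_0 (u k (?end k))"
      and u0: "\<And>x t. x \<in> {0..1} \<Longrightarrow> t > real N * K \<Longrightarrow> u k x t = 0" if "k \<in> A" for k
      using u that by (auto simp: component_solution_def solves_transport_def)
    define g where "g t = (\<Sum>k\<in>A. P $$ (j, k) * u k (?end k) t)" for t
    define g' where "g' t = (\<Sum>k\<in>A. P $$ (j, k) * partial_t (u k) (?end k) t)" for t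
    have g: "(g has_real_derivative g' t) (at t within {0..})" if "t \<ge> 0" for t
      unfolding g_def[abs_def] g'_def
      by (intro DERIV_sum DERIV_cmult C1_strip_trace(1)[OF uC endp] that)
    have g'c: "continuous_on {0..} g'"
      unfolding g'_def[abs_def] by (intro continuous_intros C1_strip_trace(2)[OF uC endp])
    have flat: "flat_at_0 g"
      unfolding g_def[abs_def] by (rule flat_at_0_sum[OF fin uf])
    obtain v where v: "solves_transport (a j) (b j) (\<phi> j) (inflow_end m j) g v"
      and vf: "flat_at_0 (v (?end j))"
      and vT: "\<And>T. T \<ge> 0 \<Longrightarrow> (\<forall>t>T. g t = 0) \<Longrightarrow> (\<forall>x\<in>{0..1}. \<forall>t>T + K. v x t = 0)"
      using K[unfolded solvable_with_delay_def delayed_transport_def, rule_format, OF j(1), of "\<phi> j" g g']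
        \<phi> j(1) g g'c flat
      by blast
    let ?u = "u(j := v)"
    have off: "(\<Sum>k<n. P $$ (i, k) * ?u k (?end k) t) = (\<Sum>k<n. P $$ (i, k) * u k (?end k) t)"
      if "P $$ (i, j) = 0" for i t
      by (rule sum.cong) (use that in auto)
    have gsum: "g t = (\<Sum>k<n. P $$ (j, k) * ?u k (?end k) t)" for t
      unfolding g_def off[OF jA[OF j]]
      by (rule sum.mono_neutral_left) (use A(1) jA in auto)
    have NK: "real N * K \<ge> 0" using K0 by simp
    have "g t = 0" if "t > real N * K" for t
      unfolding g_def by (rule sum.neutral) (use u0 that endp in auto)
    then have v0: "v x t = 0" if "x \<in> {0..1}" "t > real (Suc N) * K" for x t
      using vT[OF NK] that by (auto simp: algebra_simps)
    have old: "component_solution n m P a b \<phi> (real (Suc N) * K) ?u i" if i: "i \<in> A" for i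
    proof -
      have Pij: "P $$ (i, j) = 0" using closed[OF i j(1)] j(2) by blast
      have ne: "?u i = u i" using i j(2) by auto
      have "real N * K \<le> real (Suc N) * K" using K0 by (intro mult_right_mono) auto
      then have "\<forall>x\<in>{0..1}. \<forall>t > real (Suc N) * K. u i x t = 0"
        using u0[OF i] by (meson order.strict_trans1)
      then show ?thesis
        using u i unfolding component_solution_def off[OF Pij] ne by blast
    qed
    have "component_solution n m P a b \<phi> (real (Suc N) * K) ?u j"
      unfolding component_solution_def gsum[symmetric] using v vf v0 by simp
    with old show ?thesis by blast
  qed
  moreover have "insert j A \<subseteq> {..<n}" "card (insert j A) = Suc N"
    using A j fin by auto
  moreover have "\<forall>i\<in>insert j A. \<forall>k<n. P $$ (i, k) \<noteq> 0 \<longrightarrow> k \<in> insert j A"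
    using closed jA by blast
  ultimately show ?case by blast
qed

theorem acyclic_classical_solution:
  assumes m: "m \<le> n" and adm: "admissible n m a b" and acyclic: "\<not> (\<exists>T. self_feeding n P T)"
  obtains T where "T > 0" "\<And>\<phi>. (\<forall>j<n. C0inf_unit (\<phi> j)) \<Longrightarrow>
    \<exists>u. classical_solution n m P a b \<phi> u \<and> (\<forall>j<n. \<forall>x\<in>{0..1}. \<forall>t>T. u j x t = 0)"
proof -
  obtain K where K0: "K > 0" and K: "solvable_with_delay n m a b K"
    by (rule admissible_solvable_with_delay[OF adm])
  obtain A where A: "A \<subseteq> {..<n}" "card A = n" and sol: "\<And>\<phi>. (\<forall>j<n. C0inf_unit (\<phi> j)) \<Longrightarrow>
      \<exists>u. \<forall>j\<in>A. component_solution n m P a b \<phi> (real n * K) u j"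
    using successor_closed_solvable[OF acyclic K K0 order_refl] by blast
  \<comment> \<open>The extinction time is the number of components times the delay; the \<open>1\<close> added below makes it positive.\<close>
  have An: "A = {..<n}" using A by (simp add: card_subset_eq)
  show thesis
  proof (rule that[of "real n * K + 1"])
    show "real n * K + 1 > 0" using K0 by (simp add: add_nonneg_pos)
    fix \<phi> :: "nat \<Rightarrow> real \<Rightarrow> real" assume "\<forall>j<n. C0inf_unit (\<phi> j)"
    then obtain u where "\<forall>j<n. component_solution n m P a b \<phi> (real n * K) u j"
      using sol unfolding An by blast
    then have u: "\<forall>j<n. solves_transport (a j) (b j) (\<phi> j) (inflow_end m j)
         (\<lambda>t. \<Sum>k<n. P $$ (j, k) * u k (1 - inflow_end m k) t) (u j)"
      "\<forall>j<n. \<forall>x\<in>{0..1}. \<forall>t > real n * K. u j x t = 0"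
      by (simp_all add: component_solution_def)
    have "classical_solution n m P a b \<phi> u"
      unfolding classical_solution_def boundary_op_outflow[OF m]
    proof (intro conjI allI ballI impI)
      fix j t assume "j < m" "t \<ge> (0 :: real)"
      then show "u j 0 t = (\<Sum>k<n. P $$ (j, k) * u k (1 - inflow_end m k) t)"
        using u(1)[rule_format, of j] m by (simp add: solves_transport_def inflow_end_def[of m j])
    next
      fix j t assume "j \<in> {m..<n}" "t \<ge> (0 :: real)"
      then show "u j 1 t = (\<Sum>k<n. P $$ (j, k) * u k (1 - inflow_end m k) t)"
        using u(1)[rule_format, of j] by (simp add: solves_transport_def inflow_end_def[of m j])
    qed (use u(1) in \<open>auto simp: solves_transport_def\<close>)
    then show "\<exists>u. classical_solution n m P a b \<phi> u \<and> (\<forall>j<n. \<forall>x\<in>{0..1}. \<forall>t>real n * K + 1. u j x t = 0)"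
      using u(2) by (intro exI[of _ u]) auto
  qed
qed

section \<open>Test functions are dense\<close>

text \<open>These functions arise as factors in the derivatives of \<open>exp (- 1/s)\<close>. The derivative of \<open>decay i\<close> is
  a polynomial times \<open>decay (i + 2)\<close>, so that polynomials times \<open>decay i\<close>, for all \<open>i\<close>, are closed
  under differentiation.\<close>

definition decay :: "nat \<Rightarrow> real \<Rightarrow> real" where
  "decay i s = (if s > 0 then exp (- 1 / s) / s ^ i else 0)"

lemma decay_shift: "decay i s = s * decay (Suc i) s"
  by (simp add: decay_def)

lemma decay_tendsto_0: "(decay i \<longlongrightarrow> 0) (at 0)"
  unfolding filterlim_at_split
proof
  have "eventually (\<lambda>s. decay i s = 0) (at_left 0)"
    by (auto simp: eventually_at_filter decay_def)
  then show "(decay i \<longlongrightarrow> 0) (at_left 0)" by (rule tendsto_eventually)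
  have "((\<lambda>x :: real. x ^ i / exp x) \<longlongrightarrow> 0) at_top" by (rule tendsto_power_div_exp_0)
  moreover have "eventually (\<lambda>x. decay i (inverse x) = x ^ i / exp x) at_top"
    using eventually_gt_at_top[of 0]
    by eventually_elim (simp add: decay_def exp_minus field_simps)
  ultimately show "(decay i \<longlongrightarrow> 0) (at_right 0)"
    unfolding filterlim_at_right_to_top by (simp cong: tendsto_cong)
qed

lemma decay_has_derivative:
  "(decay i has_real_derivative (1 - real i * s) * decay (i + 2) s) (at s)"
proof -
  consider "s > 0" | "s < 0" | "s = 0" by linarith
  then show ?thesis
  proof cases
    case 1
    have "((\<lambda>s. exp (- 1 / s) / s ^ i) has_real_derivative (1 - real i * s) * decay (i + 2) s) (at s)"
    proof -
      have e: "((\<lambda>s. exp (- 1 / s)) has_real_derivative exp (- 1 / s) / s\<^sup>2) (at s)"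
        using 1 by (auto intro!: derivative_eq_intros simp: power2_eq_square)
      have p: "((\<lambda>s. s ^ i) has_real_derivative real i * s ^ (i - 1)) (at s)"
        by (auto intro!: derivative_eq_intros)
      have "(exp (- 1 / s) / s\<^sup>2 * s ^ i - exp (- 1 / s) * (real i * s ^ (i - 1))) / (s ^ i * s ^ i) =
          (1 - real i * s) * decay (i + 2) s"
        using 1 by (cases i) (auto simp: decay_def field_simps power2_eq_square)
      then show ?thesis using DERIV_divide[OF e p] 1 by simp
    qed
    then show ?thesis
      by (rule has_field_derivative_transform_within_open[where S = "{0<..}"])
         (use 1 in \<open>auto simp: decay_def\<close>)
  next
    case 2
    have "((\<lambda>_. 0 :: real) has_real_derivative 0) (at s)" by simp
    then have "(decay i has_real_derivative 0) (at s)"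
      by (rule has_field_derivative_transform_within_open[where S = "{..<0}"])
         (use 2 in \<open>auto simp: decay_def\<close>)
    then show ?thesis using 2 by (simp add: decay_def)
  next
    case 3
    have "((\<lambda>h. (decay i (0 + h) - decay i 0) / h) \<longlongrightarrow> 0) (at 0)"
      by (rule Lim_transform_eventually[OF decay_tendsto_0[of "Suc i"]])
         (auto simp: eventually_at_filter decay_def)
    then show ?thesis using 3 by (simp add: DERIV_def decay_def)
  qed
qed

text \<open>The polynomial factor in the \<open>k\<close>-th derivative of \<open>bump w q\<close> below.\<close>

primrec bump_factor :: "real poly \<Rightarrow> real poly \<Rightarrow> nat \<Rightarrow> real poly" where
  "bump_factor w q 0 = q" |
  "bump_factor w q (Suc k) = pderiv (bump_factor w q k) * w ^ 2 +
     bump_factor w q k * pderiv w * (1 - [:real (2 * k):] * w)"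

text \<open>A smooth function with support in \<open>{x. poly w x \<ge> 0}\<close>.\<close>

definition bump :: "real poly \<Rightarrow> real poly \<Rightarrow> real \<Rightarrow> real" where
  "bump w q x = poly q x * decay 0 (poly w x)"

lemma Cinf_unit_bump: "Cinf_unit (bump w q)"
  unfolding Cinf_unit_def
proof (intro exI[of _ "\<lambda>k x. poly (bump_factor w q k) x * decay (2 * k) (poly w x)"] conjI allI ballI)
  show "(\<lambda>x. poly (bump_factor w q 0) x * decay (2 * 0) (poly w x)) = bump w q"
    by (auto simp: bump_def)
  fix k x
  let ?Q = "bump_factor w q k" and ?d = "\<lambda>i. decay i (poly w x)"
  have "((\<lambda>x. poly ?Q x * decay (2 * k) (poly w x)) has_real_derivative
      poly (pderiv ?Q) x * ?d (2 * k) +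
      (1 - real (2 * k) * poly w x) * ?d (2 * k + 2) * poly (pderiv w) x * poly ?Q x) (at x)"
    by (rule DERIV_mult[OF poly_DERIV DERIV_chain2[OF decay_has_derivative poly_DERIV]])
  moreover have "?d (2 * k) = (poly w x)\<^sup>2 * ?d (2 * k + 2)"
    using decay_shift[of "2 * k" "poly w x"] decay_shift[of "Suc (2 * k)" "poly w x"]
    by (simp add: power2_eq_square)
  ultimately have "((\<lambda>x. poly ?Q x * decay (2 * k) (poly w x)) has_real_derivative
      poly (bump_factor w q (Suc k)) x * decay (2 * Suc k) (poly w x)) (at x)"
    by (simp add: algebra_simps)
  then show "((\<lambda>x. poly ?Q x * decay (2 * k) (poly w x)) has_real_derivative
      poly (bump_factor w q (Suc k)) x * decay (2 * Suc k) (poly w x)) (at x within {0..1})"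
    by (rule has_field_derivative_at_within)
qed

lemma C0inf_unit_bump:
  assumes "poly w 0 < 0" "poly w 1 < 0"
  shows "C0inf_unit (bump w q)"
proof -
  have "closed ({0..1} \<inter> {x. 0 \<le> poly w x})"
    by (intro closed_Int closed_atLeastAtMost closed_Collect_le continuous_intros)
  moreover have "{x \<in> {0..1}. bump w q x \<noteq> 0} \<subseteq> ({0..1} \<inter> {x. 0 \<le> poly w x})"
    by (auto simp: bump_def decay_def split: if_splits)
  ultimately have "closure {x \<in> {0..1}. bump w q x \<noteq> 0} \<subseteq> ({0..1} \<inter> {x. 0 \<le> poly w x})"
    by (rule closure_minimal[rotated])
  also have "\<dots> \<subseteq> {0<..<1}"
    using assms by (auto simp: order.order_iff_strict)
  finally show ?thesis by (simp add: C0inf_unit_def Cinf_unit_bump)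
qed

text \<open>At each point of \<open>(0, 1)\<close> these polynomials tend to infinity, while they stay negative at the end points, so
  that \<open>bump (cutoff k) q\<close> tends to \<open>poly q\<close> without any normalization.\<close>

definition cutoff :: "nat \<Rightarrow> real poly" where
  "cutoff k = [:-1, real k, - real k:]"

lemma poly_cutoff: "poly (cutoff k) x = real k * (x * (1 - x)) - 1"
  by (simp add: cutoff_def algebra_simps)

lemma bump_cutoff_tendsto:
  assumes "x \<in> {0<..<1}"
  shows "(\<lambda>k. bump (cutoff k) q x) \<longlonglongrightarrow> poly q x"
proof -
  have p: "x * (1 - x) > 0" using assms by simp
  have "filterlim (\<lambda>k. real k * (x * (1 - x))) at_top sequentially"
    using filterlim_at_top_mult_tendsto_pos[OF tendsto_const p filterlim_real_sequentially] .
  from filterlim_tendsto_add_at_top[OF tendsto_const[of "- 1"] this]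
  have w: "filterlim (\<lambda>k. poly (cutoff k) x) at_top sequentially"
    by (simp add: poly_cutoff)
  have "((\<lambda>s :: real. - 1 / s) \<longlongrightarrow> 0) at_top"
    by (rule real_tendsto_divide_at_top[OF tendsto_const filterlim_ident])
  then have "((\<lambda>s :: real. exp (- 1 / s)) \<longlongrightarrow> 1) at_top"
    using tendsto_exp by fastforce
  moreover have "eventually (\<lambda>s. exp (- 1 / s) = decay 0 s) at_top"
    using eventually_gt_at_top[of 0] by eventually_elim (simp add: decay_def)
  ultimately have "(decay 0 \<longlongrightarrow> 1) at_top" by (rule Lim_transform_eventually)
  from tendsto_mult[OF tendsto_const[of "poly q x"] filterlim_compose[OF this w]]
  show ?thesis by (simp add: bump_def)
qed

lemma bump_bound: "\<bar>bump w q x\<bar> \<le> \<bar>poly q x\<bar>"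
proof -
  have "decay 0 s \<in> {0..1}" for s by (simp add: decay_def)
  then show ?thesis by (auto simp: bump_def abs_mult intro!: mult_right_le_one_le)
qed

abbreviation "unit_measure \<equiv> lebesgue_on {0<..<1::real}"

lemma finite_unit_measure: "finite_measure unit_measure"
  by (rule finite_measure_lebesgue_on) (rule lmeasurable_interval)

lemma space_unit_measure [simp]: "space unit_measure = {0<..<1}"
  by (simp add: space_restrict_space)

lemma L2_unit_bounded:
  assumes "f \<in> borel_measurable unit_measure" "\<And>x. x \<in> {0<..<1} \<Longrightarrow> \<bar>f x\<bar> \<le> B"
  shows "L2_unit f"
proof -
  interpret finite_measure unit_measure by (rule finite_unit_measure)
  have "(f x)\<^sup>2 \<le> B\<^sup>2" if "x \<in> {0<..<1}" for x
    using power_mono[OF assms(2)[OF that], of 2] by simp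
  then have "integrable unit_measure (\<lambda>x. (f x)\<^sup>2)"
    by (intro integrable_const_bound[of _ "B\<^sup>2"]) (auto intro!: AE_I2 borel_measurable_power assms(1))
  then show ?thesis using assms(1) by (simp add: L2_unit_def)
qed

lemma L2_unit_continuous:
  assumes "continuous_on {0..1} f"
  shows "L2_unit f"
proof -
  have "continuous_on {0<..<1} f" using assms by (rule continuous_on_subset) auto
  then have m: "f \<in> borel_measurable unit_measure"
    by (rule continuous_imp_measurable_on_sets_lebesgue) simp
  have "bounded (f ` {0..1})"
    using assms by (intro compact_imp_bounded compact_continuous_image) auto
  then obtain B where "\<forall>x\<in>{0..1}. \<bar>f x\<bar> \<le> B"
    unfolding bounded_iff by auto
  then show ?thesis by (intro L2_unit_bounded[OF m, of B]) auto
qed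

lemma L2_unit_dominated:
  assumes "f \<in> borel_measurable unit_measure" "integrable unit_measure h"
    "\<And>x. x \<in> {0<..<1} \<Longrightarrow> (f x)\<^sup>2 \<le> h x"
  shows "L2_unit f"
  unfolding L2_unit_def
  using assms by (auto intro!: Bochner_Integration.integrable_bound[OF assms(2)] AE_I2
      simp: order_trans[OF _ abs_ge_self])

lemma square_add_bound: "((x :: real) + y)\<^sup>2 \<le> 2 * x\<^sup>2 + 2 * y\<^sup>2"
  using sum_squares_bound[of x y] by (simp add: power2_sum)

lemma L2_unit_add:
  assumes "L2_unit f" "L2_unit g"
  shows "L2_unit (\<lambda>x. f x + g x)"
  using assms unfolding L2_unit_def[of f] L2_unit_def[of g]
  by (intro L2_unit_dominated[where h = "\<lambda>x. 2 * (f x)\<^sup>2 + 2 * (g x)\<^sup>2"])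
     (auto simp: square_add_bound)

lemma L2_unit_cmult:
  assumes "L2_unit f"
  shows "L2_unit (\<lambda>x. c * f x)"
  using assms by (auto simp: L2_unit_def power_mult_distrib intro!: borel_measurable_times)

lemma L2_unit_diff:
  assumes "L2_unit f" "L2_unit g"
  shows "L2_unit (\<lambda>x. f x - g x)"
  using L2_unit_add[OF assms(1) L2_unit_cmult[OF assms(2), of "- 1"]] by simp

definition L2_sq :: "(real \<Rightarrow> real) \<Rightarrow> real" where
  "L2_sq f = integral\<^sup>L unit_measure (\<lambda>x. (f x)\<^sup>2)"

lemma L2_sq_nonneg: "L2_sq f \<ge> 0"
  by (simp add: L2_sq_def)

lemma L2_norm_unit_sq: "L2_norm_unit f = sqrt (L2_sq f)"
  by (simp add: L2_norm_unit_def L2_sq_def)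

lemma L2_sq_add:
  assumes "L2_unit f" "L2_unit g"
  shows "L2_sq (\<lambda>x. f x + g x) \<le> 2 * L2_sq f + 2 * L2_sq g"
proof -
  have "L2_sq (\<lambda>x. f x + g x) \<le> (\<integral>x. 2 * (f x)\<^sup>2 + 2 * (g x)\<^sup>2 \<partial>unit_measure)"
    unfolding L2_sq_def
    using assms L2_unit_add[OF assms] square_add_bound
    by (intro integral_mono) (auto simp: L2_unit_def)
  also have "\<dots> = 2 * L2_sq f + 2 * L2_sq g"
    using assms by (simp add: L2_unit_def L2_sq_def)
  finally show ?thesis .
qed

definition test_approximable :: "(real \<Rightarrow> real) \<Rightarrow> bool" where
  "test_approximable f \<longleftrightarrow> L2_unit f \<and> (\<forall>\<epsilon>>0. \<exists>\<phi>. C0inf_unit \<phi> \<and> L2_sq (\<lambda>x. \<phi> x - f x) < \<epsilon>)"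

lemma C0inf_unit_L2: "C0inf_unit \<phi> \<Longrightarrow> L2_unit \<phi>"
proof -
  assume "C0inf_unit \<phi>"
  then obtain D where "D 0 = \<phi>"
    "\<forall>k. \<forall>x\<in>{0..1}. (D k has_real_derivative D (Suc k) x) (at x within {0..1})"
    by (auto simp: C0inf_unit_def Cinf_unit_def)
  then have "(\<phi> has_real_derivative D 1 x) (at x within {0..1})" if "x \<in> {0..1}" for x
    using that by (metis One_nat_def)
  then show ?thesis by (intro L2_unit_continuous DERIV_continuous_on)
qed

lemma test_approximable_C0inf: "C0inf_unit \<phi> \<Longrightarrow> test_approximable \<phi>"
  unfolding test_approximable_def by (auto simp: C0inf_unit_L2 L2_sq_def intro!: exI[of _ \<phi>])

text \<open>Dominated convergence. Four applications lead from test functions to polynomials, to continuous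
  functions, to bounded measurable functions, and to all of \<open>L\<^sup>2\<close>.\<close>

lemma test_approximable_limit:
  assumes f: "L2_unit f" and g: "\<And>n. test_approximable (g n)"
    and lim: "AE x in unit_measure. (\<lambda>n. g n x) \<longlonglongrightarrow> f x"
    and h: "integrable unit_measure h" and dom: "\<And>n x. x \<in> {0<..<1} \<Longrightarrow> (g n x - f x)\<^sup>2 \<le> h x"
  shows "test_approximable f"
  unfolding test_approximable_def
proof (intro conjI allI impI f)
  fix \<epsilon> :: real assume "\<epsilon> > 0"
  have gL: "L2_unit (g n)" for n using g by (simp add: test_approximable_def)
  have "(\<lambda>n. L2_sq (\<lambda>x. g n x - f x)) \<longlonglongrightarrow> integral\<^sup>L unit_measure (\<lambda>x. 0)"
    unfolding L2_sq_def
  proof (rule integral_dominated_convergence[where w = h])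
    show "(\<lambda>x. (g n x - f x)\<^sup>2) \<in> borel_measurable unit_measure" for n
      using gL[of n] f by (auto simp: L2_unit_def)
    show "AE x in unit_measure. (\<lambda>n. (g n x - f x)\<^sup>2) \<longlonglongrightarrow> 0"
      using lim by eventually_elim (auto intro!: tendsto_eq_intros)
    show "AE x in unit_measure. norm ((g n x - f x)\<^sup>2) \<le> h x" for n
      using dom by (auto intro!: AE_I2)
  qed (use h in auto)
  then have "(\<lambda>n. L2_sq (\<lambda>x. g n x - f x)) \<longlonglongrightarrow> 0" by simp
  then have "eventually (\<lambda>n. L2_sq (\<lambda>x. g n x - f x) < \<epsilon> / 4) sequentially"
    by (rule order_tendstoD(2)) (use \<open>\<epsilon> > 0\<close> in simp)
  then obtain n where n: "L2_sq (\<lambda>x. g n x - f x) < \<epsilon> / 4"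
    using eventually_happens' sequentially_bot by blast
  obtain \<phi> where \<phi>: "C0inf_unit \<phi>" "L2_sq (\<lambda>x. \<phi> x - g n x) < \<epsilon> / 4"
    using g[of n] \<open>\<epsilon> > 0\<close> unfolding test_approximable_def by (meson divide_pos_pos zero_less_numeral)
  have "L2_sq (\<lambda>x. (\<phi> x - g n x) + (g n x - f x)) < \<epsilon>"
    using L2_sq_add[OF L2_unit_diff[OF C0inf_unit_L2[OF \<phi>(1)] gL] L2_unit_diff[OF gL f], of n n] \<phi>(2) n
    by linarith
  then show "\<exists>\<phi>. C0inf_unit \<phi> \<and> L2_sq (\<lambda>x. \<phi> x - f x) < \<epsilon>" using \<phi>(1) by auto
qed

lemma test_approximable_poly: "test_approximable (poly q)"
proof (rule test_approximable_limit[where g = "\<lambda>k. bump (cutoff k) q" and h = "\<lambda>x. 4 * (poly q x)\<^sup>2"])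
  show L: "L2_unit (poly q)" by (rule L2_unit_continuous) (intro continuous_intros)
  then show "integrable unit_measure (\<lambda>x. 4 * (poly q x)\<^sup>2)" by (simp add: L2_unit_def)
  show "test_approximable (bump (cutoff k) q)" for k
    by (intro test_approximable_C0inf C0inf_unit_bump) (simp_all add: poly_cutoff)
  show "AE x in unit_measure. (\<lambda>k. bump (cutoff k) q x) \<longlonglongrightarrow> poly q x"
    by (rule AE_I2) (simp add: bump_cutoff_tendsto)
  show "(bump (cutoff k) q x - poly q x)\<^sup>2 \<le> 4 * (poly q x)\<^sup>2" for k x
  proof -
    have "\<bar>bump (cutoff k) q x - poly q x\<bar> \<le> \<bar>2 * poly q x\<bar>"
      using bump_bound[of "cutoff k" q x] by linarith
    from abs_le_square_iff[THEN iffD1, OF this] show ?thesis by (simp add: power_mult_distrib)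
  qed
qed

lemma test_approximable_continuous:
  assumes f: "continuous_on {0..1} f"
  shows "test_approximable f"
proof -
  have "\<exists>q. \<forall>x\<in>{0..1}. \<bar>f x - poly q x\<bar> < inverse (real (Suc n))" for n
  proof -
    obtain g where g: "real_polynomial_function g" "\<And>x. x \<in> {0..1} \<Longrightarrow> \<bar>f x - g x\<bar> < inverse (real (Suc n))"
      by (rule Stone_Weierstrass_real_polynomial_function[OF compact_Icc f, of "inverse (real (Suc n))"])
        (simp, blast)
    obtain a N where "g = (\<lambda>x. \<Sum>i\<le>N. a i * x ^ i)"
      using g(1) real_polynomial_function_iff_sum by blast
    then have "g x = poly (\<Sum>i\<le>N. monom (a i) i) x" for x
      by (simp add: poly_sum poly_monom)
    then show ?thesis using g(2) by metis
  qed
  then obtain q where q: "\<And>n x. x \<in> {0..1} \<Longrightarrow> \<bar>f x - poly (q n) x\<bar> < inverse (real (Suc n))"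
    by metis
  interpret finite_measure unit_measure by (rule finite_unit_measure)
  show ?thesis
  proof (rule test_approximable_limit[where g = "\<lambda>n. poly (q n)" and h = "\<lambda>_. 1"])
    show "AE x in unit_measure. (\<lambda>n. poly (q n) x) \<longlonglongrightarrow> f x"
    proof (rule AE_I2)
      fix x assume "x \<in> space unit_measure"
      then have "norm (poly (q n) x - f x) \<le> inverse (real (Suc n))" for n
        using q[of x n] by (auto simp: abs_minus_commute less_imp_le)
      then have "(\<lambda>n. poly (q n) x - f x) \<longlonglongrightarrow> 0"
        by (intro Lim_null_comparison[OF _ LIMSEQ_inverse_real_of_nat]) auto
      then show "(\<lambda>n. poly (q n) x) \<longlonglongrightarrow> f x" by (simp add: LIM_zero_iff)
    qed
    show "(poly (q n) x - f x)\<^sup>2 \<le> 1" if "x \<in> {0<..<1}" for n x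
    proof -
      have "\<bar>poly (q n) x - f x\<bar> \<le> 1"
        using q[of x n] that inverse_le_1_iff[of "real (Suc n)"] by (auto simp: abs_minus_commute)
      then show ?thesis using abs_le_square_iff[of _ 1] by fastforce
    qed
  qed (auto simp: f L2_unit_continuous test_approximable_poly)
qed

text \<open>A Lebesgue measurable function is an almost everywhere limit of continuous functions; these are
  truncated at the bound of \<open>f\<close> to have a dominating constant.\<close>

lemma test_approximable_bounded:
  assumes f: "f \<in> borel_measurable unit_measure" and B: "\<And>x. \<bar>f x\<bar> \<le> B"
  shows "test_approximable f"
proof -
  have "f measurable_on {0<..<1}"
    by (subst measurable_on_iff_borel_measurable) (use f in auto)
  then obtain N g where N: "negligible N" and g: "\<And>n. continuous_on UNIV (g n)"
    and lim: "\<And>x. x \<notin> N \<Longrightarrow> (\<lambda>n. g n x) \<longlonglongrightarrow> (if x \<in> {0<..<1} then f x else 0)"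
    unfolding measurable_on_def by blast
  let ?g = "\<lambda>n x. max (- B) (min B (g n x))"
  interpret finite_measure unit_measure by (rule finite_unit_measure)
  show ?thesis
  proof (rule test_approximable_limit[where g = ?g and h = "\<lambda>_. (2 * B)\<^sup>2"])
    show "L2_unit f" by (rule L2_unit_bounded[OF f B])
    show "test_approximable (?g n)" for n
      by (intro test_approximable_continuous continuous_intros continuous_on_subset[OF g]) auto
    have "AE x in lebesgue. x \<in> {0<..<1} \<longrightarrow> (\<lambda>n. ?g n x) \<longlonglongrightarrow> f x"
    proof (rule AE_I'[of N])
      show "N \<in> null_sets lebesgue" using N by (simp add: negligible_iff_null_sets)
      have "(\<lambda>n. ?g n x) \<longlonglongrightarrow> f x" if "x \<notin> N" "x \<in> {0<..<1}" for x
      proof -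
        have "(\<lambda>n. ?g n x) \<longlonglongrightarrow> max (- B) (min B (f x))"
          using lim[OF that(1)] that(2) by (intro tendsto_intros) auto
        moreover have "max (- B) (min B (f x)) = f x" using B[of x] by auto
        ultimately show ?thesis by simp
      qed
      then show "{x \<in> space lebesgue. \<not> (x \<in> {0<..<1} \<longrightarrow> (\<lambda>n. ?g n x) \<longlonglongrightarrow> f x)} \<subseteq> N" by blast
    qed
    then show "AE x in unit_measure. (\<lambda>n. ?g n x) \<longlonglongrightarrow> f x"
      by (simp add: AE_restrict_space_iff)
    show "(?g n x - f x)\<^sup>2 \<le> (2 * B)\<^sup>2" for n x
    proof -
      have "\<bar>?g n x - f x\<bar> \<le> \<bar>2 * B\<bar>" using B[of x] by (auto simp: max_def min_def)
      then show ?thesis using abs_le_square_iff by blast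
    qed
  qed simp
qed

lemma test_approximable_L2:
  assumes f: "L2_unit f"
  shows "test_approximable f"
proof -
  let ?g = "\<lambda>n x. max (- real n) (min (real n) (f x))"
  have fm: "f \<in> borel_measurable unit_measure" and fi: "integrable unit_measure (\<lambda>x. (f x)\<^sup>2)"
    using f by (auto simp: L2_unit_def)
  show ?thesis
  proof (rule test_approximable_limit[where g = ?g and h = "\<lambda>x. (f x)\<^sup>2", OF f])
    show "test_approximable (?g n)" for n
      by (rule test_approximable_bounded[where B = "real n"]) (use fm in \<open>auto simp: max_def min_def\<close>)
    show "AE x in unit_measure. (\<lambda>n. ?g n x) \<longlonglongrightarrow> f x"
    proof (rule AE_I2)
      fix x
      obtain N :: nat where "\<bar>f x\<bar> \<le> real N" using real_arch_simple by blast
      then have "?g n x = f x" if "n \<ge> N" for n using that by (auto simp: max_def min_def)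
      then show "(\<lambda>n. ?g n x) \<longlonglongrightarrow> f x"
        by (intro tendsto_eventually) (auto simp: eventually_sequentially)
    qed
    show "(?g n x - f x)\<^sup>2 \<le> (f x)\<^sup>2" for n x
    proof -
      have "\<bar>?g n x - f x\<bar> \<le> \<bar>f x\<bar>" by (auto simp: max_def min_def)
      then show ?thesis using abs_le_square_iff by blast
    qed
  qed (rule fi)
qed

lemma L2_norm_vec_tendsto_0:
  assumes "n > 0" "\<And>j. j < n \<Longrightarrow> (\<lambda>l. L2_norm_unit (f l j)) \<longlonglongrightarrow> 0"
  shows "(\<lambda>l. L2_norm_vec n (f l)) \<longlonglongrightarrow> 0"
proof (rule tendstoI)
  fix \<epsilon> :: real assume "\<epsilon> > 0"
  then have "\<forall>j\<in>{..<n}. eventually (\<lambda>l. L2_norm_unit (f l j) < \<epsilon>) sequentially"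
    using order_tendstoD(2)[OF assms(2)] by blast
  then have "eventually (\<lambda>l. \<forall>j\<in>{..<n}. L2_norm_unit (f l j) < \<epsilon>) sequentially"
    by (simp add: eventually_ball_finite)
  then show "eventually (\<lambda>l. dist (L2_norm_vec n (f l)) 0 < \<epsilon>) sequentially"
  proof eventually_elim
    case (elim l)
    have ne: "(\<lambda>j. L2_norm_unit (f l j)) ` {..<n} \<noteq> {}" using assms(1) by auto
    have "L2_norm_vec n (f l) < \<epsilon>"
      unfolding L2_norm_vec_def using elim ne by (subst Max_less_iff) auto
    moreover have "0 \<le> L2_norm_unit (f l 0)" by (simp add: L2_norm_unit_def)
    then have "0 \<le> L2_norm_vec n (f l)"
      unfolding L2_norm_vec_def using assms(1) by (subst Max_ge_iff) (auto intro!: bexI[of _ 0])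
    ultimately show ?case by simp
  qed
qed

lemma L2_norm_unit_le_vec:
  assumes "j < n"
  shows "L2_norm_unit (f j) \<le> L2_norm_vec n f"
  unfolding L2_norm_vec_def using assms by (intro Max_ge) auto

theorem C0inf_unit_dense:
  assumes n: "n > 0" and \<phi>: "\<And>j. j < n \<Longrightarrow> L2_unit (\<phi> j)"
  obtains \<phi>s where "\<And>l j. j < n \<Longrightarrow> C0inf_unit (\<phi>s l j)"
    "(\<lambda>l. L2_norm_vec n (\<lambda>j x. \<phi>s l j x - \<phi> j x)) \<longlonglongrightarrow> 0"
proof -
  have "\<exists>\<psi>. C0inf_unit \<psi> \<and> L2_sq (\<lambda>x. \<psi> x - \<phi> j x) < (inverse (real (Suc l)))\<^sup>2" if "j < n" for l j
    using test_approximable_L2[OF \<phi>[OF that]] unfolding test_approximable_def by simp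
  note ex = this
  define \<phi>s where "\<phi>s l j = (SOME \<psi>. C0inf_unit \<psi> \<and>
    L2_sq (\<lambda>x. \<psi> x - \<phi> j x) < (inverse (real (Suc l)))\<^sup>2)" for l j
  have \<phi>s: "C0inf_unit (\<phi>s l j)"
    "L2_sq (\<lambda>x. \<phi>s l j x - \<phi> j x) < (inverse (real (Suc l)))\<^sup>2" if "j < n" for l j
    using someI_ex[OF ex[OF that, of l]] unfolding \<phi>s_def by blast+
  have "(\<lambda>l. L2_norm_unit (\<lambda>x. \<phi>s l j x - \<phi> j x)) \<longlonglongrightarrow> 0" if "j < n" for j
  proof (rule Lim_null_comparison[OF _ LIMSEQ_inverse_real_of_nat], rule always_eventually, rule allI)
    fix l
    have "L2_norm_unit (\<lambda>x. \<phi>s l j x - \<phi> j x) \<le> sqrt ((inverse (real (Suc l)))\<^sup>2)"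
      unfolding L2_norm_unit_sq using \<phi>s(2)[OF that, of l] by (intro real_sqrt_le_mono) simp
    then show "norm (L2_norm_unit (\<lambda>x. \<phi>s l j x - \<phi> j x)) \<le> inverse (real (Suc l))"
      by (simp add: L2_norm_unit_sq L2_sq_nonneg)
  qed
  then show thesis by (intro that[of \<phi>s] \<phi>s(1) L2_norm_vec_tendsto_0 n)
qed

section \<open>Energy estimate for constant coefficients\<close>

lemma continuous_on_strip_swap:
  assumes "continuous_on strip (\<lambda>(x, t). f x t)"
  shows "continuous_on ({0..} \<times> cbox 0 1) (\<lambda>(t, x). f x t)"
proof -
  have "continuous_on ({0..} \<times> cbox 0 1) (\<lambda>z. (\<lambda>(x, t). f x t) (snd z, fst z))"
    by (rule continuous_on_compose2[OF assms]) (auto intro!: continuous_intros simp: strip_def)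
  then show ?thesis by (simp add: split_beta)
qed

lemma continuous_on_strip_slice:
  assumes "continuous_on strip (\<lambda>(x, t). f x t)" "t \<ge> 0"
  shows "continuous_on {0..1} (\<lambda>x. f x t)"
proof -
  have "continuous_on {0..1} (\<lambda>x. (\<lambda>(x, t). f x t) (x, t))"
    by (rule continuous_on_compose2[OF assms(1)])
       (use assms(2) in \<open>auto intro!: continuous_intros simp: strip_def\<close>)
  then show ?thesis by simp
qed

definition weighted_energy :: "real \<Rightarrow> (real \<Rightarrow> real \<Rightarrow> real) \<Rightarrow> real \<Rightarrow> real" where
  "weighted_energy \<mu> w t = integral {0..1} (\<lambda>x. exp (\<mu> * x) * (w x t)\<^sup>2)"

lemma weighted_energy_has_derivative:
  assumes w: "C1_with w wx wt" and t: "t \<ge> 0"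
  shows "(weighted_energy \<mu> w has_real_derivative
     integral {0..1} (\<lambda>x. exp (\<mu> * x) * (2 * w x t * wt x t))) (at t within {0..})"
proof -
  have c: "continuous_on strip (\<lambda>(x, t). w x t)" "continuous_on strip (\<lambda>(x, t). wt x t)"
    using w by (auto simp: C1_with_def)
  have "((\<lambda>t. integral (cbox 0 1) (\<lambda>x. exp (\<mu> * x) * (w x t)\<^sup>2)) has_field_derivative
     integral (cbox 0 1) (\<lambda>x. exp (\<mu> * x) * (2 * w x t * wt x t))) (at t within {0..})"
  proof (rule leibniz_rule_field_derivative)
    fix s x :: real assume "s \<in> {0..}" "x \<in> cbox 0 1"
    then have "(w x has_real_derivative wt x s) (at s within {0..})"
      using w by (simp add: C1_with_def)
    then show "((\<lambda>t. exp (\<mu> * x) * (w x t)\<^sup>2) has_field_derivative exp (\<mu> * x) * (2 * w x s * wt x s))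
        (at s within {0..})"
      by (auto intro!: derivative_eq_intros)
  next
    fix s :: real assume "s \<in> {0..}"
    then show "(\<lambda>x. exp (\<mu> * x) * (w x s)\<^sup>2) integrable_on cbox 0 1"
      by (intro integrable_continuous continuous_intros)
         (use continuous_on_strip_slice[OF c(1), of s] in simp)
  next
    have "continuous_on ({0..} \<times> cbox 0 1) (\<lambda>z. w (snd z) (fst z))"
      "continuous_on ({0..} \<times> cbox 0 1) (\<lambda>z. wt (snd z) (fst z))"
      using continuous_on_strip_swap[OF c(1)] continuous_on_strip_swap[OF c(2)]
      by (simp_all add: split_beta)
    then show "continuous_on ({0..} \<times> cbox 0 1) (\<lambda>(s, x). exp (\<mu> * x) * (2 * w x s * wt x s))"
      unfolding split_beta by (intro continuous_intros)
  qed (use t in auto)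
  then show ?thesis by (simp add: weighted_energy_def[abs_def])
qed

lemma weighted_energy_balance:
  assumes w: "C1_with w wx wt" and t: "t > 0"
    and pde: "\<And>x. x \<in> {0<..<1} \<Longrightarrow> wt x t + A * wx x t + B * w x t = 0"
  shows "(weighted_energy \<mu> w has_real_derivative
     - A * (exp \<mu> * (w 1 t)\<^sup>2 - (w 0 t)\<^sup>2) + (A * \<mu> - 2 * B) * weighted_energy \<mu> w t) (at t)"
proof -
  have "continuous_on strip (\<lambda>(x, t). w x t)" "continuous_on strip (\<lambda>(x, t). wt x t)"
    "continuous_on strip (\<lambda>(x, t). wx x t)"
    using w by (auto simp: C1_with_def)
  then have c: "continuous_on {0..1} (\<lambda>x. w x t)" "continuous_on {0..1} (\<lambda>x. wt x t)"
    "continuous_on {0..1} (\<lambda>x. wx x t)"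
    using t by (auto intro: continuous_on_strip_slice)
  let ?E = "\<lambda>x. exp (\<mu> * x) * (w x t)\<^sup>2"
  let ?F = "\<lambda>x. \<mu> * exp (\<mu> * x) * (w x t)\<^sup>2 + exp (\<mu> * x) * (2 * w x t * wx x t)"
  have "(?F has_integral ?E 1 - ?E 0) {0..1}"
  proof (rule fundamental_theorem_of_calculus)
    fix x :: real assume "x \<in> {0..1}"
    then have "((\<lambda>x. w x t) has_real_derivative wx x t) (at x within {0..1})"
      using w t by (simp add: C1_with_def)
    then have "(?E has_real_derivative ?F x) (at x within {0..1})"
      by (auto intro!: derivative_eq_intros)
    then show "(?E has_vector_derivative ?F x) (at x within {0..1})"
      by (simp add: has_real_derivative_iff_has_vector_derivative)
  qed simp
  then have F: "integral {0..1} ?F = exp \<mu> * (w 1 t)\<^sup>2 - (w 0 t)\<^sup>2"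
    by (simp add: integral_unique)
  let ?G = "\<lambda>x. exp (\<mu> * x) * (2 * w x t * wt x t)"
  have int: "(\<lambda>x. A * ?F x) integrable_on {0..1}" "?G integrable_on {0..1}"
    by (intro integrable_continuous_interval continuous_intros c)+
  have "integral {0..1} (\<lambda>x. ?G x + A * ?F x) = integral {0..1} (\<lambda>x. (A * \<mu> - 2 * B) * ?E x)"
  proof (rule integral_spike[of "{0, 1}"])
    fix x :: real assume x: "x \<in> {0..1} - {0, 1}"
    have eq: "wt x t = - A * wx x t - B * w x t" using pde[of x] x by auto
    show "(A * \<mu> - 2 * B) * ?E x = ?G x + A * ?F x"
      unfolding eq by (simp add: algebra_simps power2_eq_square)
  qed simp
  also have "integral {0..1} (\<lambda>x. ?G x + A * ?F x) = integral {0..1} ?G + A * integral {0..1} ?F"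
    unfolding integral_add[OF int(2,1)] by simp
  also have "integral {0..1} (\<lambda>x. (A * \<mu> - 2 * B) * ?E x) = (A * \<mu> - 2 * B) * weighted_energy \<mu> w t"
    unfolding weighted_energy_def by (rule integral_mult_right)
  finally have "integral {0..1} ?G = - A * (exp \<mu> * (w 1 t)\<^sup>2 - (w 0 t)\<^sup>2) + (A * \<mu> - 2 * B) * weighted_energy \<mu> w t"
    unfolding F by linarith
  moreover have "(weighted_energy \<mu> w has_real_derivative integral {0..1} ?G) (at t)"
    using weighted_energy_has_derivative[OF w, of t \<mu>] t by (simp add: at_within_interior[of t "{0..}"])
  ultimately show ?thesis by simp
qed

lemma L2_sq_continuous:
  assumes "continuous_on {0..1} f"
  shows "L2_sq f = integral {0..1} (\<lambda>x. (f x)\<^sup>2)"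
proof -
  have "integrable unit_measure (\<lambda>x. (f x)\<^sup>2)"
    using L2_unit_continuous[OF assms] by (simp add: L2_unit_def)
  then have "L2_sq f = integral {0<..<1} (\<lambda>x. (f x)\<^sup>2)"
    unfolding L2_sq_def by (rule lebesgue_integral_eq_integral) simp
  then show ?thesis by (simp add: integral_open_interval_real)
qed

lemma weighted_energy_bounds:
  assumes w: "continuous_on {0..1} (\<lambda>x. w x t)" and
    \<mu>: "\<And>x. x \<in> {0..1} \<Longrightarrow> l \<le> exp (\<mu> * x)" "\<And>x. x \<in> {0..1} \<Longrightarrow> exp (\<mu> * x) \<le> r"
  shows "l * L2_sq (\<lambda>x. w x t) \<le> weighted_energy \<mu> w t"
    and "weighted_energy \<mu> w t \<le> r * L2_sq (\<lambda>x. w x t)"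
proof -
  have int: "(\<lambda>x. k * (w x t)\<^sup>2) integrable_on {0..1}" "(\<lambda>x. exp (\<mu> * x) * (w x t)\<^sup>2) integrable_on {0..1}" for k
    by (intro integrable_continuous_interval continuous_intros w)+
  have "integral {0..1} (\<lambda>x. l * (w x t)\<^sup>2) \<le> weighted_energy \<mu> w t"
    unfolding weighted_energy_def by (intro integral_le int mult_right_mono \<mu>) auto
  then show "l * L2_sq (\<lambda>x. w x t) \<le> weighted_energy \<mu> w t" by (simp add: L2_sq_continuous[OF w])
  have "weighted_energy \<mu> w t \<le> integral {0..1} (\<lambda>x. r * (w x t)\<^sup>2)"
    unfolding weighted_energy_def by (intro integral_le int mult_right_mono \<mu>) auto
  then show "weighted_energy \<mu> w t \<le> r * L2_sq (\<lambda>x. w x t)" by (simp add: L2_sq_continuous[OF w])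
qed

lemma Gronwall_differential:
  fixes E :: "real \<Rightarrow> real"
  assumes c: "continuous_on {0..T} E" and d: "\<And>t. 0 < t \<Longrightarrow> t < T \<Longrightarrow> \<exists>D. (E has_real_derivative D) (at t) \<and> D \<le> Q * E t"
    and T: "T \<ge> 0"
  shows "E T \<le> exp (Q * T) * E 0"
proof (cases "T = 0")
  case False
  let ?F = "\<lambda>t. exp (- Q * t) * E t"
  have "?F T \<le> ?F 0"
  proof (rule DERIV_nonpos_imp_decreasing_open[where a = 0 and b = T and f = ?F])
    show "0 \<le> T" by (rule T)
    fix t assume "0 < t" "t < T"
    then obtain D where D: "(E has_real_derivative D) (at t)" "D \<le> Q * E t" using d by blast
    have "(?F has_real_derivative - Q * exp (- Q * t) * E t + exp (- Q * t) * D) (at t)"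
      by (auto intro!: derivative_eq_intros D(1))
    moreover have "- Q * exp (- Q * t) * E t + exp (- Q * t) * D = exp (- Q * t) * (D - Q * E t)"
      by (simp add: algebra_simps)
    moreover have "exp (- Q * t) * (D - Q * E t) \<le> 0"
      using D(2) by (intro mult_nonneg_nonpos) auto
    ultimately show "\<exists>y. (?F has_real_derivative y) (at t) \<and> y \<le> 0" by metis
  qed (intro continuous_intros c)
  then have "exp (Q * T) * ?F T \<le> exp (Q * T) * E 0" by (simp add: mult_left_mono)
  then show ?thesis by (simp add: exp_minus field_simps)
qed simp

text \<open>The Frobenius norm bounds the operator norm.\<close>

lemma sum_square_matrix_bound:
  fixes P :: "nat \<Rightarrow> nat \<Rightarrow> real"
  shows "(\<Sum>j<n. (\<Sum>k<n. P j k * v k)\<^sup>2) \<le> (\<Sum>j<n. \<Sum>k<n. (P j k)\<^sup>2) * (\<Sum>k<n. (v k)\<^sup>2)"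
  unfolding sum_distrib_right
  by (intro sum_mono order_trans[OF Cauchy_Schwarz_ineq_sum]) (simp add: sum_distrib_right)

text \<open>The boundary terms of all components add up to \<open>\<Sum> in\<^sup>2 - exp \<kappa> * \<Sum> out\<^sup>2\<close>, where the weight
  grows by the factor \<open>exp \<kappa>\<close> from the inflow end to the outflow end. By the boundary condition
  \<open>\<Sum> in\<^sup>2\<close> is at most \<open>\<Sum> out\<^sup>2\<close> times the squared Frobenius norm of \<open>P\<close>, so a large \<open>\<kappa>\<close> makes
  them nonpositive, and what remains of the energy balance is controlled by Gronwall's inequality.\<close>

lemma classical_solution_energy_estimate:
  assumes m: "m \<le> n" and Apos: "\<And>j. j < m \<Longrightarrow> A j > 0" and Aneg: "\<And>j. m \<le> j \<Longrightarrow> j < n \<Longrightarrow> A j < (0 :: real)"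
  obtains C Q where "C \<ge> 0" "Q \<ge> 0"
    "\<And>\<phi> w j t. classical_solution n m P (\<lambda>j x t. A j) (\<lambda>j x t. B j) \<phi> w \<Longrightarrow> j < n \<Longrightarrow> t \<ge> 0 \<Longrightarrow>
      L2_sq (\<lambda>x. w j x t) \<le> C * exp (Q * t) * (\<Sum>k<n. L2_sq (\<lambda>x. w k x 0))"
proof -
  define S where "S = (\<Sum>j<n. \<Sum>k<n. (P $$ (j, k))\<^sup>2)"
  have S0: "S \<ge> 0" unfolding S_def by (intro sum_nonneg) auto
  \<comment> \<open>Any \<open>\<kappa> \<ge> 0\<close> with \<open>exp \<kappa> \<ge> S\<close> will do.\<close>
  define \<kappa> where "\<kappa> = S"
  have \<kappa>: "\<kappa> \<ge> 0" "S \<le> exp \<kappa>"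
    using S0 exp_ge_add_one_self[of S] unfolding \<kappa>_def by linarith+
  \<comment> \<open>The weight \<open>c j * exp (\<mu> j * x)\<close> is \<open>1 / \<bar>A j\<bar>\<close> at the inflow end and \<open>exp \<kappa> / \<bar>A j\<bar>\<close> at the outflow end.\<close>
  define \<mu> where "\<mu> j = (if j < m then \<kappa> else - \<kappa>)" for j
  define c where "c j = (if j < m then 1 else exp \<kappa>) / \<bar>A j\<bar>" for j
  have A0: "A j \<noteq> 0" if "j < n" for j
    using Apos[of j] Aneg[of j] that by (cases "j < m") auto
  have c0: "c j > 0" if "j < n" for j using A0[OF that] by (simp add: c_def)
  define Q where "Q = (\<Sum>j<n. \<bar>A j * \<mu> j - 2 * B j\<bar>)"
  have Q0: "Q \<ge> 0" unfolding Q_def by (intro sum_nonneg) auto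
  have Qj: "A j * \<mu> j - 2 * B j \<le> Q" if "j < n" for j
    using member_le_sum[of j "{..<n}" "\<lambda>j. \<bar>A j * \<mu> j - 2 * B j\<bar>"] that unfolding Q_def by auto
  define C1 where "C1 = (\<Sum>j<n. \<bar>A j\<bar>)"
  define C2 where "C2 = (\<Sum>j<n. exp \<kappa> / \<bar>A j\<bar>)"
  have CC: "C1 \<ge> 0" "C2 \<ge> 0" unfolding C1_def C2_def by (auto intro!: sum_nonneg)
  show thesis
  proof (rule that[of "C1 * C2" Q])
    show "C1 * C2 \<ge> 0" using CC by simp
    fix \<phi> w j t
    assume w: "classical_solution n m P (\<lambda>j x t. A j) (\<lambda>j x t. B j) \<phi> w" and j: "j < n" and t: "t \<ge> (0 :: real)"
    have C1: "C1_with (w k) (partial_x (w k)) (partial_t (w k))" if "k < n" for k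
      using w that by (intro C1_strip_imp_C1_with) (simp add: classical_solution_def)
    have slice: "continuous_on {0..1} (\<lambda>x. w k x s)" if "k < n" "s \<ge> 0" for k s
      using C1[OF that(1)] that(2) by (intro continuous_on_strip_slice) (auto simp: C1_with_def)
    define inn where "inn k s = w k (inflow_end m k) s" for k s
    define out where "out k s = w k (1 - inflow_end m k) s" for k s
    define E where "E s = (\<Sum>k<n. c k * weighted_energy (\<mu> k) (w k) s)" for s
    have wb: "L2_sq (\<lambda>x. w k x s) \<le> \<bar>A k\<bar> * (c k * weighted_energy (\<mu> k) (w k) s)"
      "c k * weighted_energy (\<mu> k) (w k) s \<le> exp \<kappa> / \<bar>A k\<bar> * L2_sq (\<lambda>x. w k x s)" if k: "k < n" and s: "s \<ge> 0" for k s
    proof -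
      have l: "(if k < m then 1 else exp (- \<kappa>)) \<le> exp (\<mu> k * x)" "exp (\<mu> k * x) \<le> (if k < m then exp \<kappa> else 1)"
        if "x \<in> {0..1}" for x
        using that \<kappa>(1) mult_left_mono[of x 1 \<kappa>] by (auto simp: \<mu>_def)
      note b = weighted_energy_bounds[where w = "w k" and t = s, OF slice[OF k s] l]
      show "L2_sq (\<lambda>x. w k x s) \<le> \<bar>A k\<bar> * (c k * weighted_energy (\<mu> k) (w k) s)"
      proof (cases "k < m")
        case True
        then show ?thesis using b(1) A0[OF k] by (simp add: c_def)
      next
        case False
        have "exp \<kappa> * (exp (- \<kappa>) * L2_sq (\<lambda>x. w k x s)) \<le> exp \<kappa> * weighted_energy (\<mu> k) (w k) s"
          using b(1) False by (intro mult_left_mono) auto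
        moreover have "exp \<kappa> * (exp (- \<kappa>) * L2_sq (\<lambda>x. w k x s)) = L2_sq (\<lambda>x. w k x s)"
          by (simp add: exp_minus)
        ultimately show ?thesis using False A0[OF k] by (simp add: c_def)
      qed
      show "c k * weighted_energy (\<mu> k) (w k) s \<le> exp \<kappa> / \<bar>A k\<bar> * L2_sq (\<lambda>x. w k x s)"
        using mult_left_mono[OF b(2), of "c k"] c0[OF k] by (cases "k < m") (auto simp: c_def)
    qed
    have wnn: "c k * weighted_energy (\<mu> k) (w k) s \<ge> 0" if "k < n" "s \<ge> 0" for k s
      using order_trans[OF L2_sq_nonneg wb(1)[OF that]] A0[OF that(1)] by (simp add: zero_le_mult_iff)
    have E: "\<exists>D. (E has_real_derivative D) (at s) \<and> D \<le> Q * E s" if s: "s > 0" for s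
    proof -
      define D where "D k = - A k * (exp (\<mu> k) * (w k 1 s)\<^sup>2 - (w k 0 s)\<^sup>2)
          + (A k * \<mu> k - 2 * B k) * weighted_energy (\<mu> k) (w k) s" for k
      have dE: "(E has_real_derivative (\<Sum>k<n. c k * D k)) (at s)"
        unfolding E_def[abs_def]
      proof (intro DERIV_sum DERIV_cmult)
        fix k assume "k \<in> {..<n}"
        then have k: "k < n" by simp
        show "(weighted_energy (\<mu> k) (w k) has_real_derivative D k) (at s)"
          unfolding D_def
          by (rule weighted_energy_balance[OF C1[OF k] s])
             (use w k s in \<open>simp add: classical_solution_def\<close>)
      qed
      have "c k * D k \<le> (inn k s)\<^sup>2 - exp \<kappa> * (out k s)\<^sup>2 + Q * (c k * weighted_energy (\<mu> k) (w k) s)" if k: "k < n" for k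
      proof -
        have "c k * (- A k * (exp (\<mu> k) * (w k 1 s)\<^sup>2 - (w k 0 s)\<^sup>2)) = (inn k s)\<^sup>2 - exp \<kappa> * (out k s)\<^sup>2"
        proof (cases "k < m")
          case True
          then show ?thesis using Apos[OF True] by (simp add: c_def \<mu>_def inn_def out_def inflow_end_def)
        next
          case False
          then have "\<bar>A k\<bar> = - A k" "A k \<noteq> 0" using Aneg[of k] k by auto
          then show ?thesis using False
            by (simp add: c_def \<mu>_def inn_def out_def inflow_end_def exp_minus field_simps)
        qed
        moreover have "(A k * \<mu> k - 2 * B k) * (c k * weighted_energy (\<mu> k) (w k) s)
            \<le> Q * (c k * weighted_energy (\<mu> k) (w k) s)"
          using Qj[OF k] wnn[OF k] s by (intro mult_right_mono) auto
        ultimately show ?thesis by (simp add: D_def algebra_simps)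
      qed
      then have "(\<Sum>k<n. c k * D k) \<le> (\<Sum>k<n. (inn k s)\<^sup>2 - exp \<kappa> * (out k s)\<^sup>2 + Q * (c k * weighted_energy (\<mu> k) (w k) s))"
        by (intro sum_mono) simp
      also have "\<dots> = (\<Sum>k<n. (inn k s)\<^sup>2) - exp \<kappa> * (\<Sum>k<n. (out k s)\<^sup>2) + Q * E s"
        by (simp add: E_def sum.distrib sum_subtractf sum_distrib_left)
      also have "\<dots> \<le> Q * E s"
      proof -
        have "inn k s = (\<Sum>i<n. P $$ (k, i) * out i s)" if "k < n" for k
          using w that m s boundary_op_outflow[OF m, of P w k s]
          by (cases "k < m") (auto simp: classical_solution_def inn_def out_def inflow_end_def[of m k])
        then have "(\<Sum>k<n. (inn k s)\<^sup>2) = (\<Sum>k<n. (\<Sum>i<n. P $$ (k, i) * out i s)\<^sup>2)" by simp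
        also have "\<dots> \<le> S * (\<Sum>k<n. (out k s)\<^sup>2)" unfolding S_def by (rule sum_square_matrix_bound)
        also have "\<dots> \<le> exp \<kappa> * (\<Sum>k<n. (out k s)\<^sup>2)"
          by (intro mult_right_mono \<kappa> sum_nonneg) auto
        finally show ?thesis by simp
      qed
      finally show ?thesis using dE by blast
    qed
    have "continuous_on {0..} (weighted_energy (\<mu> k) (w k))" if "k < n" for k
      using weighted_energy_has_derivative[OF C1[OF that]] by (intro DERIV_continuous_on) auto
    then have "continuous_on {0..} E"
      unfolding E_def by (intro continuous_intros) auto
    then have "E t \<le> exp (Q * t) * E 0"
      by (intro Gronwall_differential E t) (auto intro: continuous_on_subset)
    also have "E 0 \<le> C2 * (\<Sum>k<n. L2_sq (\<lambda>x. w k x 0))"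
      unfolding E_def C2_def sum_distrib_left
    proof (rule sum_mono)
      fix k assume "k \<in> {..<n}"
      then have k: "k < n" by simp
      have "exp \<kappa> / \<bar>A k\<bar> \<le> (\<Sum>j<n. exp \<kappa> / \<bar>A j\<bar>)"
        using k by (intro member_le_sum) auto
      then show "c k * weighted_energy (\<mu> k) (w k) 0 \<le> (\<Sum>j<n. exp \<kappa> / \<bar>A j\<bar>) * L2_sq (\<lambda>x. w k x 0)"
        using wb(2)[OF k order_refl] mult_right_mono[OF _ L2_sq_nonneg] order_trans by blast
    qed
    finally have Et: "E t \<le> exp (Q * t) * (C2 * (\<Sum>k<n. L2_sq (\<lambda>x. w k x 0)))" by simp
    have "c j * weighted_energy (\<mu> j) (w j) t \<le> E t"
      unfolding E_def by (rule member_le_sum[where f = "\<lambda>k. c k * weighted_energy (\<mu> k) (w k) t"]) (use j wnn t in auto)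
    moreover have "\<bar>A j\<bar> \<le> C1" unfolding C1_def using j by (intro member_le_sum) auto
    ultimately have "\<bar>A j\<bar> * (c j * weighted_energy (\<mu> j) (w j) t) \<le> C1 * E t"
      using wnn[OF j t] by (intro mult_mono CC) auto
    with wb(1)[OF j t] have "L2_sq (\<lambda>x. w j x t) \<le> C1 * E t" by linarith
    also have "\<dots> \<le> C1 * (exp (Q * t) * (C2 * (\<Sum>k<n. L2_sq (\<lambda>x. w k x 0))))"
      by (rule mult_left_mono[OF Et CC(1)])
    finally show "L2_sq (\<lambda>x. w j x t) \<le> C1 * C2 * exp (Q * t) * (\<Sum>k<n. L2_sq (\<lambda>x. w k x 0))"
      by (simp add: mult_ac)
  qed (rule Q0)
qed

section \<open>Classical solutions are generalized solutions\<close>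

lemma C1_with_diff:
  assumes "C1_with f fx ft" "C1_with g gx gt"
  shows "C1_with (\<lambda>x t. f x t - g x t) (\<lambda>x t. fx x t - gx x t) (\<lambda>x t. ft x t - gt x t)"
  using assms by (auto simp: C1_with_def split_beta intro!: DERIV_diff continuous_intros)

lemma classical_solution_diff:
  assumes mn: "m \<le> n" and u: "classical_solution n m P a b \<phi> u" and v: "classical_solution n m P a b \<psi> v"
  shows "classical_solution n m P a b (\<lambda>j x. \<phi> j x - \<psi> j x) (\<lambda>j x t. u j x t - v j x t)"
proof -
  have C: "C1_with (\<lambda>x t. u j x t - v j x t)
      (\<lambda>x t. partial_x (u j) x t - partial_x (v j) x t) (\<lambda>x t. partial_t (u j) x t - partial_t (v j) x t)"
    if "j < n" for j
    using u v that by (intro C1_with_diff C1_strip_imp_C1_with) (auto simp: classical_solution_def)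
  have bd: "boundary_op n m P (\<lambda>j x t. u j x t - v j x t) j t = boundary_op n m P u j t - boundary_op n m P v j t" for j t
    unfolding boundary_op_outflow[OF mn] by (simp add: right_diff_distrib sum_subtractf)
  show ?thesis
    unfolding classical_solution_def
  proof (intro conjI allI impI ballI)
    fix j assume j: "j < n"
    show "C1_strip (\<lambda>x t. u j x t - v j x t)" by (rule C1_with_imp_C1_strip[OF C[OF j]])
    show "u j x 0 - v j x 0 = \<phi> j x - \<psi> j x" if "x \<in> {0..1}" for x
      using u v j that by (simp add: classical_solution_def)
    fix x t :: real assume xt: "x \<in> {0<..<1}" "t > 0"
    then have xt': "x \<in> {0..1}" "t \<ge> 0" by auto
    have "partial_t (u j) x t + a j x t * partial_x (u j) x t + b j x t * u j x t = 0"
      "partial_t (v j) x t + a j x t * partial_x (v j) x t + b j x t * v j x t = 0"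
      using u v j xt by (simp_all add: classical_solution_def)
    then show "partial_t (\<lambda>x t. u j x t - v j x t) x t + a j x t * partial_x (\<lambda>x t. u j x t - v j x t) x t
        + b j x t * (u j x t - v j x t) = 0"
      unfolding C1_with_partials[OF C[OF j] xt'] by (simp add: algebra_simps)
  qed (use u v mn in \<open>auto simp: classical_solution_def bd\<close>)
qed

lemma C1_strip_L2_continuous:
  assumes u: "C1_strip u"
  shows "L2_continuous (\<lambda>t x. u x t)"
proof -
  have c: "continuous_on strip (\<lambda>(x, t). u x t)" using u by (simp add: C1_strip_def)
  have slice: "continuous_on {0..1} (\<lambda>x. u x t)" if "t \<ge> 0" for t
    by (rule continuous_on_strip_slice[OF c that])
  have "((\<lambda>s. L2_norm_unit (\<lambda>x. u x s - u x t)) \<longlongrightarrow> 0) (at t within {0..})" if t: "t \<ge> 0" for t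
  proof -
    let ?I = "\<lambda>s. integral (cbox 0 1) (\<lambda>x. (u x s - u x t)\<^sup>2)"
    have c1: "continuous_on ({0..} \<times> cbox 0 1) (\<lambda>z. u (snd z) (fst z))"
      using continuous_on_strip_swap[OF c] by (simp add: split_beta)
    have c2: "continuous_on ({0..} \<times> cbox 0 1) (\<lambda>z :: real \<times> real. u (snd z) t)"
      by (rule continuous_on_compose2[OF slice[OF t]]) (auto intro!: continuous_intros)
    have "continuous_on ({0..} \<times> cbox 0 1) (\<lambda>(s, x). (u x s - u x t)\<^sup>2)"
      unfolding split_beta by (intro continuous_intros c1 c2)
    from integral_continuous_on_param[OF this]
    have "(?I \<longlongrightarrow> ?I t) (at t within {0..})"
      using t unfolding continuous_on_def by blast
    from tendsto_real_sqrt[OF this] have lim: "((\<lambda>s. sqrt (?I s)) \<longlongrightarrow> 0) (at t within {0..})" by simp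
    have "eventually (\<lambda>s. sqrt (?I s) = L2_norm_unit (\<lambda>x. u x s - u x t)) (at t within {0..})"
      unfolding eventually_at_filter
    proof (rule always_eventually, intro allI impI)
      fix s :: real assume "s \<noteq> t" "s \<in> {0..}"
      then have "continuous_on {0..1} (\<lambda>x. u x s - u x t)" by (intro continuous_intros slice t) auto
      then show "sqrt (?I s) = L2_norm_unit (\<lambda>x. u x s - u x t)"
        by (simp add: L2_norm_unit_sq L2_sq_continuous)
    qed
    with lim show ?thesis by (rule Lim_transform_eventually)
  qed
  then show ?thesis using L2_unit_continuous[OF slice] by (simp add: L2_continuous_def)
qed

text \<open>Differences of classical solutions are classical solutions, so the energy estimate bounds the
  distance to every approximating sequence by the distance of the initial data. The lemma covers initial data that do not
  vanish near the boundary, such as those of the periodic solution below.\<close>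

lemma classical_imp_generalized:
  assumes n: "n > 0" and mn: "m \<le> n"
    and Apos: "\<And>j. j < m \<Longrightarrow> A j > 0" and Aneg: "\<And>j. m \<le> j \<Longrightarrow> j < n \<Longrightarrow> A j < (0 :: real)"
    and u: "classical_solution n m P (\<lambda>j x t. A j) (\<lambda>j x t. B j) \<phi> u"
  shows "L2_generalized_solution n m P (\<lambda>j x t. A j) (\<lambda>j x t. B j) \<phi> (\<lambda>j t x. u j x t)"
  unfolding L2_generalized_solution_def
proof (intro conjI allI impI)
  show "L2_continuous (\<lambda>t x. u j x t)" if "j < n" for j
    using u that by (intro C1_strip_L2_continuous) (simp add: classical_solution_def)
  fix \<phi>s us and T :: real
  assume lim: "(\<lambda>l. L2_norm_vec n (\<lambda>j x. \<phi>s l j x - \<phi> j x)) \<longlonglongrightarrow> 0"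
    and us: "\<forall>l. classical_solution n m P (\<lambda>j x t. A j) (\<lambda>j x t. B j) (\<phi>s l) (us l)" and T: "T > 0"
  obtain C Q where C: "C \<ge> 0" and Q: "Q \<ge> 0" and est:
    "\<And>\<phi> w j t. classical_solution n m P (\<lambda>j x t. A j) (\<lambda>j x t. B j) \<phi> w \<Longrightarrow> j < n \<Longrightarrow> t \<ge> 0 \<Longrightarrow>
      L2_sq (\<lambda>x. w j x t) \<le> C * exp (Q * t) * (\<Sum>k<n. L2_sq (\<lambda>x. w k x 0))"
    by (rule classical_solution_energy_estimate[where P = P and B = B, OF mn Apos Aneg]) blast+
  define K where "K = sqrt (C * exp (Q * T) * real n)"
  let ?d = "\<lambda>l. L2_norm_vec n (\<lambda>j x. \<phi>s l j x - \<phi> j x)"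
  have nn: "L2_norm_vec n f \<ge> 0" for f
  proof -
    have "0 \<le> L2_norm_unit (f 0)" by (simp add: L2_norm_unit_sq L2_sq_nonneg)
    also have "\<dots> \<le> L2_norm_vec n f" by (rule L2_norm_unit_le_vec[OF n])
    finally show ?thesis .
  qed
  note d0 = nn[of "\<lambda>j x. \<phi>s l j x - \<phi> j x" for l]
  have bound: "L2_norm_vec n (\<lambda>j x. u j x t - us l j x t) \<le> K * ?d l" if t: "t \<in> {0..T}" for l t
  proof -
    have sol: "classical_solution n m P (\<lambda>j x t. A j) (\<lambda>j x t. B j) (\<lambda>j x. \<phi> j x - \<phi>s l j x) (\<lambda>j x t. u j x t - us l j x t)"
      using classical_solution_diff[OF mn u us[rule_format]] .
    have "L2_norm_unit (\<lambda>x. u j x t - us l j x t) \<le> K * ?d l" if j: "j < n" for j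
    proof -
      have init: "L2_sq (\<lambda>x. u k x 0 - us l k x 0) \<le> (?d l)\<^sup>2" if k: "k < n" for k
      proof -
        have "L2_sq (\<lambda>x. u k x 0 - us l k x 0) = L2_sq (\<lambda>x. \<phi>s l k x - \<phi> k x)"
          unfolding L2_sq_def
          by (rule Bochner_Integration.integral_cong)
             (use u us k in \<open>auto simp: classical_solution_def power2_commute\<close>)
        also have "\<dots> = (L2_norm_unit (\<lambda>x. \<phi>s l k x - \<phi> k x))\<^sup>2"
          by (simp add: L2_norm_unit_sq L2_sq_nonneg)
        also have "\<dots> \<le> (?d l)\<^sup>2"
          by (intro power_mono L2_norm_unit_le_vec[OF k]) (simp add: L2_norm_unit_sq L2_sq_nonneg)
        finally show ?thesis .
      qed
      have "L2_sq (\<lambda>x. u j x t - us l j x t) \<le> C * exp (Q * t) * (\<Sum>k<n. L2_sq (\<lambda>x. u k x 0 - us l k x 0))"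
        using est[OF sol j] t by auto
      also have "\<dots> \<le> C * exp (Q * T) * (\<Sum>k<n. (?d l)\<^sup>2)"
        using t C Q by (intro mult_mono sum_mono init) (auto intro!: sum_nonneg L2_sq_nonneg mult_left_mono)
      finally have "L2_sq (\<lambda>x. u j x t - us l j x t) \<le> C * exp (Q * T) * real n * (?d l)\<^sup>2" by simp
      from real_sqrt_le_mono[OF this] show ?thesis
        by (simp add: L2_norm_unit_sq K_def real_sqrt_mult d0)
    qed
    then show ?thesis
      unfolding L2_norm_vec_def[of n "\<lambda>j x. u j x t - us l j x t"] using n by (subst Max_le_iff) auto
  qed
  show "uniform_limit {0..T} (\<lambda>l t. L2_norm_vec n (\<lambda>j x. u j x t - us l j x t)) (\<lambda>_. 0) sequentially"
  proof (rule uniform_limitI)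
    fix \<epsilon> :: real assume "\<epsilon> > 0"
    have "(\<lambda>l. K * ?d l) \<longlonglongrightarrow> 0" using tendsto_mult_right_zero[OF lim] .
    then have "eventually (\<lambda>l. K * ?d l < \<epsilon>) sequentially" using \<open>\<epsilon> > 0\<close> order_tendstoD(2) by blast
    then show "eventually (\<lambda>l. \<forall>t\<in>{0..T}. dist (L2_norm_vec n (\<lambda>j x. u j x t - us l j x t)) 0 < \<epsilon>) sequentially"
      by eventually_elim (use bound nn in \<open>fastforce dest: order.strict_trans1\<close>)
  qed
qed

section \<open>A persistent solution on a self-feeding set\<close>

text \<open>On the largest self-feeding set \<open>S\<close> take \<open>y\<^sub>k = s ^ k\<close>. Indices outside \<open>S\<close> have no arrow into
  \<open>S\<close> by maximality, so \<open>P y\<close> vanishes there. For \<open>j\<close> in \<open>S\<close> the entry \<open>(P y)\<^sub>j\<close> is a nonzero polynomial in \<open>s\<close>;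
  cancellations are avoided by choosing \<open>s\<close> outside the finitely many roots.\<close>

lemma self_feeding_balanced_vector:
  assumes "\<exists>T. self_feeding n P T"
  obtains y :: "nat \<Rightarrow> real" and j\<^sub>0 where "j\<^sub>0 < n" "y j\<^sub>0 \<noteq> 0"
    "\<And>j. j < n \<Longrightarrow> (\<Sum>k<n. P $$ (j, k) * y k) = 0 \<longleftrightarrow> y j = 0"
proof -
  define S where "S = \<Union> {T. self_feeding n P T}"
  have Sn: "S \<subseteq> {..<n}" by (auto simp: S_def self_feeding_def)
  have S0: "S \<noteq> {}" using assms by (auto simp: S_def self_feeding_def)
  have succ: "\<exists>k\<in>S. P $$ (j, k) \<noteq> 0" if "j \<in> S" for j
    using that unfolding S_def self_feeding_def by blast
  have S: "self_feeding n P S" using Sn S0 succ by (simp add: self_feeding_def)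
  have out: "P $$ (j, k) = 0" if "j < n" "j \<notin> S" "k \<in> S" for j k
  proof (rule ccontr)
    assume "P $$ (j, k) \<noteq> 0"
    then have "self_feeding n P (insert j S)"
      using S that unfolding self_feeding_def by blast
    then show False using that(2) unfolding S_def by blast
  qed
  define p where "p j = (\<Sum>k\<in>S. monom (P $$ (j, k)) k)" for j
  have fin: "finite S" using Sn finite_subset by blast
  have pc: "coeff (p j) k = P $$ (j, k)" if "k \<in> S" for j k
    unfolding p_def coeff_sum using fin that by (simp add: sum.delta)
  have "p j \<noteq> 0" if "j \<in> S" for j
    using succ[OF that] pc by (metis coeff_0)
  then have "[:0, 1:] * (\<Prod>j\<in>S. p j) \<noteq> 0"
    using fin by (simp add: prod_zero_iff)
  then obtain s where s: "poly ([:0, 1:] * (\<Prod>j\<in>S. p j)) s \<noteq> 0"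
    using poly_all_0_iff_0 by blast
  then have s0: "s \<noteq> 0" and ps: "\<And>j. j \<in> S \<Longrightarrow> poly (p j) s \<noteq> 0"
    using fin by (auto simp: poly_prod prod_zero_iff)
  define y where "y k = (if k \<in> S then s ^ k else 0)" for k
  have sum: "(\<Sum>k<n. P $$ (j, k) * y k) = poly (p j) s" for j
  proof -
    have "(\<Sum>k<n. P $$ (j, k) * y k) = (\<Sum>k\<in>S. P $$ (j, k) * y k)"
      by (rule sum.mono_neutral_right) (use Sn in \<open>auto simp: y_def\<close>)
    then show ?thesis by (simp add: p_def poly_sum poly_monom y_def)
  qed
  obtain j0 where j0: "j0 \<in> S" using S0 by blast
  show thesis
  proof (rule that[of j0 y])
    show "j0 < n" "y j0 \<noteq> 0" using j0 Sn s0 by (auto simp: y_def)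
    fix j assume j: "j < n"
    show "(\<Sum>k<n. P $$ (j, k) * y k) = 0 \<longleftrightarrow> y j = 0"
    proof (cases "j \<in> S")
      case True
      then show ?thesis using ps[OF True] s0 unfolding sum by (simp add: y_def)
    next
      case False
      then show ?thesis using out[OF j] by (simp add: y_def sum.neutral)
    qed
  qed
qed

lemma admissible_constant:
  assumes mn: "m \<le> n" and n: "n > 0"
    and Apos: "\<And>j. j < m \<Longrightarrow> A j > 0" and Aneg: "\<And>j. m \<le> j \<Longrightarrow> j < n \<Longrightarrow> A j < (0 :: real)"
  shows "admissible n m (\<lambda>j x t. A j) (\<lambda>j x t. B j)"
proof -
  have C: "C1_with (\<lambda>x t. k) (\<lambda>x t. 0) (\<lambda>x t. 0)" for k :: real
    by (simp add: C1_with_def split_beta)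
  have bdd: "bounded_on_strip f" if "\<And>x t. x \<in> {0..1} \<Longrightarrow> t \<ge> 0 \<Longrightarrow> f x t = k" for f and k :: real
    unfolding bounded_on_strip_def bounded_iff
    by (intro exI[of _ "\<bar>k\<bar>"]) (auto simp: strip_def that)
  have "C1_strip f \<and> bounded_on_strip f \<and> bounded_on_strip (partial_x f) \<and> bounded_on_strip (partial_t f)"
    if "f = (\<lambda>x t. k)" for f and k :: real
    unfolding that using C1_with_imp_C1_strip[OF C] C1_with_partials[OF C]
    by (auto intro: bdd)
  moreover
  let ?\<alpha> = "Min ((\<lambda>j. \<bar>A j\<bar>) ` {..<n})"
  have "A j \<noteq> 0" if "j < n" for j using Apos[of j] Aneg[of j] that by (cases "j < m") auto
  then have "?\<alpha> > 0" using n by (subst Min_gr_iff) auto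
  moreover have "?\<alpha> \<le> \<bar>A j\<bar>" if "j < n" for j using that by (intro Min_le) auto
  then have "?\<alpha> \<le> A j" if "j < m" for j
    using that Apos[OF that] mn by (metis abs_of_pos order.strict_trans2)
  moreover have "A j \<le> - ?\<alpha>" if "j \<in> {m..<n}" for j
    using that Aneg[of j] \<open>\<And>j. j < n \<Longrightarrow> ?\<alpha> \<le> \<bar>A j\<bar>\<close>[of j] by auto
  ultimately show ?thesis unfolding admissible_def by (intro conjI exI[of _ ?\<alpha>]) auto
qed

text \<open>It suffices that a solution is nonzero, on a fixed interval, at arbitrarily late times; the even
  integers are such times for the solution constructed below.\<close>

lemma persistent_solution_not_robust:
  assumes n: "n > 0" and mn: "m \<le> n"
    and Apos: "\<And>j. j < m \<Longrightarrow> A j > 0" and Aneg: "\<And>j. m \<le> j \<Longrightarrow> j < n \<Longrightarrow> A j < (0 :: real)"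
    and u: "classical_solution n m P (\<lambda>j x t. A j) (\<lambda>j x t. B j) (\<lambda>j x. u j x 0) u"
    and j: "j < n" and lr: "l < r" "{l<..<r} \<subseteq> {0<..<1}"
    and nz: "\<And>N x. x \<in> {l<..<r} \<Longrightarrow> u j x (2 * real N) \<noteq> 0"
  shows "\<not> robust_FTS n m P"
proof
  assume "robust_FTS n m P"
  then have "FTS n m P (\<lambda>j x t. A j) (\<lambda>j x t. B j)"
    using admissible_constant[OF mn n Apos Aneg] by (simp add: robust_FTS_def)
  then obtain T where T: "\<And>\<phi> U t j. (\<forall>j<n. L2_unit (\<phi> j)) \<Longrightarrow>
      L2_generalized_solution n m P (\<lambda>j x t. A j) (\<lambda>j x t. B j) \<phi> U \<Longrightarrow> t > T \<Longrightarrow> j < n \<Longrightarrow>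
      AE x in unit_measure. U j t x = 0"
    unfolding FTS_def by blast
  have "L2_continuous (\<lambda>t x. u j x t)" if "j < n" for j
    using u that by (intro C1_strip_L2_continuous) (simp add: classical_solution_def)
  then have L2: "\<forall>j<n. L2_unit (\<lambda>x. u j x 0)" by (simp add: L2_continuous_def)
  obtain N :: nat where "2 * real N > T"
    using reals_Archimedean2[of "T / 2"] by (metis divide_less_eq_numeral1(1) mult.commute)
  from T[OF L2 classical_imp_generalized[OF n mn Apos Aneg u] this j]
  have "AE x in lebesgue. x \<in> {0<..<1} \<longrightarrow> u j x (2 * real N) = 0"
    by (simp add: AE_restrict_space_iff)
  then obtain Z where Z: "Z \<in> null_sets lebesgue" "{x. \<not> (x \<in> {0<..<1} \<longrightarrow> u j x (2 * real N) = 0)} \<subseteq> Z"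
    unfolding eventually_ae_filter by auto
  have "{l<..<r} \<subseteq> Z" using Z(2) nz lr(2) by blast
  then have "negligible {l<..<r}" using Z(1) negligible_iff_null_sets negligible_subset by blast
  moreover have "open {l<..<r}" "{l<..<r} \<noteq> {}" using lr(1) by auto
  ultimately show False using open_not_negligible by blast
qed

text \<open>In the coordinate \<open>\<xi>\<close> measured from the inflow end, component \<open>j\<close> is the wave
  \<open>c\<^sub>j exp (\<rho>\<^sub>j \<xi>) cos (\<pi> (t - \<tau>\<^sub>j \<xi>))\<close>. It enters as \<open>c\<^sub>j cos (\<pi> t)\<close> and leaves as
  \<open>c\<^sub>j d\<^sub>j cos (\<pi> t) = y\<^sub>j cos (\<pi> t)\<close>, and the boundary condition reads \<open>c = P y\<close>.\<close>

theorem self_feeding_not_robust: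
  assumes n: "n > 0" and mn: "m \<le> n" and ex: "\<exists>T. self_feeding n P T"
  shows "\<not> robust_FTS n m P"
proof -
  obtain y j\<^sub>0 where j\<^sub>0: "j\<^sub>0 < n" "y j\<^sub>0 \<noteq> 0"
    and supp: "\<And>j. j < n \<Longrightarrow> (\<Sum>k<n. P $$ (j, k) * y k) = 0 \<longleftrightarrow> y j = 0"
    by (rule self_feeding_balanced_vector[OF ex]) blast
  define c where "c j = (\<Sum>k<n. P $$ (j, k) * y k)" for j
  \<comment> \<open>The factor that component \<open>j\<close> has to apply; where \<open>y j\<close> and \<open>c j\<close> vanish, any nonzero factor will do.\<close>
  define d where "d j = (if y j = 0 then 1 else y j / c j)" for j
  have d: "d j \<noteq> 0" "c j * d j = y j" if "j < n" for j
    using supp[OF that] by (auto simp: d_def c_def)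
  \<comment> \<open>A delay by \<open>1\<close> changes the sign of \<open>cos (\<pi> t)\<close>, a delay by \<open>2\<close> does not.\<close>
  define \<tau> where "\<tau> j = (if d j < 0 then 1 else 2 :: real)" for j
  have \<tau>: "\<tau> j > 0" "\<tau> j \<le> 2" for j by (auto simp: \<tau>_def)
  define \<rho> where "\<rho> j = ln \<bar>d j\<bar>" for j
  define A where "A j = (if j < m then 1 / \<tau> j else - (1 / \<tau> j))" for j
  define B where "B j = - \<rho> j / \<tau> j" for j
  define v where "v j \<xi> t = c j * (exp (\<rho> j * \<xi>) * cos (pi * (t - \<tau> j * \<xi>)))" for j \<xi> t
  define vx where "vx j \<xi> t = c j * (exp (\<rho> j * \<xi>) * \<rho> j * cos (pi * (t - \<tau> j * \<xi>))
      + exp (\<rho> j * \<xi>) * (sin (pi * (t - \<tau> j * \<xi>)) * (pi * \<tau> j)))" for j \<xi> t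
  define vt where "vt j \<xi> t = - c j * (exp (\<rho> j * \<xi>) * (sin (pi * (t - \<tau> j * \<xi>)) * pi))" for j \<xi> t
  have v: "C1_with (v j) (vx j) (vt j)" for j
    unfolding C1_with_def
  proof (intro conjI ballI allI impI)
    fix \<xi> t :: real
    show "((\<lambda>\<xi>. v j \<xi> t) has_real_derivative vx j \<xi> t) (at \<xi> within {0..1})"
      unfolding v_def vx_def by (auto intro!: derivative_eq_intros simp: algebra_simps)
    show "(v j \<xi> has_real_derivative vt j \<xi> t) (at t within {0..})"
      unfolding v_def[abs_def] vt_def by (auto intro!: derivative_eq_intros simp: algebra_simps)
  qed (unfold v_def vx_def vt_def split_beta, (intro continuous_intros)+)
  have eq: "vt j \<xi> t + 1 / \<tau> j * vx j \<xi> t + B j * v j \<xi> t = 0" for j \<xi> t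
    using \<tau>(1)[of j] by (simp add: vt_def vx_def v_def B_def field_simps)
  define u where "u j x t = (if j < m then v j x t else v j (1 - x) t)" for j x t
  have uC: "C1_with (u j) (if j < m then vx j else (\<lambda>x t. - vx j (1 - x) t))
      (if j < m then vt j else (\<lambda>x. vt j (1 - x)))" for j
    using v[of j] C1_with_reflect[OF v[of j]] by (auto simp: u_def[abs_def])
  have inn: "u j (inflow_end m j) t = c j * cos (pi * t)" for j t
    by (simp add: u_def v_def inflow_end_def)
  have out: "u j (1 - inflow_end m j) t = y j * cos (pi * t)" if j: "j < n" for j t
  proof -
    have "u j (1 - inflow_end m j) t = v j 1 t" by (simp add: u_def inflow_end_def)
    also have "\<dots> = c j * (\<bar>d j\<bar> * cos (pi * t - pi * \<tau> j))"
      using d(1)[OF j] by (simp add: v_def \<rho>_def algebra_simps)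
    also have "\<bar>d j\<bar> * cos (pi * t - pi * \<tau> j) = d j * cos (pi * t)"
      using d(1)[OF j] by (auto simp: \<tau>_def cos_diff mult.commute[of pi 2])
    also have "c j * (d j * cos (pi * t)) = y j * cos (pi * t)"
      using d(2)[OF j] by (simp flip: mult.assoc)
    finally show ?thesis .
  qed
  have bc: "boundary_op n m P u j t = c j * cos (pi * t)" for j t
    unfolding boundary_op_outflow[OF mn] c_def sum_distrib_right
    by (rule sum.cong) (simp_all add: out)
  have sol: "classical_solution n m P (\<lambda>j x t. A j) (\<lambda>j x t. B j) (\<lambda>j x. u j x 0) u"
    unfolding classical_solution_def
  proof (intro conjI allI impI ballI)
    show "C1_strip (u j)" for j by (rule C1_with_imp_C1_strip[OF uC])
    fix j and x t :: real assume "x \<in> {0<..<1}" "t > 0"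
    then have xt: "x \<in> {0..1}" "t \<ge> 0" by auto
    show "partial_t (u j) x t + A j * partial_x (u j) x t + B j * u j x t = 0"
      unfolding C1_with_partials[OF uC xt] using eq[of j x t] eq[of j "1 - x" t]
      by (auto simp: A_def u_def)
  next
    show "u j 0 t = boundary_op n m P u j t" if "j < m" for j t
      using inn[of j t] that by (simp add: bc inflow_end_def)
    show "u j 1 t = boundary_op n m P u j t" if "j \<in> {m..<n}" for j t
      using inn[of j t] that by (simp add: bc inflow_end_def)
  qed simp
  have Apos: "A j > 0" if "j < m" for j using \<tau>(1)[of j] that by (simp add: A_def)
  have Aneg: "A j < 0" if "m \<le> j" "j < n" for j using \<tau>(1)[of j] that by (simp add: A_def)
  have c0: "c j\<^sub>0 \<noteq> 0" using supp[OF j\<^sub>0(1)] j\<^sub>0(2) by (simp add: c_def)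
  have vnz: "v j\<^sub>0 \<xi> (2 * real N) \<noteq> 0" if "\<xi> \<in> {0<..<1/4}" for \<xi> N
  proof -
    have "cos (pi * (2 * real N - \<tau> j\<^sub>0 * \<xi>)) = cos (2 * pi * real N - pi * \<tau> j\<^sub>0 * \<xi>)"
      by (simp add: algebra_simps)
    also have "\<dots> = cos (pi * \<tau> j\<^sub>0 * \<xi>)"
      using sin_2npi[of N] cos_2npi[of N] by (simp add: cos_diff mult_ac)
    also have "\<dots> > 0"
    proof (rule cos_gt_zero_pi)
      have "\<tau> j\<^sub>0 * \<xi> < 2 * (1/4)"
        using that \<tau>[of j\<^sub>0] by (intro mult_le_less_imp_less) auto
      then have "pi * (\<tau> j\<^sub>0 * \<xi>) < pi * (1/2)" by (intro mult_strict_left_mono) auto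
      then show "pi * \<tau> j\<^sub>0 * \<xi> < pi / 2" by (simp add: mult_ac)
      have "0 \<le> pi * \<tau> j\<^sub>0 * \<xi>" using that \<tau>(1)[of j\<^sub>0] by (intro mult_nonneg_nonneg) auto
      then show "- (pi / 2) < pi * \<tau> j\<^sub>0 * \<xi>" using pi_half_gt_zero by linarith
    qed
    finally show ?thesis using c0 by (simp add: v_def)
  qed
  show ?thesis
  proof (cases "j\<^sub>0 < m")
    case True
    show ?thesis
      by (rule persistent_solution_not_robust[OF n mn Apos Aneg sol j\<^sub>0(1), of 0 "1/4"])
         (use vnz True in \<open>auto simp: u_def\<close>)
  next
    case False
    show ?thesis
      by (rule persistent_solution_not_robust[OF n mn Apos Aneg sol j\<^sub>0(1), of "3/4" 1])
         (use vnz False in \<open>auto simp: u_def\<close>)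
  qed
qed

section \<open>The equivalences\<close>

text \<open>A generalized solution is the limit of the classical solutions for approximating test data. These
  vanish after a time that does not depend on the data.\<close>

theorem acyclic_robust:
  assumes n: "n > 0" and mn: "m \<le> n" and acyclic: "\<not> (\<exists>T. self_feeding n P T)"
  shows "robust_FTS n m P"
  unfolding robust_FTS_def
proof (intro allI impI)
  fix a b assume adm: "admissible n m a b"
  obtain T where T: "T > 0" and sol: "\<And>\<phi>. (\<forall>j<n. C0inf_unit (\<phi> j)) \<Longrightarrow>
    \<exists>u. classical_solution n m P a b \<phi> u \<and> (\<forall>j<n. \<forall>x\<in>{0..1}. \<forall>t>T. u j x t = 0)"
    by (rule acyclic_classical_solution[OF mn adm acyclic]) blast
  have "AE x in unit_measure. U j t x = 0"
    if \<phi>: "\<forall>j<n. L2_unit (\<phi> j)" and U: "L2_generalized_solution n m P a b \<phi> U" and t: "t > T" and j: "j < n"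
    for \<phi> U t j
  proof -
    obtain \<phi>s where \<phi>s: "\<And>l j. j < n \<Longrightarrow> C0inf_unit (\<phi>s l j)"
      and lim: "(\<lambda>l. L2_norm_vec n (\<lambda>j x. \<phi>s l j x - \<phi> j x)) \<longlonglongrightarrow> 0"
      by (rule C0inf_unit_dense[OF n, of \<phi>]) (use \<phi> in blast)+
    have "\<forall>l. \<exists>u. classical_solution n m P a b (\<phi>s l) u \<and> (\<forall>j<n. \<forall>x\<in>{0..1}. \<forall>t>T. u j x t = 0)"
      using sol \<phi>s by blast
    from choice[OF this] obtain us where us_all: "\<forall>l. classical_solution n m P a b (\<phi>s l) (us l) \<and>
        (\<forall>j<n. \<forall>x\<in>{0..1}. \<forall>t>T. us l j x t = 0)" by (elim exE)
    then have us: "classical_solution n m P a b (\<phi>s l) (us l)" for l by blast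
    have us0: "us l j x t = 0" if "j < n" "x \<in> {0..1}" "t > T" for l j x t
      using us_all that by blast
    have "uniform_limit {0..t} (\<lambda>l t. L2_norm_vec n (\<lambda>j x. U j t x - us l j x t)) (\<lambda>_. 0) sequentially"
      using U lim \<phi>s us t T unfolding L2_generalized_solution_def by (meson order.strict_trans)
    then have "(\<lambda>l. L2_norm_vec n (\<lambda>j x. U j t x - us l j x t)) \<longlonglongrightarrow> 0"
      by (rule tendsto_uniform_limitI) (use t T in auto)
    moreover have "L2_norm_unit (U j t) \<le> L2_norm_vec n (\<lambda>j x. U j t x - us l j x t)" for l
    proof -
      have "L2_norm_unit (U j t) = L2_norm_unit (\<lambda>x. U j t x - us l j x t)"
        unfolding L2_norm_unit_def
        by (intro arg_cong[where f = sqrt] Bochner_Integration.integral_cong) (auto simp: us0 j t)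
      then show ?thesis using L2_norm_unit_le_vec[OF j, of "\<lambda>j x. U j t x - us l j x t"] by simp
    qed
    ultimately have "L2_norm_unit (U j t) \<le> 0"
      by (intro LIMSEQ_le_const) auto
    then have "L2_sq (U j t) = 0"
      using L2_sq_nonneg[of "U j t"] by (simp add: L2_norm_unit_sq)
    then have zero: "integral\<^sup>L unit_measure (\<lambda>x. (U j t x)\<^sup>2) = 0"
      by (simp add: L2_sq_def)
    have "L2_continuous (U j)" using U j by (simp add: L2_generalized_solution_def)
    then have "integrable unit_measure (\<lambda>x. (U j t x)\<^sup>2)"
      using t T by (simp add: L2_continuous_def L2_unit_def)
    then have "AE x in unit_measure. (U j t x)\<^sup>2 = 0"
      using zero by (subst (asm) integral_nonneg_eq_0_iff_AE) auto
    then show ?thesis by simp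
  qed
  then show "FTS n m P a b" unfolding FTS_def using T by blast
qed

theorem theorem1p8:
  fixes n m :: nat and P W :: "real mat"
  assumes "n \<ge> 2" and "m \<le> n"
    and "P \<in> carrier_mat n n"
    and "W = sgn_abs_mat P"
  shows "(robust_FTS n m P \<longleftrightarrow>
            (\<forall>i :: nat \<Rightarrow> nat. (\<forall>l\<le>n. i l < n) \<longrightarrow> (\<Prod>l<n. W $$ (i l, i (Suc l))) = 0))
       \<and> ((\<forall>i :: nat \<Rightarrow> nat. (\<forall>l\<le>n. i l < n) \<longrightarrow> (\<Prod>l<n. W $$ (i l, i (Suc l))) = 0) \<longleftrightarrow>
            (\<forall>I. I \<noteq> {} \<and> I \<subseteq> {..<n} \<longrightarrow> principal_minor W I = 0))
       \<and> ((\<forall>I. I \<noteq> {} \<and> I \<subseteq> {..<n} \<longrightarrow> principal_minor W I = 0) \<longleftrightarrow>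
            (nilpotent_mat W \<and> W ^\<^sub>m n = 0\<^sub>m n n))"
proof -
  have n: "n > 0" using assms(1) by simp
  have W: "W \<in> carrier_mat n n" using assms(3,4) by (simp add: sgn_abs_mat_def)
  have nonneg: "W $$ (i, j) \<ge> 0" if "i < n" "j < n" for i j
    using assms(3,4) that by (simp add: sgn_abs_mat_def sgn_if)
  have powers: "(\<exists>T. self_feeding n W T) \<longleftrightarrow> \<not> (nilpotent_mat W \<and> W ^\<^sub>m n = 0\<^sub>m n n)"
    by (rule self_feeding_iff_pow[OF W nonneg])
  have "robust_FTS n m P \<longleftrightarrow> \<not> (\<exists>T. self_feeding n P T)"
    using self_feeding_not_robust[OF n assms(2)] acyclic_robust[OF n assms(2)] by blast
  also have "(\<exists>T. self_feeding n P T) \<longleftrightarrow> (\<exists>T. self_feeding n W T)"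
    unfolding assms(4) self_feeding_sgn_abs[OF assms(3)] ..
  finally show ?thesis
    using self_feeding_iff_walk[of n W] self_feeding_iff_minor[OF W] powers by argo
qed

end
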